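(* Let $(\mu_t)_{t\ge0}$ be a $\boxplus$-semigroup with Lévy measure $\sigma_{\mu_1}$ and assume that $n(\mathrm{supp}(\sigma_{\mu_1}))<\infty$. The evolution $(\mu_t\boxplus\nu)_{t\ge0}$ starting at $\nu\in\mathcal{P}_{\mathbb{R}}$ satisfies $n(\mathrm{supp}(\mu_t\boxplus\nu))<\infty$ for all $t\ge0$ if and only if $n(\mathrm{supp}(\nu))<\infty$.
   Context: $\mathcal{P}_{\mathbb{R}}$ is the set of Borel probability measures on $\mathbb{R}$, $\boxplus$ is free additive convolution, $\mathrm{supp}$ is topological (closed) support, and for $S\subset\mathbb{R}$, $n(S)<\infty$ means that $S$ has finitely many connected components. A $\boxplus$-semigroup is a family $(\mu_t)_{t\ge0}\subset\mathcal{P}_{\mathbb{R}}$ with $\mu_{t+s}=\mu_t\boxplus\mu_s$ for $s,t\ge0$, $\mu_0=\delta_0$, and $\mu_t\to\delta_0$ weakly as $t\to0$; each $\mu_t$ is $\boxplus$-infinitely divisible. For $\boxplus$-infinitely divisible $\mu$, with $F_\mu=1/G_\mu$ and $G_\mu(z)=\int\frac{d\mu(s)}{z-s}$, the Voiculescu transform $\varphi_\mu(z)=F_\mu^{-1}(z)-z$ (defined first on a truncated cone) extends to the upper half-plane by $\varphi_\mu(z)=\gamma_\mu+\int_{\mathbb{R}}\frac{1+sz}{z-s}\,d\sigma_\mu(s)$ with unique $\gamma_\mu\in\mathbb{R}$ and finite positive Borel measure $\sigma_\mu$, the Lévy measure of $\mu$. The Lévy measure of the semigroup is $\sigma_{\mu_1}$.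 *)

theory Defs
  imports "HOL-Probability.Probability"
begin

text \<open>Borel probability measures on the real line are the measures satisfying
  \<^locale>\<open>real_distribution\<close>.\<close>

definition measure_support :: "real measure \<Rightarrow> real set" where
  "measure_support M = {x. \<forall>U. open U \<and> x \<in> U \<longrightarrow> emeasure M U > 0}"

definition cauchy_transform :: "real measure \<Rightarrow> complex \<Rightarrow> complex" where
  "cauchy_transform M z = (\<integral>s. 1 / (z - complex_of_real s) \<partial>M)"

definition F_transform :: "real measure \<Rightarrow> complex \<Rightarrow> complex" where
  "F_transform M z = 1 / cauchy_transform M z"

definition truncated_cone :: "real \<Rightarrow> real \<Rightarrow> complex set" where
  "truncated_cone a b = {z. b < Im z \<and> \<bar>Re z\<bar> < a * Im z}"

text \<open>\<open>\<phi>\<close> is the Voiculescu transform \<open>F\<inverse>(z) - z\<close> of \<open>M\<close> on \<open>D\<close>. A point may have several preimages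
  under \<open>F\<close> in the upper half-plane; the inverse meant is the one on a truncated cone on which
  \<open>F\<close> is injective. Any two such inverses agree far out in every sufficiently
  narrow cone, so no particular cone has to be singled out.\<close>

definition voiculescu_transform_on ::
    "real measure \<Rightarrow> complex set \<Rightarrow> (complex \<Rightarrow> complex) \<Rightarrow> bool" where
  "voiculescu_transform_on M D \<phi> \<longleftrightarrow>
     (\<exists>a>0. \<exists>b>0. inj_on (F_transform M) (truncated_cone a b) \<and>
        (\<forall>z\<in>D. z + \<phi> z \<in> truncated_cone a b \<and> F_transform M (z + \<phi> z) = z))"

text \<open>\<open>R\<close> is the free additive convolution of \<open>M\<close> and \<open>N\<close>: the Voiculescu transforms add up on
  some truncated cone. For probability measures \<open>M\<close> and \<open>N\<close>, possibly with unbounded support,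
  there is exactly one such \<open>R\<close> (Bercovici and Voiculescu).\<close>

definition is_free_convolution :: "real measure \<Rightarrow> real measure \<Rightarrow> real measure \<Rightarrow> bool" where
  "is_free_convolution M N R \<longleftrightarrow> real_distribution R \<and>
     (\<exists>a>0. \<exists>b>0. \<exists>\<phi> \<psi>.
        voiculescu_transform_on M (truncated_cone a b) \<phi> \<and>
        voiculescu_transform_on N (truncated_cone a b) \<psi> \<and>
        voiculescu_transform_on R (truncated_cone a b) (\<lambda>z. \<phi> z + \<psi> z))"

definition free_convolution :: "real measure \<Rightarrow> real measure \<Rightarrow> real measure"
    (infixl "\<boxplus>" 65) where
  "M \<boxplus> N = (THE R. is_free_convolution M N R)"

text \<open>The library has weak convergence only for sequences, hence the weak limit as \<open>t\<close> tends to
  \<open>0\<close> is taken along all positive null sequences.\<close>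

definition free_convolution_semigroup :: "(real \<Rightarrow> real measure) \<Rightarrow> bool" where
  "free_convolution_semigroup \<mu> \<longleftrightarrow>
     (\<forall>t\<ge>0. real_distribution (\<mu> t)) \<and>
     (\<forall>s\<ge>0. \<forall>t\<ge>0. is_free_convolution (\<mu> t) (\<mu> s) (\<mu> (t + s))) \<and>
     \<mu> 0 = return borel 0 \<and>
     (\<forall>\<tau>. (\<forall>n. \<tau> n > 0) \<and> \<tau> \<longlonglongrightarrow> 0 \<longrightarrow> weak_conv_m (\<lambda>n. \<mu> (\<tau> n)) (return borel 0))"

text \<open>The integral below is analytic on the upper half-plane, so by the identity theorem it suffices
  that it represents the Voiculescu transform on one truncated cone; it is then the analytic
  extension of that transform.\<close>

definition is_free_levy_measure :: "real measure \<Rightarrow> real measure \<Rightarrow> bool" where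
  "is_free_levy_measure M \<sigma> \<longleftrightarrow> finite_borel_measure \<sigma> \<and>
     (\<exists>\<gamma>. \<exists>a>0. \<exists>b>0. voiculescu_transform_on M (truncated_cone a b)
        (\<lambda>z. complex_of_real \<gamma> +
          (\<integral>s. (1 + complex_of_real s * z) / (z - complex_of_real s) \<partial>\<sigma>)))"

end

theory Submission
  imports Defs "HOL-Complex_Analysis.Complex_Analysis" "HOL-Real_Asymp.Real_Asymp"
begin

text \<open>Write \<open>\<rho> = \<mu>\<^sub>t \<boxplus> \<nu>\<close>, let \<open>\<phi>\<close> be the Voiculescu transform of \<open>\<mu>\<^sub>1\<close>, and put \<open>N = - t \<phi> \<circ> F\<^sub>\<nu>\<close> and
  \<open>H w = w - N w\<close>. Then \<open>G\<^sub>\<rho> = G\<^sub>\<nu> \<circ> \<omega>\<close>, where \<open>\<omega>\<close> is the right inverse of \<open>H\<close> on the upper half-plane. The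
  Cauchy--Schwarz inequality applied to the kernels of \<open>G\<^sub>\<nu>\<close> and \<open>\<phi>\<close> gives the Pick inequality
  \<open>\<bar>N w - N w'\<bar>\<^sup>2 \<le> \<bar>w - w'\<bar>\<^sup>2 K w K w'\<close> with \<open>K w = Im (N w) / Im w\<close>. It also holds at the real points
  outside \<open>supp \<nu>\<close> which \<open>F\<^sub>\<nu>\<close> maps outside \<open>supp \<sigma>\<close>; there \<open>K\<close> is the derivative of \<open>N\<close>. These points form
  a set \<open>W\<close> with finitely many components, since \<open>F\<^sub>\<nu>\<close> is monotone on the gaps of \<open>supp \<nu>\<close>.

  A gap of \<open>supp \<rho>\<close> is mapped by the boundary values of \<open>\<omega>\<close> into \<open>{p \<in> W. K p < 1}\<close>, and \<open>H\<close> maps this set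
  back outside \<open>supp \<rho>\<close>. By the Pick inequality the set \<open>{K < 1}\<close> is convex inside each component of \<open>W\<close>, so
  distinct gaps of \<open>supp \<rho>\<close> belong to distinct components of \<open>W\<close>. Conversely, \<open>\<mu>\<^sub>0 \<boxplus> \<nu> = \<nu>\<close>.\<close>

section \<open>Sets of reals with finitely many components\<close>

text \<open>Behaviour at the real line is controlled by one quantity, the energy: an integral over
  the inverse squared distance, equal to \<open>- Im T / Im z\<close> off the axis and to
  \<open>- T'\<close> at real points off the support. A real point is shown to lie outside a support
  by bounding the energy at upper half-plane points that accumulate at every point of a real
  neighbourhood. This stands in for boundary regularity of \<open>\<omega>\<close>, which is not
  known beforehand on a gap of \<open>supp \<rho>\<close>: the bounded energy of
  \<open>\<rho>\<close> is passed on to \<open>\<nu>\<close> and \<open>\<sigma>\<close> through the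
  equations for \<open>\<omega>\<close>.

  Since \<open>\<boxplus>\<close> is a definite description, a measure with the right Voiculescu
  transform has to be built and shown to be unique, and the transform of \<open>\<mu> t\<close> has
  to be identified as \<open>t\<close> times that of \<open>\<mu> 1\<close>. Zeros of the Cauchy
  transform are poles of \<open>F\<close> and are left out of the gaps; it decreases strictly on a
  gap, so no gap is lost. The case \<open>t = 0\<close> is separate, since \<open>\<rho>\<close>
  then carries no information about \<open>\<sigma>\<close>.\<close>

lemma finite_components_iff:
  "finite (components S) \<longleftrightarrow> (\<exists>\<I>. finite \<I> \<and> (\<forall>I\<in>\<I>. connected I) \<and> \<Union>\<I> = S)"
proof
  assume "finite (components S)"
  then show "\<exists>\<I>. finite \<I> \<and> (\<forall>I\<in>\<I>. connected I) \<and> \<Union>\<I> = S"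
    by (intro exI[of _ "components S"]) (auto simp: in_components_connected Union_components[symmetric])
next
  assume "\<exists>\<I>. finite \<I> \<and> (\<forall>I\<in>\<I>. connected I) \<and> \<Union>\<I> = S"
  then obtain \<I> where I: "finite \<I>" "\<And>I. I \<in> \<I> \<Longrightarrow> connected I" "\<Union>\<I> = S" by blast
  \<comment> \<open>One point is chosen in each member of the family. A component of
    \<open>S\<close> meets some member, hence contains all of it and in particular the chosen
    point.\<close>
  have "components S \<subseteq> (\<lambda>I. connected_component_set S (SOME x. x \<in> I)) ` \<I>"
  proof
    fix C assume "C \<in> components S"
    then obtain x where x: "x \<in> S" "C = connected_component_set S x" by (auto simp: components_def)
    then obtain I where J: "I \<in> \<I>" "x \<in> I" using I(3) by blast
    then have y: "(SOME y. y \<in> I) \<in> I" by (metis someI)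
    have "connected_component S x (SOME y. y \<in> I)"
      unfolding connected_component_def using J y I by blast
    then show "C \<in> (\<lambda>I. connected_component_set S (SOME x. x \<in> I)) ` \<I>"
      using J(1) unfolding x(2) by (intro image_eqI[of _ _ I] connected_component_eq)
        (auto intro: connected_component_sym)
  qed
  then show "finite (components S)" using I(1) finite_surj by blast
qed

lemma finite_components_connected: "connected S \<Longrightarrow> finite (components S)"
  unfolding finite_components_iff by (intro exI[of _ "{S}"]) auto

lemma finite_components_Un:
  assumes "finite (components S)" "finite (components T)"
  shows "finite (components (S \<union> T))"
proof -
  obtain \<I> \<J> where "finite \<I>" "\<forall>I\<in>\<I>. connected I" "\<Union>\<I> = S"
     "finite \<J>" "\<forall>I\<in>\<J>. connected I" "\<Union>\<J> = T"
    using assms unfolding finite_components_iff by blast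
  then show ?thesis unfolding finite_components_iff
    by (intro exI[of _ "\<I> \<union> \<J>"]) auto
qed

lemma finite_components_UN:
  assumes "finite A" "\<And>i. i \<in> A \<Longrightarrow> finite (components (S i))"
  shows "finite (components (\<Union>i\<in>A. S i))"
  using assms by (induction A rule: finite_induct) (auto intro: finite_components_Un)

lemma connected_Int_real:
  fixes S T :: "real set"
  shows "connected S \<Longrightarrow> connected T \<Longrightarrow> connected (S \<inter> T)"
  unfolding connected_iff_interval by blast

lemma finite_components_Int:
  fixes S T :: "real set"
  assumes "finite (components S)" "finite (components T)"
  shows "finite (components (S \<inter> T))"
proof -
  have "S \<inter> T = (\<Union>(A,B)\<in>components S \<times> components T. A \<inter> B)"
    using Union_components[of S] Union_components[of T] by blast
  moreover have "finite (components (\<Union>(A,B)\<in>components S \<times> components T. A \<inter> B))"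
    using assms by (intro finite_components_UN)
      (auto intro!: finite_components_connected connected_Int_real simp: in_components_connected)
  ultimately show ?thesis by simp
qed

text \<open>An order-convex set leaves only the points below all of it and the points above all of
  it.\<close>

lemma finite_components_Compl_connected:
  fixes S :: "real set"
  assumes "connected S"
  shows "finite (components (- S))"
proof (cases "S = {}")
  case True
  then show ?thesis by (auto intro: finite_components_connected)
next
  case False
  have *: "\<And>x y z. \<lbrakk>x \<in> S; z \<in> S; x \<le> y; y \<le> z\<rbrakk> \<Longrightarrow> y \<in> S"
    using assms connected_iff_interval by blast
  let ?A = "{x. \<forall>y\<in>S. x < y}" and ?B = "{x. \<forall>y\<in>S. y < x}"
  have "connected ?A" "connected ?B"
    unfolding connected_iff_interval by (auto intro: le_less_trans less_le_trans)
  moreover have "- S = ?A \<union> ?B"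
  proof (intro equalityI subsetI)
    fix x assume x: "x \<in> - S"
    show "x \<in> ?A \<union> ?B"
    proof (rule ccontr)
      assume "x \<notin> ?A \<union> ?B"
      then obtain y z where "y \<in> S" "y \<le> x" "z \<in> S" "x \<le> z" by (auto simp: not_less)
      then show False using *[of y z x] x by simp
    qed
  qed auto
  ultimately show ?thesis
    by (metis finite_components_Un finite_components_connected)
qed

lemma finite_components_Compl:
  fixes S :: "real set"
  assumes "finite (components S)"
  shows "finite (components (- S))"
proof -
  have *: "finite (components (\<Inter>I\<in>\<I>. - I))" if "finite \<I>" "\<forall>I\<in>\<I>. connected I" for \<I> :: "real set set"
    using that
    by (induction \<I> rule: finite_induct)
       (auto intro: finite_components_Int finite_components_Compl_connected finite_components_connected)
  obtain \<I> where "finite \<I>" "\<forall>I\<in>\<I>. connected I" "\<Union>\<I> = S"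
    using assms unfolding finite_components_iff by blast
  moreover have "- \<Union>\<I> = (\<Inter>I\<in>\<I>. - I)" by auto
  ultimately show ?thesis using *[of \<I>] by simp
qed

text \<open>An antitone map pulls order-convex sets back to order-convex sets, so every component of
  \<open>A\<close> contributes one interval. It is applied to the Cauchy transform on a gap and to
  the reciprocal on a half-line.\<close>

lemma finite_components_antimono_vimage:
  fixes L A :: "real set" and g :: "real \<Rightarrow> real"
  assumes "connected L" "finite (components A)"
    and g: "\<And>x y. x \<in> L \<Longrightarrow> y \<in> L \<Longrightarrow> x \<le> y \<Longrightarrow> g y \<le> g x"
  shows "finite (components {x\<in>L. g x \<in> A})"
proof -
  have "{x\<in>L. g x \<in> A} = (\<Union>I\<in>components A. {x\<in>L. g x \<in> I})"
    using Union_components[of A] by blast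
  moreover have "connected {x\<in>L. g x \<in> I}" if "I \<in> components A" for I
    unfolding connected_iff_interval
  proof safe
    fix x y z assume *: "x \<in> L" "g x \<in> I" "y \<in> L" "g y \<in> I" "x \<le> z" "z \<le> y"
    then show z: "z \<in> L" using assms(1) connected_iff_interval by blast
    have "g y \<le> g z" "g z \<le> g x" using g * z by auto
    then show "g z \<in> I" using in_components_connected[OF that] * connected_iff_interval by blast
  qed
  ultimately show ?thesis
    using finite_components_UN[OF assms(2), of "\<lambda>I. {x\<in>L. g x \<in> I}"]
    by (simp add: finite_components_connected)
qed

section \<open>Kernel integrals off the support\<close>

text \<open>Young's inequality with a free weight \<open>c\<close> is integrated, and
  \<open>c\<close> is then optimised. The product carries no conjugate, which is the form needed for
  kernels such as \<open>1 / ((z - s) * (z' - s))\<close>.\<close>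

lemma Cauchy_Schwarz_integral:
  fixes f g :: "'a \<Rightarrow> complex"
  assumes [measurable]: "f \<in> borel_measurable M" "g \<in> borel_measurable M"
    and f: "integrable M (\<lambda>x. (cmod (f x))\<^sup>2)" and g: "integrable M (\<lambda>x. (cmod (g x))\<^sup>2)"
  shows "cmod (\<integral>x. f x * g x \<partial>M) \<le> sqrt ((\<integral>x. (cmod (f x))\<^sup>2 \<partial>M) * (\<integral>x. (cmod (g x))\<^sup>2 \<partial>M))"
    and "integrable M (\<lambda>x. f x * g x)"
proof -
  have young: "cmod (f x * g x) \<le> (c * (cmod (f x))\<^sup>2 + (cmod (g x))\<^sup>2 / c) / 2" if "c > 0" for c x
  proof -
    have "0 \<le> (sqrt c * cmod (f x) - cmod (g x) / sqrt c)\<^sup>2" by simp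
    then show ?thesis using that
      by (simp add: power2_diff power_mult_distrib power_divide norm_mult)
  qed
  show i: "integrable M (\<lambda>x. f x * g x)"
  proof (rule Bochner_Integration.integrable_bound)
    show "integrable M (\<lambda>x. (1 * (cmod (f x))\<^sup>2 + (cmod (g x))\<^sup>2 / 1) / 2)" using f g by simp
    show "AE x in M. cmod (f x * g x) \<le> norm ((1 * (cmod (f x))\<^sup>2 + (cmod (g x))\<^sup>2 / 1) / 2)"
      using young[of 1] by (intro AE_I2) (smt (verit, best) real_norm_def)
  qed simp
  let ?A = "\<integral>x. (cmod (f x))\<^sup>2 \<partial>M" and ?B = "\<integral>x. (cmod (g x))\<^sup>2 \<partial>M"
  let ?X = "cmod (\<integral>x. f x * g x \<partial>M)"
  have A: "?A \<ge> 0" "?B \<ge> 0" by simp_all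
  have *: "?X \<le> (c * ?A + ?B / c) / 2" if "c > 0" for c
  proof -
    have "?X \<le> (\<integral>x. cmod (f x * g x) \<partial>M)" by simp
    also have "\<dots> \<le> (\<integral>x. (c * (cmod (f x))\<^sup>2 + (cmod (g x))\<^sup>2 / c) / 2 \<partial>M)"
      using i f g young[OF that] by (intro integral_mono) auto
    also have "\<dots> = (c * ?A + ?B / c) / 2" using f g by simp
    finally show ?thesis .
  qed
  have "?X \<le> sqrt ((?A + e) * (?B + e))" if "e > 0" for e
  proof -
    \<comment> \<open>The optimal weight is \<open>b / a\<close>. Adding \<open>e\<close> to both
      integrals keeps it positive and finite when one of them vanishes; \<open>e\<close> tends to 0
      at the end.\<close>
    define a b where "a = sqrt (?A + e)" and "b = sqrt (?B + e)"
    have ab: "a > 0" "b > 0" "a\<^sup>2 = ?A + e" "b\<^sup>2 = ?B + e" using A that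
      by (simp_all add: a_def b_def add_nonneg_pos)
    have "?X \<le> (b / a * ?A + ?B / (b / a)) / 2" by (rule *) (use ab in auto)
    also have "\<dots> \<le> (b / a * a\<^sup>2 + b\<^sup>2 / (b / a)) / 2"
      unfolding ab using ab(1,2) that by (intro divide_right_mono add_mono mult_left_mono) auto
    also have "\<dots> = a * b" using ab(1,2) by (simp add: power2_eq_square field_simps)
    finally show ?thesis by (simp add: a_def b_def real_sqrt_mult)
  qed
  moreover have "((\<lambda>e. sqrt ((?A + e) * (?B + e))) \<longlongrightarrow> sqrt ((?A + 0) * (?B + 0))) (at_right 0)"
    by (intro tendsto_intros)
  ultimately show "?X \<le> sqrt (?A * ?B)"
    by (intro tendsto_lowerbound[of _ "sqrt (?A * ?B)" "at_right 0"])
       (auto simp: eventually_at_right_less intro: eventually_mono[OF eventually_at_right_less])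
qed

text \<open>Stated with an almost-everywhere distance bound so that real and non-real points are
  treated alike: every non-real point qualifies, and a real one does exactly when it is outside
  \<open>measure_support\<close>.\<close>

definition off_support :: "real measure \<Rightarrow> complex \<Rightarrow> bool" where
  "off_support M z \<longleftrightarrow> (\<exists>d>0. AE s in M. d \<le> cmod (z - complex_of_real s))"

lemma cmod_ge_Im: "\<bar>Im z\<bar> \<le> cmod (z - complex_of_real s)"
  using abs_Im_le_cmod[of "z - complex_of_real s"] by simp

lemma off_support_Im: "Im z \<noteq> 0 \<Longrightarrow> off_support M z"
  unfolding off_support_def by (intro exI[of _ "\<bar>Im z\<bar>"]) (auto simp: cmod_ge_Im)

lemma off_support_cnj: "off_support M z \<Longrightarrow> off_support M (cnj z)"
proof -
  have "cmod (cnj z - complex_of_real s) = cmod (z - complex_of_real s)" for s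
    by (metis complex_cnj_complex_of_real complex_cnj_diff complex_mod_cnj)
  then show "off_support M z \<Longrightarrow> off_support M (cnj z)" unfolding off_support_def by simp
qed

text \<open>The triangle inequality: a shift by less than half of the distance \<open>d\<close>
  changes the distance to \<open>s\<close> by a factor of at most 2.\<close>

lemma off_support_near:
  assumes "off_support M z"
  obtains d where "d > 0" "AE s in M. d \<le> cmod (z - complex_of_real s)"
    "\<And>z'. dist z' z < d / 2 \<Longrightarrow> off_support M z'"
    "\<And>z'. dist z' z < d / 2 \<Longrightarrow>
       AE s in M. cmod (z - complex_of_real s) \<le> 2 * cmod (z' - complex_of_real s)"
proof -
  obtain d where d: "d > 0" "AE s in M. d \<le> cmod (z - complex_of_real s)"
    using assms unfolding off_support_def by (elim exE conjE)
  have *: "AE s in M. cmod (z - complex_of_real s) \<le> 2 * cmod (z' - complex_of_real s)"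
    if "dist z' z < d / 2" for z'
    using d(2)
  proof eventually_elim
    case (elim s)
    have "cmod (z - s) \<le> cmod (z - z') + cmod (z' - s)"
      by (metis diff_add_cancel add_diff_eq norm_triangle_ineq)
    also have "cmod (z - z') = dist z' z" by (simp add: dist_norm norm_minus_commute)
    finally show ?case using elim that by linarith
  qed
  have "off_support M z'" if "dist z' z < d / 2" for z'
  proof -
    have "AE s in M. d / 2 \<le> cmod (z' - complex_of_real s)"
      using d(2) *[OF that] by eventually_elim linarith
    then show ?thesis unfolding off_support_def using d(1) by (intro exI[of _ "d/2"]) simp
  qed
  with * show ?thesis by (intro that[OF d])
qed

lemma (in finite_borel_measure) off_support_of_real_iff:
  "off_support M (complex_of_real x) \<longleftrightarrow> x \<notin> measure_support M"
proof
  have [measurable_cong]: "sets M = sets borel" by (rule M_is_borel)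
  {
    assume "off_support M (complex_of_real x)"
    then obtain d where d: "d > 0" "AE s in M. d \<le> \<bar>x - s\<bar>"
      unfolding off_support_def by (auto simp flip: of_real_diff)
    from d(2) have "emeasure M {s \<in> space M. \<not> (d \<le> \<bar>x - s\<bar>)} = 0"
      by (subst (asm) AE_iff_measurable[OF _ refl]) auto
    also have "{s \<in> space M. \<not> (d \<le> \<bar>x - s\<bar>)} = ball x d"
      using sets_eq_imp_space_eq[OF M_is_borel] by (auto simp: dist_real_def)
    finally show "x \<notin> measure_support M"
      unfolding measure_support_def using d(1)
      by (auto intro!: exI[of _ "ball x d"])
  next
    assume "x \<notin> measure_support M"
    then obtain U where U: "open U" "x \<in> U" "emeasure M U = 0"
      unfolding measure_support_def by (auto simp: zero_less_iff_neq_zero)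
    then obtain d where d: "d > 0" "ball x d \<subseteq> U" by (meson open_contains_ball)
    have "AE s in M. s \<notin> U" using U by (intro AE_not_in) (auto simp: null_sets_def M_is_borel)
    then have "AE s in M. d \<le> cmod (complex_of_real x - complex_of_real s)"
      by eventually_elim (use d in \<open>auto simp: dist_real_def subset_iff not_le[symmetric] simp flip: of_real_diff\<close>)
    then show "off_support M (complex_of_real x)"
      unfolding off_support_def using d(1) by blast
  }
qed

text \<open>A Poisson-type integral. It is used with \<open>\<kappa> = 1\<close> for the Cauchy
  transform and with \<open>\<kappa> s = 1 + s\<^sup>2\<close> for the Voiculescu transform.\<close>

definition energy :: "real measure \<Rightarrow> (real \<Rightarrow> real) \<Rightarrow> complex \<Rightarrow> real" where
  "energy M \<kappa> z = (\<integral>s. \<kappa> s / (cmod (z - complex_of_real s))\<^sup>2 \<partial>M)"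

text \<open>Common frame for the Cauchy transform and the Levy integral: both have difference
  quotients given by one positive kernel. Pick inequality, imaginary part, derivative and continuity
  follow from \<open>T_diff\<close> and \<open>T_cnj\<close> alone. The bound on
  \<open>\<kappa>\<close> makes the energy finite.\<close>

locale kernel_transform = finite_borel_measure M for M :: "real measure" +
  fixes \<kappa> :: "real \<Rightarrow> real" and T :: "complex \<Rightarrow> complex"
  assumes \<kappa>_measurable [measurable]: "\<kappa> \<in> borel_measurable borel"
    and \<kappa>_nonneg: "\<And>s. 0 \<le> \<kappa> s" and \<kappa>_le: "\<And>s. \<kappa> s \<le> 1 + s\<^sup>2"
    and T_diff: "\<And>z z'. off_support M z \<Longrightarrow> off_support M z' \<Longrightarrow>
      T z - T z' = (z' - z) * (\<integral>s. complex_of_real (\<kappa> s) / ((z - of_real s) * (z' - of_real s)) \<partial>M)"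
    and T_cnj: "\<And>z. off_support M z \<Longrightarrow> T (cnj z) = cnj (T z)"
begin

lemma sets_M_borel [measurable_cong]: "sets M = sets borel"
  by (rule M_is_borel)

lemma energy_nonneg: "energy M \<kappa> z \<ge> 0"
  unfolding energy_def using \<kappa>_nonneg by simp

lemma integrable_energy:
  assumes "off_support M z"
  shows "integrable M (\<lambda>s. \<kappa> s / (cmod (z - complex_of_real s))\<^sup>2)"
proof -
  obtain d where d: "d > 0" "AE s in M. d \<le> cmod (z - complex_of_real s)"
    using assms unfolding off_support_def by (elim exE conjE)
  \<comment> \<open>From \<open>\<bar>s\<bar> \<le> cmod z + r\<close> the numerator is at most
    \<open>1 + 2 * (cmod z)\<^sup>2 + 2 * r\<^sup>2\<close>. Dividing by \<open>r\<^sup>2\<close>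
    and using \<open>d \<le> r\<close> in the constant part gives \<open>C\<close>.\<close>
  define C where "C = (1 + 2 * (cmod z)\<^sup>2) / d\<^sup>2 + 2"
  have "AE s in M. norm (\<kappa> s / (cmod (z - complex_of_real s))\<^sup>2) \<le> norm C"
    using d(2)
  proof eventually_elim
    case (elim s)
    define r where "r = cmod (z - complex_of_real s)"
    have r: "r > 0" "d \<le> r" using elim d(1) by (auto simp: r_def)
    have "\<bar>s\<bar> = cmod (z - (z - complex_of_real s))" by simp
    then have "\<bar>s\<bar> \<le> cmod z + r" unfolding r_def by (metis norm_triangle_ineq4)
    then have "s\<^sup>2 \<le> (cmod z + r)\<^sup>2" by (metis abs_ge_zero power2_abs power_mono)
    also have "\<dots> \<le> 2 * (cmod z)\<^sup>2 + 2 * r\<^sup>2"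
      using zero_le_power2[of "cmod z - r"] unfolding power2_sum power2_diff by linarith
    finally have "\<kappa> s \<le> 1 + 2 * (cmod z)\<^sup>2 + 2 * r\<^sup>2" using \<kappa>_le[of s] by linarith
    also have "1 + 2 * (cmod z)\<^sup>2 = ((1 + 2 * (cmod z)\<^sup>2) / d\<^sup>2) * d\<^sup>2" using d by simp
    also have "\<dots> \<le> ((1 + 2 * (cmod z)\<^sup>2) / d\<^sup>2) * r\<^sup>2"
      using r d(1) by (intro mult_left_mono power_mono) auto
    finally have "\<kappa> s \<le> C * r\<^sup>2" by (simp add: C_def algebra_simps)
    then have "\<kappa> s / r\<^sup>2 \<le> C" using r by (simp add: divide_le_eq)
    then show ?case using \<kappa>_nonneg[of s] by (simp add: r_def)
  qed
  from Bochner_Integration.integrable_bound[OF _ _ this] show ?thesis by simp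
qed

lemma sqrt_kernel_eq:
  "(cmod (complex_of_real (sqrt (\<kappa> s)) / (z - complex_of_real s)))\<^sup>2 = \<kappa> s / (cmod (z - complex_of_real s))\<^sup>2"
  using \<kappa>_nonneg[of s] by (simp add: norm_divide power_divide)

lemma
  assumes "off_support M z" "off_support M z'"
  shows integrable_kernel: "integrable M (\<lambda>s. complex_of_real (\<kappa> s) / ((z - of_real s) * (z' - of_real s)))"
    and cmod_kernel_le: "cmod (\<integral>s. complex_of_real (\<kappa> s) / ((z - of_real s) * (z' - of_real s)) \<partial>M)
      \<le> sqrt (energy M \<kappa> z * energy M \<kappa> z')"
proof -
  let ?f = "\<lambda>z s. complex_of_real (sqrt (\<kappa> s)) / (z - complex_of_real s)"
  have eq: "?f z s * ?f z' s = complex_of_real (\<kappa> s) / ((z - of_real s) * (z' - of_real s))" for s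
    using \<kappa>_nonneg[of s] by (simp flip: of_real_mult)
  note CS = Cauchy_Schwarz_integral[of "?f z" M "?f z'"]
  show "integrable M (\<lambda>s. complex_of_real (\<kappa> s) / ((z - of_real s) * (z' - of_real s)))"
    using CS(2) integrable_energy assms unfolding sqrt_kernel_eq eq by simp
  show "cmod (\<integral>s. complex_of_real (\<kappa> s) / ((z - of_real s) * (z' - of_real s)) \<partial>M)
      \<le> sqrt (energy M \<kappa> z * energy M \<kappa> z')"
    using CS(1) integrable_energy assms unfolding sqrt_kernel_eq eq energy_def by simp
qed

text \<open>The Pick inequality with energies in place of \<open>Im T / Im z\<close>, so that it
  covers real points off the support as well.\<close>

lemma cmod_T_diff_le:
  assumes "off_support M z" "off_support M z'"
  shows "cmod (T z - T z') \<le> cmod (z - z') * sqrt (energy M \<kappa> z * energy M \<kappa> z')"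
  using T_diff[OF assms] cmod_kernel_le[OF assms]
  by (simp add: norm_mult norm_minus_commute mult_left_mono)

text \<open>The difference formula with \<open>cnj z\<close> as second point: there the kernel
  becomes the integrand of the energy.\<close>

lemma Im_T:
  assumes "off_support M z"
  shows "Im (T z) = - Im z * energy M \<kappa> z"
proof -
  have "(z - of_real s) * (cnj z - of_real s) = complex_of_real ((cmod (z - of_real s))\<^sup>2)" for s
    by (metis complex_cnj_complex_of_real complex_cnj_diff complex_norm_square of_real_power)
  then have "T z - cnj (T z) = (cnj z - z) * (\<integral>s. complex_of_real (\<kappa> s / (cmod (z - of_real s))\<^sup>2) \<partial>M)"
    using T_diff[OF assms off_support_cnj[OF assms]] T_cnj[OF assms] by simp
  also have "(\<integral>s. complex_of_real (\<kappa> s / (cmod (z - of_real s))\<^sup>2) \<partial>M) = of_real (energy M \<kappa> z)"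
    unfolding energy_def by (rule integral_complex_of_real)
  finally have "Im (T z - cnj (T z)) = Im ((cnj z - z) * of_real (energy M \<kappa> z))" by simp
  then show ?thesis by simp
qed

lemma T_real: "off_support M (complex_of_real x) \<Longrightarrow> T (complex_of_real x) \<in> \<real>"
  using Im_T[of "complex_of_real x"] by (simp add: complex_is_Real_iff)

text \<open>Near \<open>z\<close> all integrands are dominated by multiples of the integrand of the
  energy at \<open>z\<close>, because \<open>cmod (z - s)\<close> is almost everywhere at least
  \<open>d\<close> and at most twice \<open>cmod (z' - s)\<close>. Continuity of the energy and
  differentiability of \<open>T\<close> are both read off from these bounds.\<close>

lemma energy_lipschitz:
  assumes "off_support M z"
  obtains d where "d > 0"
    "\<And>z'. dist z' z < d / 2 \<Longrightarrow> off_support M z'"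
    "\<And>z'. dist z' z < d / 2 \<Longrightarrow> energy M \<kappa> z' \<le> 4 * energy M \<kappa> z"
    "\<And>z'. dist z' z < d / 2 \<Longrightarrow> \<bar>energy M \<kappa> z' - energy M \<kappa> z\<bar> \<le> 6 / d * dist z' z * energy M \<kappa> z"
    "\<And>z'. dist z' z < d / 2 \<Longrightarrow>
      cmod ((\<integral>s. complex_of_real (\<kappa> s) / ((z' - of_real s) * (z - of_real s)) \<partial>M)
        - (\<integral>s. complex_of_real (\<kappa> s) / (z - of_real s)\<^sup>2 \<partial>M)) \<le> 2 / d * dist z' z * energy M \<kappa> z"
proof -
  obtain d where d: "d > 0"
    "AE s in M. d \<le> cmod (z - complex_of_real s)"
    and near: "\<And>z'. dist z' z < d / 2 \<Longrightarrow> off_support M z'"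
    "\<And>z'. dist z' z < d / 2 \<Longrightarrow>
       AE s in M. cmod (z - complex_of_real s) \<le> 2 * cmod (z' - complex_of_real s)"
    by (rule off_support_near[OF assms]) blast
  note int = integrable_energy[OF assms]
  let ?e = "\<lambda>z s. \<kappa> s / (cmod (z - complex_of_real s))\<^sup>2"
  have scale: "(\<integral>s. c * ?e z s \<partial>M) = c * energy M \<kappa> z" for c
    unfolding energy_def by (rule integral_mult_right_zero)
  have iscale: "integrable M (\<lambda>s. c * ?e z s)" for c
    using int by (rule integrable_mult_right)
  have tri: "\<bar>cmod (z' - complex_of_real s) - cmod (z - complex_of_real s)\<bar> \<le> dist z' z" for z' s
    using norm_triangle_ineq3[of "z' - complex_of_real s" "z - complex_of_real s"] by (simp add: dist_norm)
  have bound4: "AE s in M. ?e z' s \<le> 4 * ?e z s" if "dist z' z < d / 2" for z'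
    using d(2) near(2)[OF that]
  proof eventually_elim
    case (elim s)
    define r r' where "r = cmod (z - complex_of_real s)" and "r' = cmod (z' - complex_of_real s)"
    have r: "d \<le> r" "r \<le> 2 * r'" "r > 0" "r' > 0" using elim d(1) by (auto simp: r_def r'_def)
    have "\<kappa> s / r'\<^sup>2 \<le> \<kappa> s / (r / 2)\<^sup>2"
      using r \<kappa>_nonneg[of s] by (intro divide_left_mono power_mono) auto
    then show ?case by (simp add: r_def r'_def power_divide mult.commute)
  qed
  have le4: "energy M \<kappa> z' \<le> 4 * energy M \<kappa> z" if "dist z' z < d / 2" for z'
  proof -
    have "energy M \<kappa> z' \<le> (\<integral>s. 4 * ?e z s \<partial>M)"
      unfolding energy_def
      by (rule integral_mono_AE[OF integrable_energy[OF near(1)[OF that]] iscale bound4[OF that]])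
    then show ?thesis unfolding scale .
  qed
  have lip: "\<bar>energy M \<kappa> z' - energy M \<kappa> z\<bar> \<le> 6 / d * dist z' z * energy M \<kappa> z" if z': "dist z' z < d / 2" for z'
  proof -
    have "AE s in M. \<bar>?e z' s - ?e z s\<bar> \<le> 6 / d * dist z' z * ?e z s"
      using d(2) near(2)[OF z']
    proof eventually_elim
      case (elim s)
      define r r' where "r = cmod (z - complex_of_real s)" and "r' = cmod (z' - complex_of_real s)"
      have r: "d \<le> r" "r \<le> 2 * r'" "r > 0" "r' > 0" using elim d(1) by (auto simp: r_def r'_def)
      have "?e z' s - ?e z s = \<kappa> s * ((r - r') * ((r + r') / (r'\<^sup>2 * r\<^sup>2)))"
        using r by (simp add: r_def[symmetric] r'_def[symmetric] field_simps power2_eq_square)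
      also have "\<bar>\<dots>\<bar> \<le> \<kappa> s * (dist z' z * (6 / d * (1 / r\<^sup>2)))"
        unfolding abs_mult abs_of_nonneg[OF \<kappa>_nonneg]
      proof (intro mult_left_mono mult_mono)
        show "\<bar>r - r'\<bar> \<le> dist z' z" using tri[of z' s] by (simp add: r_def r'_def abs_minus_commute)
        have "(r + r') / (r'\<^sup>2 * r\<^sup>2) = (r / r'\<^sup>2 + 1 / r') * (1 / r\<^sup>2)"
          using r by (simp add: field_simps power2_eq_square)
        also have "r / r'\<^sup>2 \<le> r / (r / 2)\<^sup>2"
          using r by (intro divide_left_mono power_mono) auto
        also have "r / (r / 2)\<^sup>2 = 4 / r" using r by (simp add: power2_eq_square field_simps)
        also have "1 / r' \<le> 1 / (r / 2)" using r by (intro divide_left_mono) auto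
        also have "4 / r + 1 / (r / 2) = 6 / r" using r by simp
        also have "6 / r \<le> 6 / d" using r d(1) by (intro divide_left_mono) auto
        finally have "(r + r') / (r'\<^sup>2 * r\<^sup>2) \<le> 6 / d * (1 / r\<^sup>2)" using r by (simp add: divide_right_mono mult_right_mono)
        then show "\<bar>(r + r') / (r'\<^sup>2 * r\<^sup>2)\<bar> \<le> 6 / d * (1 / r\<^sup>2)" using r by simp
      qed (use \<kappa>_nonneg in auto)
      finally show ?case by (simp add: r_def mult_ac)
    qed
    from integral_mono_AE[OF _ iscale this]
    have "(\<integral>s. \<bar>?e z' s - ?e z s\<bar> \<partial>M) \<le> (\<integral>s. 6 / d * dist z' z * ?e z s \<partial>M)"
      using int integrable_energy[OF near(1)[OF z']] by simp
    moreover have "\<bar>energy M \<kappa> z' - energy M \<kappa> z\<bar> \<le> (\<integral>s. \<bar>?e z' s - ?e z s\<bar> \<partial>M)"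
      unfolding energy_def
      using int integrable_energy[OF near(1)[OF z']] integral_norm_bound[of M "\<lambda>s. ?e z' s - ?e z s"] by simp
    ultimately show ?thesis unfolding scale by linarith
  qed
  have der: "cmod ((\<integral>s. complex_of_real (\<kappa> s) / ((z' - of_real s) * (z - of_real s)) \<partial>M)
        - (\<integral>s. complex_of_real (\<kappa> s) / (z - of_real s)\<^sup>2 \<partial>M)) \<le> 2 / d * dist z' z * energy M \<kappa> z"
    if z': "dist z' z < d / 2" for z'
  proof -
    let ?a = "\<lambda>s. complex_of_real (\<kappa> s) / ((z' - of_real s) * (z - of_real s))"
    let ?b = "\<lambda>s. complex_of_real (\<kappa> s) / (z - of_real s)\<^sup>2"
    have i: "integrable M ?a" "integrable M ?b"
      using integrable_kernel[OF near(1)[OF z'] assms] integrable_kernel[OF assms assms] by (simp_all add: power2_eq_square)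
    have "AE s in M. cmod (?a s - ?b s) \<le> 2 / d * dist z' z * ?e z s"
      using d(2) near(2)[OF z']
    proof eventually_elim
      case (elim s)
      define r r' where "r = cmod (z - complex_of_real s)" and "r' = cmod (z' - complex_of_real s)"
      have r: "d \<le> r" "r \<le> 2 * r'" "r > 0" "r' > 0" using elim d(1) by (auto simp: r_def r'_def)
      have nz: "z - complex_of_real s \<noteq> 0" "z' - complex_of_real s \<noteq> 0" using r by (auto simp: r_def r'_def)
      have "?a s - ?b s = complex_of_real (\<kappa> s) * ((z - z') * (1 / ((z' - of_real s) * (z - of_real s)\<^sup>2)))"
      proof -
        have "k / (b * a) - k / a\<^sup>2 = k * ((a - b) * (1 / (b * a\<^sup>2)))" if "a \<noteq> 0" "b \<noteq> 0" for a b k :: complex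
          using that by (simp add: field_simps power2_eq_square)
        from this[OF nz] show ?thesis by simp
      qed
      also have "cmod \<dots> = \<kappa> s * (dist z' z * (1 / (r' * r\<^sup>2)))"
        using \<kappa>_nonneg[of s] by (simp add: norm_mult norm_divide norm_power r_def r'_def dist_norm norm_minus_commute)
      also have "\<dots> \<le> \<kappa> s * (dist z' z * (2 / d * (1 / r\<^sup>2)))"
      proof (intro mult_left_mono)
        have "1 / r' \<le> 1 / (d / 2)" using r d(1) by (intro divide_left_mono) auto
        then have "1 / r' * (1 / r\<^sup>2) \<le> 2 / d * (1 / r\<^sup>2)" using r by (intro mult_right_mono) auto
        then show "1 / (r' * r\<^sup>2) \<le> 2 / d * (1 / r\<^sup>2)" by simp
      qed (use \<kappa>_nonneg in auto)
      finally show ?case by (simp add: r_def mult_ac)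
    qed
    from integral_mono_AE[OF _ iscale this]
    have "(\<integral>s. cmod (?a s - ?b s) \<partial>M) \<le> (\<integral>s. 2 / d * dist z' z * ?e z s \<partial>M)"
      using int i by simp
    moreover have "cmod ((\<integral>s. ?a s \<partial>M) - (\<integral>s. ?b s \<partial>M)) \<le> (\<integral>s. cmod (?a s - ?b s) \<partial>M)"
      using i integral_norm_bound[of M "\<lambda>s. ?a s - ?b s"] by simp
    ultimately show ?thesis unfolding scale by linarith
  qed
  show thesis using that[OF d(1) near(1) le4 lip der] by simp
qed

lemma isCont_energy:
  assumes "off_support M z"
  shows "isCont (energy M \<kappa>) z"
proof -
  obtain d where d: "d > 0"
    "\<And>z'. dist z' z < d / 2 \<Longrightarrow> \<bar>energy M \<kappa> z' - energy M \<kappa> z\<bar> \<le> 6 / d * dist z' z * energy M \<kappa> z"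
    by (rule energy_lipschitz[OF assms]) blast
  have "\<forall>\<^sub>F z' in at z. dist z' z < d / 2" using d(1) by (auto simp: eventually_at intro!: exI[of _ "d/2"])
  then have "\<forall>\<^sub>F z' in at z. norm (energy M \<kappa> z' - energy M \<kappa> z) \<le> 6 / d * dist z' z * energy M \<kappa> z"
    by eventually_elim (use d(2) in auto)
  moreover have "((\<lambda>z'. 6 / d * dist z' z * energy M \<kappa> z) \<longlongrightarrow> 6 / d * dist z z * energy M \<kappa> z) (at z)"
    by (intro tendsto_intros)
  then have "((\<lambda>z'. 6 / d * dist z' z * energy M \<kappa> z) \<longlongrightarrow> 0) (at z)" by simp
  ultimately have "((\<lambda>z'. energy M \<kappa> z' - energy M \<kappa> z) \<longlongrightarrow> 0) (at z)"
    by (rule Lim_null_comparison)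
  then show ?thesis by (simp add: isCont_def LIM_zero_iff)
qed

lemma T_has_field_derivative:
  assumes "off_support M z"
  shows "(T has_field_derivative - (\<integral>s. complex_of_real (\<kappa> s) / (z - of_real s)\<^sup>2 \<partial>M)) (at z)"
proof -
  let ?k = "\<lambda>z'. \<integral>s. complex_of_real (\<kappa> s) / ((z' - of_real s) * (z - of_real s)) \<partial>M"
  let ?D = "\<integral>s. complex_of_real (\<kappa> s) / (z - of_real s)\<^sup>2 \<partial>M"
  obtain d where d: "d > 0"
    "\<And>z'. dist z' z < d / 2 \<Longrightarrow> off_support M z'"
    "\<And>z'. dist z' z < d / 2 \<Longrightarrow> cmod (?k z' - ?D) \<le> 2 / d * dist z' z * energy M \<kappa> z"
    by (rule energy_lipschitz[OF assms]) blast
  have ev: "\<forall>\<^sub>F z' in at z. dist z' z < d / 2 \<and> z' \<noteq> z" using d(1) by (auto simp: eventually_at intro!: exI[of _ "d/2"])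
  then have "\<forall>\<^sub>F z' in at z. cmod (?k z' - ?D) \<le> 2 / d * dist z' z * energy M \<kappa> z"
    by eventually_elim (use d(3) in auto)
  moreover have "((\<lambda>z'. 2 / d * dist z' z * energy M \<kappa> z) \<longlongrightarrow> 2 / d * dist z z * energy M \<kappa> z) (at z)"
    by (intro tendsto_intros)
  then have "((\<lambda>z'. 2 / d * dist z' z * energy M \<kappa> z) \<longlongrightarrow> 0) (at z)" by simp
  ultimately have "((\<lambda>z'. ?k z' - ?D) \<longlongrightarrow> 0) (at z)"
    by (rule Lim_null_comparison)
  then have "(?k \<longlongrightarrow> ?D) (at z)" by (simp add: LIM_zero_iff)
  then have "((\<lambda>z'. - ?k z') \<longlongrightarrow> - ?D) (at z)" by (rule tendsto_minus)
  moreover from ev have "\<forall>\<^sub>F z' in at z. - ?k z' = (T z' - T z) / (z' - z)"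
  proof eventually_elim
    case (elim z')
    have "T z' - T z = (z - z') * ?k z'" using T_diff[OF d(2) assms] elim by blast
    then show ?case using elim by (simp add: field_simps)
  qed
  ultimately have "((\<lambda>z'. (T z' - T z) / (z' - z)) \<longlongrightarrow> - ?D) (at z)"
    by (rule Lim_transform_eventually)
  then show ?thesis by (simp add: has_field_derivative_iff)
qed

lemma isCont_T: "off_support M z \<Longrightarrow> isCont T z"
  using T_has_field_derivative DERIV_isCont by blast

lemma T_holomorphic: "T holomorphic_on {z. Im z > 0}"
  using T_has_field_derivative off_support_Im
  by (auto simp: holomorphic_on_open open_halfspace_Im_gt)
     (metis less_irrefl)

text \<open>For real \<open>x\<close> the square \<open>(x - s)\<^sup>2\<close> equals its modulus,
  so the derivative is minus the energy. This is why such transforms decrease on the gaps of the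
  support.\<close>

lemma T_has_derivative_energy:
  assumes "off_support M (complex_of_real x)"
  shows "(T has_field_derivative - complex_of_real (energy M \<kappa> (of_real x))) (at (of_real x))"
proof -
  have "complex_of_real (\<kappa> s) / (of_real x - of_real s)\<^sup>2
      = complex_of_real (\<kappa> s / (cmod (of_real x - complex_of_real s))\<^sup>2)" for s
    by (simp flip: of_real_diff)
  then show ?thesis
    using T_has_field_derivative[OF assms] by (simp add: energy_def del: of_real_divide)
qed

end

section \<open>The Cauchy transform and the Levy integral as kernel transforms\<close>

lemma (in finite_borel_measure) integrable_inverse_off_support:
  assumes "off_support M z"
  shows "integrable M (\<lambda>s. 1 / (z - complex_of_real s))"
proof -
  have [measurable_cong]: "sets M = sets borel" by (rule M_is_borel)
  obtain d where d: "d > 0" "AE s in M. d \<le> cmod (z - complex_of_real s)"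
    using assms unfolding off_support_def by (elim exE conjE)
  from d(2) have "AE s in M. cmod (1 / (z - complex_of_real s)) \<le> norm (1 / d)"
    by eventually_elim (use d(1) in \<open>auto simp: norm_divide intro!: divide_left_mono mult_pos_pos\<close>)
  from Bochner_Integration.integrable_bound[OF _ _ this] show ?thesis by simp
qed

lemma off_support_AE_neq:
  assumes "off_support M z"
  shows "AE s in M. z - complex_of_real s \<noteq> 0"
proof -
  obtain d where d: "d > 0" "AE s in M. d \<le> cmod (z - complex_of_real s)"
    using assms unfolding off_support_def by (elim exE conjE)
  from d(2) show ?thesis by eventually_elim (use d(1) in auto)
qed

lemma (in finite_borel_measure) kernel_transform_cauchy:
  "kernel_transform M (\<lambda>_. 1) (cauchy_transform M)"
proof
  fix z z' assume z: "off_support M z" "off_support M z'"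
  have [measurable_cong]: "sets M = sets borel" by (rule M_is_borel)
  have ae: "AE s in M. 1 / (z - complex_of_real s) - 1 / (z' - complex_of_real s)
     = (z' - z) * (complex_of_real 1 / ((z - of_real s) * (z' - of_real s)))"
    using z[THEN off_support_AE_neq] by eventually_elim (simp add: field_simps)
  have "cauchy_transform M z - cauchy_transform M z'
    = (\<integral>s. 1 / (z - complex_of_real s) - 1 / (z' - complex_of_real s) \<partial>M)"
    using z[THEN integrable_inverse_off_support] by (simp add: cauchy_transform_def)
  also have "\<dots> = (\<integral>s. (z' - z) * (complex_of_real 1 / ((z - of_real s) * (z' - of_real s))) \<partial>M)"
    by (rule integral_cong_AE[OF _ _ ae]) measurable
  finally show "cauchy_transform M z - cauchy_transform M z'
    = (z' - z) * (\<integral>s. complex_of_real 1 / ((z - of_real s) * (z' - of_real s)) \<partial>M)"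
    unfolding integral_mult_right_zero .
next
  fix z
  show "cauchy_transform M (cnj z) = cnj (cauchy_transform M z)"
  proof -
    have "cauchy_transform M (cnj z) = (\<integral>s. cnj (1 / (z - complex_of_real s)) \<partial>M)"
      unfolding cauchy_transform_def by (intro Bochner_Integration.integral_cong) simp_all
    also have "\<dots> = cnj (\<integral>s. 1 / (z - complex_of_real s) \<partial>M)" by (rule Bochner_Integration.integral_cnj)
    finally show ?thesis by (simp only: cauchy_transform_def)
  qed
qed auto

definition levy_transform :: "real \<Rightarrow> real measure \<Rightarrow> complex \<Rightarrow> complex" where
  "levy_transform \<gamma> \<sigma> z = complex_of_real \<gamma> +
     (\<integral>s. (1 + complex_of_real s * z) / (z - complex_of_real s) \<partial>\<sigma>)"

text \<open>Bringing the two fractions \<open>(1 + s * z) / (z - s)\<close> to a common denominator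
  leaves \<open>(z' - z) * (1 + s\<^sup>2)\<close> on top, which is the origin of this
  \<open>\<kappa>\<close>.\<close>

lemma (in finite_borel_measure) kernel_transform_levy:
  "kernel_transform M (\<lambda>s. 1 + s\<^sup>2) (levy_transform \<gamma> M)"
proof
  have [measurable_cong]: "sets M = sets borel" by (rule M_is_borel)
  have int: "integrable M (\<lambda>s. (1 + complex_of_real s * z) / (z - complex_of_real s))"
    if z: "off_support M z" for z
  proof -
    \<comment> \<open>Division of \<open>1 + s * z\<close> by \<open>z - s\<close> reduces
      integrability to that of the Cauchy kernel.\<close>
    have "AE s in M. - z + (1 + z\<^sup>2) * (1 / (z - complex_of_real s))
        = (1 + complex_of_real s * z) / (z - complex_of_real s)"
      using off_support_AE_neq[OF z] by eventually_elim (simp add: field_simps power2_eq_square)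
    moreover have "integrable M (\<lambda>s. - z + (1 + z\<^sup>2) * (1 / (z - complex_of_real s)))"
      using integrable_inverse_off_support[OF z] by (intro Bochner_Integration.integrable_add integrable_mult_right) auto
    ultimately show ?thesis by (rule integrable_cong_AE_imp[rotated 2]) simp
  qed
  fix z z' assume z: "off_support M z" "off_support M z'"
  have ae: "AE s in M. (1 + complex_of_real s * z) / (z - complex_of_real s)
        - (1 + complex_of_real s * z') / (z' - complex_of_real s)
     = (z' - z) * (complex_of_real (1 + s\<^sup>2) / ((z - of_real s) * (z' - of_real s)))"
    using z[THEN off_support_AE_neq]
    by eventually_elim (simp add: divide_simps, simp add: algebra_simps power2_eq_square)
  have "levy_transform \<gamma> M z - levy_transform \<gamma> M z'
    = (\<integral>s. (1 + complex_of_real s * z) / (z - complex_of_real s)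
        - (1 + complex_of_real s * z') / (z' - complex_of_real s) \<partial>M)"
    using z[THEN int] by (simp add: levy_transform_def)
  also have "\<dots> = (\<integral>s. (z' - z) * (complex_of_real (1 + s\<^sup>2) / ((z - of_real s) * (z' - of_real s))) \<partial>M)"
    by (rule integral_cong_AE[OF _ _ ae]) measurable
  finally show "levy_transform \<gamma> M z - levy_transform \<gamma> M z'
    = (z' - z) * (\<integral>s. complex_of_real (1 + s\<^sup>2) / ((z - of_real s) * (z' - of_real s)) \<partial>M)"
    unfolding integral_mult_right_zero .
next
  fix z
  show "levy_transform \<gamma> M (cnj z) = cnj (levy_transform \<gamma> M z)"
  proof -
    have "levy_transform \<gamma> M (cnj z) = complex_of_real \<gamma>
        + (\<integral>s. cnj ((1 + complex_of_real s * z) / (z - complex_of_real s)) \<partial>M)"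
      unfolding levy_transform_def
      by (intro arg_cong2[where f="(+)"] Bochner_Integration.integral_cong) simp_all
    also have "(\<integral>s. cnj ((1 + complex_of_real s * z) / (z - complex_of_real s)) \<partial>M)
        = cnj (\<integral>s. (1 + complex_of_real s * z) / (z - complex_of_real s) \<partial>M)" by (rule Bochner_Integration.integral_cnj)
    finally show ?thesis by (simp only: levy_transform_def complex_cnj_add complex_cnj_complex_of_real)
  qed
qed auto

abbreviation cauchy_energy :: "real measure \<Rightarrow> complex \<Rightarrow> real" where
  "cauchy_energy M \<equiv> energy M (\<lambda>_. 1)"

abbreviation levy_energy :: "real measure \<Rightarrow> complex \<Rightarrow> real" where
  "levy_energy M \<equiv> energy M (\<lambda>s. 1 + s\<^sup>2)"

sublocale finite_borel_measure \<subseteq> cauchy: kernel_transform M "\<lambda>_. 1" "cauchy_transform M"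
  by (rule kernel_transform_cauchy)

sublocale finite_borel_measure \<subseteq> levy: kernel_transform M "\<lambda>s. 1 + s\<^sup>2" "levy_transform \<gamma> M" for \<gamma>
  by (rule kernel_transform_levy)

text \<open>For \<open>cmod z \<le> B\<close> the integrand of the energy dominates one strictly
  positive function of \<open>s\<close>, and a probability measure gives that function a positive
  integral. The uniform \<open>c\<close> later bounds \<open>Im (\<omega> z) / Im z\<close>.\<close>

lemma (in real_distribution) cauchy_energy_lower:
  obtains c where "c > 0" "\<And>z. off_support M z \<Longrightarrow> cmod z \<le> B \<Longrightarrow> c \<le> cauchy_energy M z"
proof -
  define f where "f s = 1 / (\<bar>B\<bar> + \<bar>s\<bar> + 1)\<^sup>2" for s :: real
  have f: "0 < f s" "f s \<le> 1" for s
  proof -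
    show "0 < f s" by (auto simp: f_def)
    have "1 \<le> (\<bar>B\<bar> + \<bar>s\<bar> + 1)\<^sup>2" using one_le_power[of "\<bar>B\<bar> + \<bar>s\<bar> + 1" 2] by simp
    then show "f s \<le> 1" by (simp add: f_def divide_le_eq)
  qed
  have [measurable]: "f \<in> borel_measurable borel" unfolding f_def by measurable
  have i: "integrable M f" using f by (intro integrable_const_bound[of _ 1]) (auto simp: abs_of_pos)
  have "integral\<^sup>L M f \<noteq> 0"
  proof
    assume "integral\<^sup>L M f = 0"
    then have "AE s in M. f s = 0"
      using i f by (subst (asm) integral_nonneg_eq_0_iff_AE) (auto intro: less_imp_le)
    then have "AE s in M. False" by eventually_elim (use f in \<open>metis less_irrefl\<close>)
    then show False by simp
  qed
  moreover have "integral\<^sup>L M f \<ge> 0" using f by (simp add: less_imp_le)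
  ultimately have pos: "integral\<^sup>L M f > 0" by linarith
  moreover have "integral\<^sup>L M f \<le> cauchy_energy M z" if z: "off_support M z" "cmod z \<le> B" for z
    unfolding energy_def
  proof (rule integral_mono_AE[OF i cauchy.integrable_energy[OF z(1)]])
    show "AE s in M. f s \<le> 1 / (cmod (z - complex_of_real s))\<^sup>2"
      using off_support_AE_neq[OF z(1)]
    proof eventually_elim
      case (elim s)
      have "cmod (z - complex_of_real s) \<le> cmod z + \<bar>s\<bar>"
        using norm_triangle_ineq4[of z "complex_of_real s"] by simp
      then show ?case unfolding f_def using elim z(2)
        by (intro divide_left_mono power_mono) auto
    qed
  qed
  ultimately show ?thesis using that by blast
qed

section \<open>The reciprocal Cauchy transform and its Pick inequality\<close>

context real_distribution
begin

lemma cauchy_energy_pos: "off_support M z \<Longrightarrow> cauchy_energy M z > 0"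
  by (rule cauchy_energy_lower[of "cmod z"]) (auto intro: less_le_trans)

lemma cauchy_transform_neq_0: "Im z > 0 \<Longrightarrow> cauchy_transform M z \<noteq> 0"
  using cauchy.Im_T[of z] cauchy_energy_pos[of z] off_support_Im[of z M] by fastforce

lemma cmod_cauchy_transform_le: "Im z > 0 \<Longrightarrow> cmod (cauchy_transform M z) \<le> 1 / Im z"
proof -
  assume z: "Im z > 0"
  have "cmod (cauchy_transform M z) \<le> (\<integral>s. cmod (1 / (z - complex_of_real s)) \<partial>M)"
    unfolding cauchy_transform_def by simp
  also have "\<dots> \<le> (\<integral>s. 1 / Im z \<partial>M)"
  proof (rule integral_mono)
    show "integrable M (\<lambda>s. cmod (1 / (z - complex_of_real s)))"
      using integrable_inverse_off_support[OF off_support_Im] z by simp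
    fix s show "cmod (1 / (z - complex_of_real s)) \<le> 1 / Im z"
      using cmod_ge_Im[of z s] z by (auto simp: norm_divide intro!: divide_left_mono mult_pos_pos)
  qed simp
  also have "\<dots> = 1 / Im z" using prob_space by simp
  finally show ?thesis .
qed

lemma cauchy_transform_holomorphic: "cauchy_transform M holomorphic_on {z. Im z > 0}"
  by (rule cauchy.T_holomorphic)

lemma F_transform_holomorphic: "F_transform M holomorphic_on {z. Im z > 0}"
  unfolding F_transform_def using cauchy_transform_neq_0
  by (intro holomorphic_intros cauchy_transform_holomorphic) auto

lemma Im_F_transform:
  "off_support M z \<Longrightarrow> Im (F_transform M z) = Im z * cauchy_energy M z / (cmod (cauchy_transform M z))\<^sup>2"
  unfolding F_transform_def Im_divide cmod_power2 by (simp add: cauchy.Im_T)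

text \<open>This is the Pick inequality for \<open>F - id\<close>, obtained without a representing
  measure for that function. The functions \<open>e w\<close> have squared norm
  \<open>Im (F w) / Im w - 1\<close>, and \<open>w - w'\<close> times the integral of
  \<open>e w * e w'\<close> is the difference of \<open>F - id\<close> at \<open>w\<close> and
  \<open>w'\<close>. The second claim says that the squared norm is nonnegative.\<close>

lemma F_transform_pick:
  assumes "Im w > 0" "Im w' > 0"
  shows "cmod ((F_transform M w - w) - (F_transform M w' - w'))
      \<le> cmod (w - w') * sqrt ((Im (F_transform M w) / Im w - 1) * (Im (F_transform M w') / Im w' - 1))"
    and "Im (F_transform M w) \<ge> Im w"
proof -
  define e where "e w s = 1 / (w - complex_of_real s) / cauchy_transform M w - 1" for w s
  have [measurable]: "e w \<in> borel_measurable M" for w unfolding e_def by measurable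
  have e2: "integrable M (\<lambda>s. (cmod (e w s))\<^sup>2)"
      "(\<integral>s. (cmod (e w s))\<^sup>2 \<partial>M) = Im (F_transform M w) / Im w - 1" if w: "Im w > 0" for w
  proof -
    have off: "off_support M w" using w off_support_Im by simp
    define g where "g = cauchy_transform M w"
    have g: "g \<noteq> 0" using cauchy_transform_neq_0[OF w] by (simp add: g_def)
    have i1: "integrable M (\<lambda>s. 1 / (w - complex_of_real s) / g)"
      using integrable_inverse_off_support[OF off] by (rule integrable_divide)
    have i2: "integrable M (\<lambda>s. 1 / (cmod (w - complex_of_real s))\<^sup>2 / (cmod g)\<^sup>2)"
      using cauchy.integrable_energy[OF off] by (rule integrable_divide)
    have eq: "(cmod (e w s))\<^sup>2 = 1 / (cmod (w - complex_of_real s))\<^sup>2 / (cmod g)\<^sup>2 -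
        2 * Re (1 / (w - complex_of_real s) / g) + 1" for s
    proof -
      have "(cmod (x - 1))\<^sup>2 = (cmod x)\<^sup>2 - 2 * Re x + 1" for x
        unfolding cmod_power2 by (simp add: power2_eq_square algebra_simps)
      then show ?thesis unfolding e_def g_def by (simp add: norm_divide norm_mult power_divide power_mult_distrib)
    qed
    show "integrable M (\<lambda>s. (cmod (e w s))\<^sup>2)"
      unfolding eq using i2 integrable_Re[OF i1]
      by (intro Bochner_Integration.integrable_add Bochner_Integration.integrable_diff integrable_mult_right) simp_all
    have "(\<integral>s. (cmod (e w s))\<^sup>2 \<partial>M) = (\<integral>s. 1 / (cmod (w - complex_of_real s))\<^sup>2 / (cmod g)\<^sup>2 \<partial>M)
      - 2 * (\<integral>s. Re (1 / (w - complex_of_real s) / g) \<partial>M) + 1"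
      unfolding eq using i2 integrable_Re[OF i1] prob_space by simp
    also have "(\<integral>s. 1 / (cmod (w - complex_of_real s))\<^sup>2 / (cmod g)\<^sup>2 \<partial>M) = cauchy_energy M w / (cmod g)\<^sup>2"
      unfolding energy_def by (rule integral_divide_zero)
    also have "\<dots> = Im (F_transform M w) / Im w"
      using w by (simp add: Im_F_transform[OF off] g_def)
    also have "(\<integral>s. Re (1 / (w - complex_of_real s) / g) \<partial>M) = Re (\<integral>s. 1 / (w - complex_of_real s) / g \<partial>M)"
      by (rule integral_Re[OF i1])
    also have "(\<integral>s. 1 / (w - complex_of_real s) / g \<partial>M) = g / g"
      unfolding integral_divide_zero by (simp add: g_def cauchy_transform_def)
    finally show "(\<integral>s. (cmod (e w s))\<^sup>2 \<partial>M) = Im (F_transform M w) / Im w - 1" using g by simp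
  qed
  show "Im (F_transform M w) \<ge> Im w"
  proof -
    have "0 \<le> Im (F_transform M w) / Im w - 1" unfolding e2(2)[OF assms(1), symmetric] by simp
    then show ?thesis using assms(1) by (simp add: le_divide_eq)
  qed
  have off: "off_support M w" "off_support M w'" using assms off_support_Im by simp_all
  define g g' where "g = cauchy_transform M w" and "g' = cauchy_transform M w'"
  have g: "g \<noteq> 0" "g' \<noteq> 0" using cauchy_transform_neq_0 assms by (simp_all add: g_def g'_def)
  let ?k = "\<lambda>s. complex_of_real 1 / ((w - complex_of_real s) * (w' - complex_of_real s))"
  have i: "integrable M (\<lambda>s. 1 / (w - complex_of_real s) / g)" "integrable M (\<lambda>s. 1 / (w' - complex_of_real s) / g')"
    "integrable M (\<lambda>s. ?k s / (g * g'))"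
    using off by (intro integrable_divide integrable_inverse_off_support cauchy.integrable_kernel; simp)+
  have "(\<integral>s. e w s * e w' s \<partial>M) = (\<integral>s. ?k s / (g * g') - 1 / (w - complex_of_real s) / g - 1 / (w' - complex_of_real s) / g' + 1 \<partial>M)"
    by (intro Bochner_Integration.integral_cong) (auto simp: e_def g_def g'_def algebra_simps)
  also have "\<dots> = (\<integral>s. ?k s / (g * g') \<partial>M) - (\<integral>s. 1 / (w - complex_of_real s) / g \<partial>M)
      - (\<integral>s. 1 / (w' - complex_of_real s) / g' \<partial>M) + 1"
    using i prob_space by simp
  also have "(\<integral>s. ?k s / (g * g') \<partial>M) = (\<integral>s. ?k s \<partial>M) / (g * g')" by (rule integral_divide_zero)
  also have "(\<integral>s. 1 / (w - complex_of_real s) / g \<partial>M) = g / g"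
    unfolding integral_divide_zero by (simp add: g_def cauchy_transform_def)
  also have "(\<integral>s. 1 / (w' - complex_of_real s) / g' \<partial>M) = g' / g'"
    unfolding integral_divide_zero by (simp add: g'_def cauchy_transform_def)
  finally have *: "(\<integral>s. e w s * e w' s \<partial>M) = (\<integral>s. ?k s \<partial>M) / (g * g') - 1"
    using g by simp
  have "(w - w') * (\<integral>s. e w s * e w' s \<partial>M) = ((w - w') * (\<integral>s. ?k s \<partial>M)) / (g * g') - (w - w')"
    unfolding * by (simp add: algebra_simps)
  also have "(w - w') * (\<integral>s. ?k s \<partial>M) = g' - g"
    using cauchy.T_diff[OF off] by (simp add: g_def g'_def algebra_simps)
  also have "(g' - g) / (g * g') = F_transform M w - F_transform M w'"
    unfolding F_transform_def using g by (simp add: g_def[symmetric] g'_def[symmetric] field_simps)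
  finally have "(F_transform M w - w) - (F_transform M w' - w') = (w - w') * (\<integral>s. e w s * e w' s \<partial>M)"
    by (simp add: algebra_simps)
  then show "cmod ((F_transform M w - w) - (F_transform M w' - w'))
      \<le> cmod (w - w') * sqrt ((Im (F_transform M w) / Im w - 1) * (Im (F_transform M w') / Im w' - 1))"
    using Cauchy_Schwarz_integral(1)[of "e w" M "e w'"] e2 assms
    by (simp add: norm_mult mult_left_mono)
qed

end

section \<open>Voiculescu transforms on truncated cones\<close>

lemma truncated_coneD:
  assumes "z \<in> truncated_cone a b" "0 < a" "0 < b"
  shows "b < Im z" "0 < Im z" "\<bar>Re z\<bar> < a * Im z" "cmod z \<le> (a + 1) * Im z"
  using assms cmod_le[of z] by (auto simp: truncated_cone_def algebra_simps)

lemma truncated_cone_mono: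
  "a \<le> a' \<Longrightarrow> b' \<le> b \<Longrightarrow> 0 \<le> b \<Longrightarrow> truncated_cone a b \<subseteq> truncated_cone a' b'"
proof
  fix z assume *: "a \<le> a'" "b' \<le> b" "0 \<le> b" "z \<in> truncated_cone a b"
  then have "a * Im z \<le> a' * Im z" by (intro mult_right_mono) (auto simp: truncated_cone_def)
  then show "z \<in> truncated_cone a' b'" using * unfolding truncated_cone_def mem_Collect_eq by linarith
qed

lemma open_truncated_cone: "open (truncated_cone a b)"
  unfolding truncated_cone_def by (intro open_Collect_conj open_Collect_less continuous_intros)

lemma convex_truncated_cone: "convex (truncated_cone a b)"
proof -
  have "truncated_cone a b = {z. b < Im z} \<inter> {z. Re z - a * Im z < 0} \<inter> {z. 0 < Re z + a * Im z}"
    by (auto simp: truncated_cone_def)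
  moreover have "convex {z. Re z - a * Im z < 0}" "convex {z. 0 < Re z + a * Im z}"
    using convex_halfspace_lt[of "Complex 1 (-a)" 0] convex_halfspace_gt[of 0 "Complex 1 a"]
    by (simp_all add: inner_complex_def)
  ultimately show ?thesis
    by (simp add: convex_Int convex_halfspace_Im_gt)
qed

text \<open>The left side is the modulus of the integral of \<open>s / (w - s)\<close>, whose
  integrand is at most \<open>\<bar>s\<bar> / b\<close> and at most \<open>a + 2\<close> in modulus
  on the cone. The measure enters only through the mean of a bounded continuous function, so the
  estimate is uniform along weakly convergent sequences.\<close>

lemma (in real_distribution) cmod_cauchy_transform_asymp:
  assumes "w \<in> truncated_cone a b" "0 < a" "0 < b"
  shows "cmod (w * cauchy_transform M w - 1) \<le> (a + 2) * (\<integral>s. min 1 (\<bar>s\<bar> / b) \<partial>M)"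
proof -
  note w = truncated_coneD[OF assms]
  have off: "off_support M w" using w by (intro off_support_Im) simp
  let ?f = "\<lambda>s. w * (1 / (w - complex_of_real s)) - 1"
  have i: "integrable M (\<lambda>s. w * (1 / (w - complex_of_real s)))"
    by (rule integrable_mult_right) (rule integrable_inverse_off_support[OF off])
  have im: "integrable M (\<lambda>s. min 1 (\<bar>s\<bar> / b))"
    using assms(3) by (intro integrable_const_bound[of _ 1]) auto
  have "w * cauchy_transform M w - 1 = (\<integral>s. ?f s \<partial>M)"
    unfolding cauchy_transform_def integral_mult_right_zero[symmetric]
    using i prob_space by (subst Bochner_Integration.integral_diff) auto
  also have "cmod \<dots> \<le> (\<integral>s. cmod (?f s) \<partial>M)" by simp
  also have "\<dots> \<le> (\<integral>s. (a + 2) * min 1 (\<bar>s\<bar> / b) \<partial>M)"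
  proof (rule integral_mono)
    fix s :: real
    define r where "r = cmod (w - complex_of_real s)"
    have r: "Im w \<le> r" "r > 0" using cmod_ge_Im[of w s] w by (auto simp: r_def)
    then have "w - complex_of_real s \<noteq> 0" by (auto simp: r_def)
    then have "?f s = s / (w - complex_of_real s)" by (simp add: field_simps)
    then have eq: "cmod (?f s) = \<bar>s\<bar> / r" by (simp add: norm_divide r_def)
    have "\<bar>s\<bar> / r \<le> \<bar>s\<bar> / b" using r w assms by (intro divide_left_mono) auto
    moreover have "\<bar>s\<bar> / b \<le> (a + 2) * (\<bar>s\<bar> / b)"
      using assms mult_right_mono[of 1 "a + 2" "\<bar>s\<bar> / b"] by simp
    moreover have "\<bar>s\<bar> / r \<le> a + 2"
    proof -
      have "\<bar>s\<bar> = cmod (w - (w - complex_of_real s))" by simp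
      also have "\<dots> \<le> cmod w + r" unfolding r_def by (rule norm_triangle_ineq4)
      also have "\<dots> \<le> (a + 1) * r + r" using w(4) r assms mult_left_mono[of "Im w" r "a+1"] by linarith
      also have "\<dots> = (a + 2) * r" by (simp add: algebra_simps)
      finally show ?thesis using r by (simp add: divide_le_eq)
    qed
    ultimately show "cmod (?f s) \<le> (a + 2) * min 1 (\<bar>s\<bar> / b)"
      unfolding eq using assms by (auto simp: min_def)
  next
    show "integrable M (\<lambda>s. cmod (?f s))" using i by simp
    show "integrable M (\<lambda>s. (a + 2) * min 1 (\<bar>s\<bar> / b))" using im by (rule integrable_mult_right)
  qed
  also have "\<dots> = (a + 2) * (\<integral>s. min 1 (\<bar>s\<bar> / b) \<partial>M)" by (rule integral_mult_right_zero)
  finally show ?thesis .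
qed

lemma (in real_distribution) tail_mean_tendsto_0:
  "((\<lambda>b. \<integral>s. min 1 (\<bar>s\<bar> / b) \<partial>M) \<longlongrightarrow> 0) at_top"
proof -
  have "((\<lambda>b. \<integral>s. min 1 (\<bar>s\<bar> / b) \<partial>M) \<longlongrightarrow> (\<integral>s. 0 \<partial>M)) at_top"
  proof (rule integral_dominated_convergence_at_top[where w="\<lambda>_. 1"])
    show "AE s in M. ((\<lambda>b. min 1 (\<bar>s\<bar> / b)) \<longlongrightarrow> 0) at_top"
    proof (rule AE_I2)
      fix s :: real
      have "((\<lambda>b. min 1 (\<bar>s\<bar> / b)) \<longlongrightarrow> min 1 0) at_top"
        by (intro tendsto_min tendsto_const tendsto_divide_0[OF tendsto_const] filterlim_at_top_imp_at_infinity filterlim_ident)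
      then show "((\<lambda>b. min 1 (\<bar>s\<bar> / b)) \<longlongrightarrow> 0) at_top" by simp
    qed
    show "\<forall>\<^sub>F b in at_top. AE s in M. norm (min 1 (\<bar>s\<bar> / b)) \<le> 1"
      using eventually_gt_at_top[of 0] by eventually_elim (auto intro!: AE_I2)
  qed auto
  then show ?thesis by simp
qed

text \<open>Measured against \<open>Im w\<close>, so that it bounds the factor
  \<open>Im (F w) / Im w - 1\<close> of the Pick inequality by \<open>\<eta>\<close>.\<close>

definition near_identity :: "real measure \<Rightarrow> real \<Rightarrow> real \<Rightarrow> real \<Rightarrow> bool" where
  "near_identity M \<eta> a b \<longleftrightarrow> (\<forall>w\<in>truncated_cone a b. cmod (F_transform M w - w) \<le> \<eta> * Im w)"

text \<open>With \<open>h = w * G w\<close> one has \<open>F w - w = w * (1 - h) / h\<close>. The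
  bound \<open>\<delta> \<le> 1 / 2\<close> keeps \<open>h\<close> away from 0, and
  \<open>cmod w\<close> is at most \<open>(a + 1) * Im w\<close> on the cone.\<close>

lemma cmod_F_transform_asymp:
  assumes "w \<in> truncated_cone a b" "0 < a" "0 < b"
    and "cmod (w * cauchy_transform M w - 1) \<le> \<delta>" "\<delta> \<le> 1 / 2"
  shows "cmod (F_transform M w - w) \<le> 2 * \<delta> * (a + 1) * Im w"
proof -
  note w = truncated_coneD[OF assms(1-3)]
  define h where "h = w * cauchy_transform M w"
  have h: "cmod (h - 1) \<le> \<delta>" using assms by (simp add: h_def)
  have "1 - cmod h \<le> cmod (h - 1)" using norm_triangle_ineq2[of 1 h] by (simp add: norm_minus_commute)
  then have h2: "cmod h \<ge> 1 / 2" using h assms by linarith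
  then have "h \<noteq> 0" by auto
  then have "F_transform M w - w = w * ((1 - h) / h)"
    unfolding F_transform_def by (simp add: h_def field_simps)
  also have "cmod \<dots> = cmod w * (cmod (h - 1) / cmod h)"
    by (simp add: norm_mult norm_divide norm_minus_commute)
  also have "\<dots> \<le> cmod w * (\<delta> / (1/2))"
    using h h2 by (intro mult_left_mono frac_le) (auto intro: order_trans[OF norm_ge_zero])
  also have "\<dots> \<le> ((a + 1) * Im w) * (\<delta> / (1/2))"
    using w(4) h by (intro mult_right_mono) (auto intro: order_trans[OF norm_ge_zero])
  finally show ?thesis by (simp add: mult_ac)
qed

lemma near_identityI:
  assumes "real_distribution M" "0 < a" "0 < b" "0 < \<eta>"
    and "(a + 2) * (\<integral>s. min 1 (\<bar>s\<bar> / b) \<partial>M) \<le> min (1 / 2) (\<eta> / (2 * (a + 1)))"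
  shows "near_identity M \<eta> a b"
  unfolding near_identity_def
proof
  fix w assume w: "w \<in> truncated_cone a b"
  let ?\<delta> = "min (1 / 2) (\<eta> / (2 * (a + 1)))"
  have "cmod (w * cauchy_transform M w - 1) \<le> ?\<delta>"
    using real_distribution.cmod_cauchy_transform_asymp[OF assms(1) w assms(2,3)] assms(5) by linarith
  from cmod_F_transform_asymp[OF w assms(2,3) this]
  have "cmod (F_transform M w - w) \<le> 2 * ?\<delta> * (a + 1) * Im w" by linarith
  also have "\<dots> \<le> 2 * (\<eta> / (2 * (a + 1))) * (a + 1) * Im w"
    using assms truncated_coneD[OF w assms(2,3)] by (intro mult_right_mono mult_left_mono) auto
  also have "\<dots> = \<eta> * Im w" using assms(2) by (simp add: field_simps)
  finally show "cmod (F_transform M w - w) \<le> \<eta> * Im w" .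
qed

lemma (in real_distribution) ex_near_identity:
  assumes "0 < a" "0 < \<eta>"
  shows "\<exists>b>0. near_identity M \<eta> a b"
proof -
  let ?\<delta> = "min (1 / 2) (\<eta> / (2 * (a + 1)))"
  have "((\<lambda>b. (a + 2) * (\<integral>s. min 1 (\<bar>s\<bar> / b) \<partial>M)) \<longlongrightarrow> (a + 2) * 0) at_top"
    by (intro tendsto_mult tendsto_const tail_mean_tendsto_0)
  then have "((\<lambda>b. (a + 2) * (\<integral>s. min 1 (\<bar>s\<bar> / b) \<partial>M)) \<longlongrightarrow> 0) at_top" by simp
  then have "\<forall>\<^sub>F b in at_top. (a + 2) * (\<integral>s. min 1 (\<bar>s\<bar> / b) \<partial>M) < ?\<delta>"
    by (rule order_tendstoD(2)) (use assms in auto)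
  then have "\<forall>\<^sub>F b in at_top. 0 < b \<and> (a + 2) * (\<integral>s. min 1 (\<bar>s\<bar> / b) \<partial>M) < ?\<delta>"
    using eventually_gt_at_top[of 0] by eventually_elim simp
  then obtain b where "0 < b" "(a + 2) * (\<integral>s. min 1 (\<bar>s\<bar> / b) \<partial>M) < ?\<delta>"
    using eventually_happens'[OF trivial_limit_at_top_linorder] by blast
  then show ?thesis
    using near_identityI[OF real_distribution_axioms assms(1) _ assms(2), of b] by auto
qed

text \<open>Both factors under the root in the Pick inequality lie between 0 and
  \<open>\<eta>\<close>; a sup bound on \<open>F - id\<close> thus becomes a Lipschitz bound on the
  same cone.\<close>

lemma (in real_distribution) near_identity_lipschitz:
  assumes "near_identity M \<eta> a b" "0 < a" "0 < b" "0 \<le> \<eta>"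
    and w: "w \<in> truncated_cone a b" "w' \<in> truncated_cone a b"
  shows "cmod ((F_transform M w - w) - (F_transform M w' - w')) \<le> \<eta> * cmod (w - w')"
proof -
  have *: "0 \<le> Im (F_transform M w) / Im w - 1" "Im (F_transform M w) / Im w - 1 \<le> \<eta>"
    if "w \<in> truncated_cone a b" for w
  proof -
    note c = truncated_coneD[OF that assms(2,3)]
    show "0 \<le> Im (F_transform M w) / Im w - 1"
      using F_transform_pick(2)[OF c(2) c(2)] c by (simp add: le_divide_eq)
    have "Im (F_transform M w) - Im w \<le> cmod (F_transform M w - w)"
      using abs_Im_le_cmod[of "F_transform M w - w"] by simp
    also have "\<dots> \<le> \<eta> * Im w" using assms(1) that by (simp add: near_identity_def)
    finally show "Im (F_transform M w) / Im w - 1 \<le> \<eta>" using c by (simp add: divide_le_eq algebra_simps)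
  qed
  have Im: "Im w > 0" "Im w' > 0" using w truncated_coneD(2)[OF _ assms(2,3)] by auto
  have "sqrt ((Im (F_transform M w) / Im w - 1) * (Im (F_transform M w') / Im w' - 1)) \<le> sqrt (\<eta> * \<eta>)"
    using *[OF w(1)] *[OF w(2)] by (intro real_sqrt_le_mono mult_mono) auto
  also have "\<dots> = \<eta>" using assms by simp
  finally have "cmod (w - w') * sqrt ((Im (F_transform M w) / Im w - 1) * (Im (F_transform M w') / Im w' - 1))
    \<le> cmod (w - w') * \<eta>" by (intro mult_left_mono) auto
  with F_transform_pick(1)[OF Im] show ?thesis by (simp add: mult.commute)
qed

lemma (in real_distribution) near_identity_inj_on:
  assumes "near_identity M \<eta> a b" "0 < a" "0 < b" "0 \<le> \<eta>" "\<eta> < 1"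
  shows "inj_on (F_transform M) (truncated_cone a b)"
proof (rule inj_onI, rule ccontr)
  fix w w' assume w: "w \<in> truncated_cone a b" "w' \<in> truncated_cone a b"
    and eq: "F_transform M w = F_transform M w'" "w \<noteq> w'"
  then have "cmod (w' - w) \<le> \<eta> * cmod (w - w')"
    using near_identity_lipschitz[OF assms(1-4) w] by simp
  also have "\<dots> < 1 * cmod (w - w')" using assms(5) eq by (intro mult_strict_right_mono) auto
  finally show False by (simp add: norm_minus_commute)
qed

lemma cball_subset_truncated_cone:
  assumes "0 < a" "0 < b" and z: "z \<in> truncated_cone (a / 2) (2 * b)"
    and w: "cmod (w - z) \<le> a / (2 + 2 * a) * Im z"
  shows "w \<in> truncated_cone a b"
proof -
  note c = truncated_coneD[OF z]
  \<comment> \<open>The solution of \<open>a / 2 + k = a * (1 - k)\<close>: moving by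
    \<open>k * Im z\<close> widens the aperture from \<open>a / 2\<close> to exactly
    \<open>a\<close>.\<close>
  define k where "k = a / (2 + 2 * a)"
  have k: "0 < k" "k \<le> 1 / 2" using assms by (auto simp: k_def divide_le_eq)
  have k2: "a / 2 + k = a * (1 - k)" using assms by (simp add: k_def field_simps)
  have "\<bar>Im w - Im z\<bar> \<le> k * Im z" "\<bar>Re w - Re z\<bar> \<le> k * Im z"
    using w abs_Im_le_cmod[of "w - z"] abs_Re_le_cmod[of "w - z"] by (auto simp: k_def)
  then have i: "(1 - k) * Im z \<le> Im w" and r: "\<bar>Re w\<bar> < (a / 2 + k) * Im z"
    using c assms by (auto simp: algebra_simps)
  have "(1 - k) * Im z \<ge> (1 / 2) * Im z" using k c assms by (intro mult_right_mono) auto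
  moreover have "(a / 2 + k) * Im z \<le> a * Im w"
    unfolding k2 using i assms mult_left_mono[OF i, of a] by (simp add: mult.assoc)
  ultimately show ?thesis using i r c assms unfolding truncated_cone_def mem_Collect_eq by linarith
qed

text \<open>\<open>F w = z\<close> is solved as the fixed point of
  \<open>w \<mapsto> z - (F w - w)\<close>, a contraction of the disc of radius
  \<open>2 * \<eta> * Im z\<close> about \<open>z\<close>. The value of \<open>\<eta>\<close> makes
  this radius the one allowed by \<open>cball_subset_truncated_cone\<close>. The explicit cone
  matters later, where a sequence of measures needs a common domain.\<close>

lemma (in real_distribution) near_identity_voiculescu:
  assumes a: "0 < a" and b: "0 < b" and near: "near_identity M (a / (4 + 4 * a)) a b"
  obtains \<phi> where "voiculescu_transform_on M (truncated_cone (a / 2) (2 * b)) \<phi>"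
    "\<phi> holomorphic_on truncated_cone (a / 2) (2 * b)"
    "\<And>z. z \<in> truncated_cone (a / 2) (2 * b) \<Longrightarrow> cmod (\<phi> z) \<le> 2 * cmod (F_transform M z - z)"
proof -
  let ?S = "truncated_cone a b" and ?D = "truncated_cone (a / 2) (2 * b)"
  define \<eta> where "\<eta> = a / (4 + 4 * a)"
  have \<eta>: "0 < \<eta>" "\<eta> \<le> 1 / 4" using a by (auto simp: \<eta>_def divide_le_eq)
  have near': "near_identity M \<eta> a b" using near by (simp add: \<eta>_def)
  have inj: "inj_on (F_transform M) ?S"
    using near_identity_inj_on[OF near' a b] \<eta> by simp
  have lip: "cmod ((F_transform M w - w) - (F_transform M w' - w')) \<le> \<eta> * cmod (w - w')"
    if "w \<in> ?S" "w' \<in> ?S" for w w'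
    using near_identity_lipschitz[OF near' a b _ that] \<eta> by simp
  have sol: "\<exists>w\<in>?S. F_transform M w = z \<and> cmod (w - z) \<le> 2 * cmod (F_transform M z - z)" if z: "z \<in> ?D" for z
  proof -
    note c = truncated_coneD[OF z]
    have zpos: "Im z > 0" using c a b by auto
    let ?B = "cball z (2 * \<eta> * Im z)"
    have sub: "?B \<subseteq> ?S"
    proof
      fix w assume "w \<in> ?B"
      then have "cmod (w - z) \<le> a / (2 + 2 * a) * Im z"
        using a by (simp add: dist_norm norm_minus_commute \<eta>_def field_simps)
      then show "w \<in> ?S" by (rule cball_subset_truncated_cone[OF a b z])
    qed
    let ?f = "\<lambda>w. z - (F_transform M w - w)"
    have "\<exists>!w. w \<in> ?B \<and> ?f w = w"
    proof (rule Banach_fix[OF complete_eq_closed[THEN iffD2, OF closed_cball], where c = \<eta>])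
      show "?B \<noteq> {}" using zpos \<eta> by (simp add: not_less)
      show "?f ` ?B \<subseteq> ?B"
      proof safe
        fix w assume w: "w \<in> ?B"
        have "\<bar>Im w - Im z\<bar> \<le> 2 * \<eta> * Im z"
          using w abs_Im_le_cmod[of "w - z"] by (simp add: dist_norm norm_minus_commute)
        then have "Im w \<le> (1 + 2 * \<eta>) * Im z" by (simp add: algebra_simps)
        also have "\<dots> \<le> 2 * Im z" using \<eta> zpos by (intro mult_right_mono) auto
        finally have "\<eta> * Im w \<le> 2 * \<eta> * Im z" using \<eta> mult_left_mono[of "Im w" "2 * Im z" \<eta>] by simp
        moreover have "cmod (F_transform M w - w) \<le> \<eta> * Im w"
          using near' sub w by (auto simp: near_identity_def)
        ultimately show "?f w \<in> ?B" by (simp add: dist_norm)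
      qed
      show "dist (?f w) (?f w') \<le> \<eta> * dist w w'" if "w \<in> ?B" "w' \<in> ?B" for w w'
      proof -
        have "dist (?f w) (?f w') = cmod ((F_transform M w - w) - (F_transform M w' - w'))"
          unfolding dist_norm by (metis (no_types, opaque_lifting) diff_diff_eq2 diff_minus_eq_add minus_diff_eq norm_minus_commute add_diff_cancel_left add.commute)
        then show ?thesis
          using lip[OF subsetD[OF sub that(1)] subsetD[OF sub that(2)]] by (simp add: dist_norm)
      qed
    qed (use \<eta> in auto)
    then obtain w where w: "w \<in> ?B" "?f w = w" by blast
    have zS: "z \<in> ?S" using sub zpos \<eta> by (auto intro!: subsetD[OF sub])
    have wS: "w \<in> ?S" using sub w by blast
    have Fw: "F_transform M w = z" using w(2) by (simp add: algebra_simps)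
    have "cmod (w - z) = cmod (F_transform M w - w)" by (simp add: Fw norm_minus_commute)
    also have "\<dots> \<le> cmod (F_transform M z - z) + \<eta> * cmod (w - z)"
      using lip[OF wS zS] norm_triangle_sub[of "F_transform M w - w" "F_transform M z - z"] by linarith
    finally have "(1 - \<eta>) * cmod (w - z) \<le> cmod (F_transform M z - z)" by (simp add: algebra_simps)
    moreover have "(1 / 2) * cmod (w - z) \<le> (1 - \<eta>) * cmod (w - z)" using \<eta> by (intro mult_right_mono) auto
    ultimately show ?thesis using wS Fw by (intro bexI[of _ w]) auto
  qed
  \<comment> \<open>The fixed points give existence only. Holomorphy comes from the inverse of the
    injective holomorphic map on the whole cone.\<close>
  have "F_transform M holomorphic_on ?S"
    using F_transform_holomorphic by (rule holomorphic_on_subset) (use b in \<open>auto simp: truncated_cone_def\<close>)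
  then obtain g where g: "g holomorphic_on F_transform M ` ?S" "\<And>w. w \<in> ?S \<Longrightarrow> g (F_transform M w) = w"
    using holomorphic_has_inverse[OF _ open_truncated_cone inj] by metis
  have gz: "g z \<in> ?S" "F_transform M (g z) = z" "cmod (g z - z) \<le> 2 * cmod (F_transform M z - z)" if "z \<in> ?D" for z
    using sol[OF that] g(2) by auto
  have "?D \<subseteq> F_transform M ` ?S" using sol by blast
  with g(1) have hol: "(\<lambda>z. g z - z) holomorphic_on ?D"
    by (intro holomorphic_intros) (auto intro: holomorphic_on_subset)
  show thesis
  proof (rule that[of "\<lambda>z. g z - z"])
    show "voiculescu_transform_on M ?D (\<lambda>z. g z - z)"
      unfolding voiculescu_transform_on_def using a b inj gz by auto
  qed (use hol gz in auto)
qed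

text \<open>Turns the quantifier prefix "for some aperture and height" into
  \<open>eventually\<close>. The aperture may shrink, so one cone suffices and finitely many
  conditions can be intersected.\<close>

definition cone_filter :: "complex filter" where
  "cone_filter = (INF p\<in>{0<..} \<times> {0<..}. principal (truncated_cone (fst p) (snd p)))"

lemma eventually_cone_filter:
  "eventually P cone_filter \<longleftrightarrow> (\<exists>a>0. \<exists>b>0. \<forall>z\<in>truncated_cone a b. P z)"
proof -
  have "eventually P cone_filter \<longleftrightarrow>
      (\<exists>p\<in>{0<..} \<times> {0<..}. eventually P (principal (truncated_cone (fst p) (snd p))))"
    unfolding cone_filter_def
  proof (rule eventually_INF_base)
    fix p q :: "real \<times> real" assume "p \<in> {0<..} \<times> {0<..}" "q \<in> {0<..} \<times> {0<..}"
    then have pos: "0 < fst p" "0 < snd p" "0 < fst q" "0 < snd q" by (auto simp: mem_Times_iff)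
    have "truncated_cone (min (fst p) (fst q)) (max (snd p) (snd q)) \<subseteq> truncated_cone (fst p) (snd p)"
      by (rule truncated_cone_mono) (use pos in auto)
    moreover have "truncated_cone (min (fst p) (fst q)) (max (snd p) (snd q)) \<subseteq> truncated_cone (fst q) (snd q)"
      by (rule truncated_cone_mono) (use pos in auto)
    moreover have "(min (fst p) (fst q), max (snd p) (snd q)) \<in> {0<..} \<times> {0<..}"
      using pos by (simp add: less_max_iff_disj)
    ultimately show "\<exists>x\<in>{0<..} \<times> {0<..}. principal (truncated_cone (fst x) (snd x))
       \<le> inf (principal (truncated_cone (fst p) (snd p))) (principal (truncated_cone (fst q) (snd q)))"
      by (intro bexI[of _ "(min (fst p) (fst q), max (snd p) (snd q))"]) auto
  qed auto
  then show ?thesis by (auto simp: eventually_principal)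
qed

lemma ex_large_truncated_cone:
  assumes "eventually P cone_filter" "0 < A"
  shows "\<exists>a b. 0 < a \<and> a \<le> A \<and> B \<le> b \<and> 0 < b \<and> (\<forall>z\<in>truncated_cone a b. P z)"
proof -
  obtain a b where ab: "0 < a" "0 < b" "\<forall>z\<in>truncated_cone a b. P z"
    using assms by (auto simp: eventually_cone_filter)
  have "0 < min a A \<and> min a A \<le> A \<and> B \<le> max b B \<and> 0 < max b B \<and>
      (\<forall>z\<in>truncated_cone (min a A) (max b B). P z)"
    using truncated_cone_mono[of "min a A" a b "max b B"] ab assms(2)
    by (auto simp: le_max_iff_disj)
  then show ?thesis by blast
qed

lemma eventually_in_truncated_cone: "0 < a \<Longrightarrow> \<forall>\<^sub>F z in cone_filter. z \<in> truncated_cone a b"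
proof -
  assume "0 < a"
  moreover have "0 < max 1 b \<and> (\<forall>z\<in>truncated_cone a (max 1 b). z \<in> truncated_cone a b)"
    using truncated_cone_mono[of a a b "max 1 b"] by (auto simp: le_max_iff_disj)
  ultimately show ?thesis unfolding eventually_cone_filter by blast
qed

lemma eventually_Im_gt: "\<forall>\<^sub>F z in cone_filter. b < Im z"
  using eventually_in_truncated_cone[of 1 b] by (auto simp: truncated_cone_def elim: eventually_mono)

lemma cone_filter_neq_bot: "cone_filter \<noteq> bot"
proof
  assume "cone_filter = bot"
  then have "\<forall>\<^sub>F z in cone_filter. False" by simp
  then obtain a b where "0 < a" "0 < b" "\<forall>z\<in>truncated_cone a b. False"
    by (auto simp: eventually_cone_filter)
  moreover have "Complex 0 (b + 1) \<in> truncated_cone a b" if "0 < a" "0 < b"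
    using that by (simp add: truncated_cone_def)
  ultimately show False by blast
qed

definition has_voiculescu_germ :: "real measure \<Rightarrow> (complex \<Rightarrow> complex) \<Rightarrow> bool" where
  "has_voiculescu_germ M \<phi> \<longleftrightarrow> (\<exists>a>0. \<exists>b>0. voiculescu_transform_on M (truncated_cone a b) \<phi>)"

lemma voiculescu_transform_on_subset:
  "voiculescu_transform_on M D \<phi> \<Longrightarrow> D' \<subseteq> D \<Longrightarrow> voiculescu_transform_on M D' \<phi>"
  unfolding voiculescu_transform_on_def by blast

lemma has_voiculescu_germ_cong:
  assumes "has_voiculescu_germ M \<phi>" "\<forall>\<^sub>F z in cone_filter. \<phi> z = \<psi> z"
  shows "has_voiculescu_germ M \<psi>"
proof -
  obtain a b where *: "0 < a" "0 < b" "voiculescu_transform_on M (truncated_cone a b) \<phi>"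
    using assms by (auto simp: has_voiculescu_germ_def)
  obtain c d where cd: "0 < c" "c \<le> a" "b \<le> d" "0 < d" "\<And>z. z \<in> truncated_cone c d \<Longrightarrow> \<phi> z = \<psi> z"
    using ex_large_truncated_cone[OF assms(2) *(1), of b] by blast
  have "voiculescu_transform_on M (truncated_cone c d) \<phi>"
    using *(3) by (rule voiculescu_transform_on_subset) (intro truncated_cone_mono; use cd in simp)
  then have "voiculescu_transform_on M (truncated_cone c d) \<psi>"
    using cd(5) by (simp add: voiculescu_transform_on_def)
  then show ?thesis using cd by (auto simp: has_voiculescu_germ_def)
qed

lemma has_voiculescu_germ_F:
  "has_voiculescu_germ M \<phi> \<Longrightarrow> \<forall>\<^sub>F z in cone_filter. F_transform M (z + \<phi> z) = z"
  unfolding has_voiculescu_germ_def voiculescu_transform_on_def eventually_cone_filter by blast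

lemma eventually_add_in_truncated_cone:
  assumes "\<And>\<epsilon>. 0 < \<epsilon> \<Longrightarrow> \<forall>\<^sub>F z in cone_filter. cmod (\<phi> z) \<le> \<epsilon> * Im z" "0 < a" "0 < b"
  shows "\<forall>\<^sub>F z in cone_filter. z + \<phi> z \<in> truncated_cone a b"
proof -
  have "0 < a / (2 + 2 * a)" "0 < a / 2" using assms(2) by (auto simp: field_simps)
  then have "\<forall>\<^sub>F z in cone_filter. cmod (\<phi> z) \<le> a / (2 + 2 * a) * Im z"
      "\<forall>\<^sub>F z in cone_filter. z \<in> truncated_cone (a / 2) (2 * b)"
    using assms(1) eventually_in_truncated_cone by blast+
  then show ?thesis
    by eventually_elim (rule cball_subset_truncated_cone[OF assms(2,3)], auto)
qed

section \<open>Germs of Voiculescu transforms: existence, decay and uniqueness\<close>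

context real_distribution
begin

lemma eventually_cmod_F_transform_le:
  assumes "0 < \<epsilon>"
  shows "\<forall>\<^sub>F z in cone_filter. cmod (F_transform M z - z) \<le> \<epsilon> * Im z"
  using ex_near_identity[of 1, OF _ assms] unfolding eventually_cone_filter near_identity_def
  by (metis zero_less_one)

lemma ex_voiculescu_germ:
  obtains a b \<phi> where "0 < a" "0 < b" "voiculescu_transform_on M (truncated_cone a b) \<phi>"
    "\<phi> holomorphic_on truncated_cone a b" "has_voiculescu_germ M \<phi>"
proof -
  obtain b where b: "0 < b" "near_identity M (1 / (4 + 4 * 1)) 1 b"
    using ex_near_identity[of 1 "1 / (4 + 4 * 1)"] by auto
  show thesis
  proof (rule near_identity_voiculescu[OF _ b])
    fix \<phi> assume *: "voiculescu_transform_on M (truncated_cone (1 / 2) (2 * b)) \<phi>"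
      "\<phi> holomorphic_on truncated_cone (1 / 2) (2 * b)"
    moreover have "has_voiculescu_germ M \<phi>"
      unfolding has_voiculescu_germ_def using *(1) b(1)
      by (metis half_gt_zero_iff mult_pos_pos zero_less_numeral zero_less_one)
    ultimately show thesis using b by (intro that[of "1/2" "2 * b" \<phi>]) auto
  qed simp
qed

text \<open>The definition allows any cone of injectivity, also one reaching down to where
  \<open>F\<close> is far from the identity, so \<open>z + \<phi> z\<close> might stay low. But
  \<open>F\<close> is bounded on the low, compact part of the cone and takes the value
  \<open>z\<close> at \<open>z + \<phi> z\<close>; for large \<open>Im z\<close> that point must be
  high, where \<open>F\<close> is near the identity.\<close>

lemma has_voiculescu_germ_small:
  assumes "has_voiculescu_germ M \<phi>" "0 < \<epsilon>"
  shows "\<forall>\<^sub>F z in cone_filter. cmod (\<phi> z) \<le> \<epsilon> * Im z"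
proof -
  obtain a b c d where *: "0 < a" "0 < b" "0 < c" "0 < d" "inj_on (F_transform M) (truncated_cone c d)"
    and V: "\<And>z. z \<in> truncated_cone a b \<Longrightarrow> z + \<phi> z \<in> truncated_cone c d"
       "\<And>z. z \<in> truncated_cone a b \<Longrightarrow> F_transform M (z + \<phi> z) = z"
    using assms(1) unfolding has_voiculescu_germ_def voiculescu_transform_on_def by blast
  \<comment> \<open>Chosen so that a bound \<open>\<eta> * Im w\<close> in terms of the preimage
    \<open>w\<close> becomes \<open>\<epsilon> * Im z\<close>: \<open>1 - \<eta>\<close> is
    \<open>1 / (1 + \<epsilon>)\<close>.\<close>
  define \<eta> where "\<eta> = \<epsilon> / (1 + \<epsilon>)"
  have \<eta>: "0 < \<eta>" "\<eta> < 1" using assms by (auto simp: \<eta>_def divide_less_eq)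
  obtain e where e: "0 < e" "near_identity M \<eta> c e" using ex_near_identity[OF \<open>0 < c\<close> \<open>0 < \<eta>\<close>] by blast
  let ?K = "{w. d \<le> Im w \<and> Im w \<le> e \<and> \<bar>Re w\<bar> \<le> c * Im w}"
  have "bounded ?K"
    unfolding bounded_iff
  proof (intro exI ballI)
    fix w assume "w \<in> ?K"
    then have "c * Im w \<le> c * e" "\<bar>Im w\<bar> \<le> e" "\<bar>Re w\<bar> \<le> c * Im w" using * by auto
    then show "norm w \<le> c * e + e" using cmod_le[of w] by linarith
  qed
  moreover have "closed ?K"
    by (intro closed_Collect_conj closed_Collect_le continuous_intros)
  ultimately have "compact ?K" using compact_eq_bounded_closed by blast
  moreover have "continuous_on ?K (F_transform M)"
    using holomorphic_on_imp_continuous_on[OF F_transform_holomorphic]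
    by (rule continuous_on_subset) (use * in auto)
  ultimately have "compact (F_transform M ` ?K)" by (intro compact_continuous_image)
  then obtain B where B: "\<And>w. w \<in> ?K \<Longrightarrow> cmod (F_transform M w) \<le> B"
    using compact_imp_bounded[of "F_transform M ` ?K"] unfolding bounded_iff by blast
  have "\<forall>\<^sub>F z in cone_filter. z \<in> truncated_cone a b \<and> B < Im z \<and> 0 < Im z"
    using eventually_in_truncated_cone[OF \<open>0 < a\<close>] eventually_Im_gt eventually_Im_gt
    by (intro eventually_conj)
  then show ?thesis
  proof eventually_elim
    case (elim z)
    define w where "w = z + \<phi> z"
    have w: "w \<in> truncated_cone c d" "F_transform M w = z" using V elim by (auto simp: w_def)
    note wc = truncated_coneD[OF w(1) *(3,4)]
    have "w \<notin> ?K" using B[of w] w(2) elim abs_Im_le_cmod[of z] by auto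
    then have "w \<in> truncated_cone c e" using wc by (auto simp: truncated_cone_def)
    then have 1: "cmod (z - w) \<le> \<eta> * Im w" using e w by (auto simp: near_identity_def)
    have "Im w - Im z \<le> cmod (z - w)" using abs_Im_le_cmod[of "z - w"] by simp
    then have "(1 - \<eta>) * Im w \<le> Im z" using 1 by (simp add: algebra_simps)
    moreover have "1 - \<eta> = 1 / (1 + \<epsilon>)" using assms by (simp add: \<eta>_def field_simps)
    ultimately have "Im w \<le> (1 + \<epsilon>) * Im z" using assms by (simp add: field_simps)
    then have "\<eta> * Im w \<le> \<eta> * ((1 + \<epsilon>) * Im z)" using \<eta> by (intro mult_left_mono) auto
    also have "\<dots> = \<epsilon> * Im z" using assms by (simp add: \<eta>_def)
    finally show ?case using 1 by (simp add: w_def norm_minus_commute)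
  qed
qed

text \<open>Smallness moves both preimages of \<open>z\<close> into one cone on which
  \<open>F\<close> is injective, whatever cones the two germs came with.\<close>

lemma has_voiculescu_germ_unique:
  assumes "has_voiculescu_germ M \<phi>" "has_voiculescu_germ M \<psi>"
  shows "\<forall>\<^sub>F z in cone_filter. \<phi> z = \<psi> z"
proof -
  obtain b where b: "0 < b" "near_identity M (1 / 2) 1 b" using ex_near_identity[of 1 "1/2"] by auto
  have inj: "inj_on (F_transform M) (truncated_cone 1 b)"
    using near_identity_inj_on[OF b(2) _ b(1)] by simp
  have "\<forall>\<^sub>F z in cone_filter. z + \<phi> z \<in> truncated_cone 1 b"
       "\<forall>\<^sub>F z in cone_filter. z + \<psi> z \<in> truncated_cone 1 b"
    using eventually_add_in_truncated_cone[OF has_voiculescu_germ_small[OF assms(1)] zero_less_one b(1)]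
      eventually_add_in_truncated_cone[OF has_voiculescu_germ_small[OF assms(2)] zero_less_one b(1)] by simp_all
  then show ?thesis
    using has_voiculescu_germ_F[OF assms(1)] has_voiculescu_germ_F[OF assms(2)]
  proof eventually_elim
    case (elim z)
    then have "z + \<phi> z = z + \<psi> z" using inj_onD[OF inj] by metis
    then show ?case by simp
  qed
qed

lemma has_voiculescu_germI:
  assumes "\<And>\<epsilon>. 0 < \<epsilon> \<Longrightarrow> \<forall>\<^sub>F z in cone_filter. cmod (\<phi> z) \<le> \<epsilon> * Im z"
    and "\<forall>\<^sub>F z in cone_filter. F_transform M (z + \<phi> z) = z"
  shows "has_voiculescu_germ M \<phi>"
proof -
  obtain b where b: "0 < b" "near_identity M (1 / 2) 1 b" using ex_near_identity[of 1 "1/2"] by auto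
  have inj: "inj_on (F_transform M) (truncated_cone 1 b)"
    using near_identity_inj_on[OF b(2) _ b(1)] by simp
  have "\<forall>\<^sub>F z in cone_filter. z + \<phi> z \<in> truncated_cone 1 b \<and> F_transform M (z + \<phi> z) = z"
    by (rule eventually_conj[OF eventually_add_in_truncated_cone[OF assms(1) zero_less_one b(1)] assms(2)])
  then obtain c d where "0 < c" "0 < d"
    "\<forall>z\<in>truncated_cone c d. z + \<phi> z \<in> truncated_cone 1 b \<and> F_transform M (z + \<phi> z) = z"
    by (auto simp: eventually_cone_filter)
  then show ?thesis unfolding has_voiculescu_germ_def voiculescu_transform_on_def
    using inj b by (metis zero_less_one)
qed

end

text \<open>The three germs come with cones of their own; the smallest aperture and the largest
  height give a common one.\<close>

lemma is_free_convolution_iff: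
  "is_free_convolution M N R \<longleftrightarrow> real_distribution R \<and>
    (\<exists>\<phi> \<psi>. has_voiculescu_germ M \<phi> \<and> has_voiculescu_germ N \<psi> \<and> has_voiculescu_germ R (\<lambda>z. \<phi> z + \<psi> z))"
proof safe
  assume "is_free_convolution M N R"
  then show "real_distribution R" "\<exists>\<phi> \<psi>. has_voiculescu_germ M \<phi> \<and> has_voiculescu_germ N \<psi> \<and>
      has_voiculescu_germ R (\<lambda>z. \<phi> z + \<psi> z)"
    unfolding is_free_convolution_def has_voiculescu_germ_def by blast+
next
  fix \<phi> \<psi>
  assume R: "real_distribution R" and "has_voiculescu_germ M \<phi>" "has_voiculescu_germ N \<psi>"
    "has_voiculescu_germ R (\<lambda>z. \<phi> z + \<psi> z)"
  then obtain a b c d e f where *: "0 < a" "0 < b" "0 < c" "0 < d" "0 < e" "0 < f"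
    "voiculescu_transform_on M (truncated_cone a b) \<phi>" "voiculescu_transform_on N (truncated_cone c d) \<psi>"
    "voiculescu_transform_on R (truncated_cone e f) (\<lambda>z. \<phi> z + \<psi> z)"
    unfolding has_voiculescu_germ_def by blast
  define p q where "p = min a (min c e)" and "q = max b (max d f)"
  have pq: "p \<le> a" "p \<le> c" "p \<le> e" "b \<le> q" "d \<le> q" "f \<le> q" "0 < p" "0 < q"
    using * by (auto simp: p_def q_def)
  then have "voiculescu_transform_on M (truncated_cone p q) \<phi>" "voiculescu_transform_on N (truncated_cone p q) \<psi>"
    "voiculescu_transform_on R (truncated_cone p q) (\<lambda>z. \<phi> z + \<psi> z)"
    using voiculescu_transform_on_subset[OF *(7) truncated_cone_mono]
      voiculescu_transform_on_subset[OF *(8) truncated_cone_mono]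
      voiculescu_transform_on_subset[OF *(9) truncated_cone_mono] by simp_all
  then show "is_free_convolution M N R"
    unfolding is_free_convolution_def using R pq by blast
qed

section \<open>Uniqueness of the Cauchy transform\<close>

lemma integrable_cauchy_kernel: "integrable lborel (\<lambda>x::real. 1 / (1 + x\<^sup>2))"
  and integral_cauchy_kernel: "(\<integral>x. 1 / (1 + x\<^sup>2) \<partial>lborel) = pi"
  using integrable_inverse_1_plus_square LBINT_inverse_1_plus_square
  by (simp_all add: set_integrable_def interval_lebesgue_integral_def set_lebesgue_integral_def inverse_eq_divide)

lemma nn_integral_cauchy_kernel: "(\<integral>\<^sup>+x. ennreal (1 / (1 + x\<^sup>2)) \<partial>lborel) = ennreal pi"
  by (subst nn_integral_eq_integral[OF integrable_cauchy_kernel]) (auto simp: integral_cauchy_kernel)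

text \<open>\<open>y\<close> times the energy at height \<open>y\<close> is \<open>pi\<close> times
  the Poisson smoothing of \<open>M\<close>. After Fubini and the substitution
  \<open>x = s + y * u\<close> the dependence on \<open>y\<close> sits in
  \<open>f (s + y * u)\<close> alone, and dominated convergence applies twice. Nonnegative integrals
  keep Fubini free of integrability conditions.\<close>

lemma (in real_distribution) stieltjes_inversion:
  fixes f :: "real \<Rightarrow> real"
  assumes f: "\<And>x. isCont f x" "\<And>x. 0 \<le> f x" "\<And>x. f x \<le> B"
  shows "(\<lambda>n. \<integral>\<^sup>+x. ennreal (f x) * ennreal ((1 / Suc n) * cauchy_energy M (Complex x (1 / Suc n))) \<partial>lborel)
    \<longlonglongrightarrow> (\<integral>\<^sup>+s. ennreal (f s) * ennreal pi \<partial>M)"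
proof -
  have [measurable_cong]: "sets M = sets borel" by simp
  have [measurable]: "f \<in> borel_measurable borel"
    using f by (intro borel_measurable_continuous_onI continuous_at_imp_continuous_on) auto
  have B: "0 \<le> B" using f(2,3) by (meson order_trans)
  interpret L: pair_sigma_finite M lborel ..
  have eq: "(\<integral>\<^sup>+x. ennreal (f x) * ennreal (y * cauchy_energy M (Complex x y)) \<partial>lborel)
    = (\<integral>\<^sup>+s. \<integral>\<^sup>+u. ennreal (f (s + y * u)) * ennreal (1 / (1 + u\<^sup>2)) \<partial>lborel \<partial>M)" if y: "y > 0" for y
  proof -
    have e: "ennreal (y * cauchy_energy M (Complex x y)) = (\<integral>\<^sup>+s. ennreal (y / ((x - s)\<^sup>2 + y\<^sup>2)) \<partial>M)" for x
    proof -
      have "off_support M (Complex x y)" using y by (intro off_support_Im) simp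
      note i = integrable_mult_right[OF cauchy.integrable_energy[OF this], of y]
      have "y * cauchy_energy M (Complex x y) = (\<integral>s. y * (1 / (cmod (Complex x y - complex_of_real s))\<^sup>2) \<partial>M)"
        unfolding energy_def by (rule integral_mult_right_zero[symmetric])
      also have "ennreal \<dots> = (\<integral>\<^sup>+s. ennreal (y * (1 / (cmod (Complex x y - complex_of_real s))\<^sup>2)) \<partial>M)"
        using y by (intro nn_integral_eq_integral[OF i, symmetric]) auto
      also have "\<dots> = (\<integral>\<^sup>+s. ennreal (y / ((x - s)\<^sup>2 + y\<^sup>2)) \<partial>M)"
        by (intro nn_integral_cong) (simp add: cmod_power2)
      finally show ?thesis .
    qed
    have "(\<integral>\<^sup>+x. ennreal (f x) * ennreal (y * cauchy_energy M (Complex x y)) \<partial>lborel)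
       = (\<integral>\<^sup>+x. \<integral>\<^sup>+s. ennreal (f x) * ennreal (y / ((x - s)\<^sup>2 + y\<^sup>2)) \<partial>M \<partial>lborel)"
      unfolding e by (rule nn_integral_cong, rule nn_integral_cmult[symmetric]) simp
    also have "\<dots> = (\<integral>\<^sup>+s. \<integral>\<^sup>+x. ennreal (f x) * ennreal (y / ((x - s)\<^sup>2 + y\<^sup>2)) \<partial>lborel \<partial>M)"
      by (rule L.Fubini') measurable
    also have "\<dots> = (\<integral>\<^sup>+s. \<integral>\<^sup>+u. ennreal (f (s + y * u)) * ennreal (1 / (1 + u\<^sup>2)) \<partial>lborel \<partial>M)"
    proof (rule nn_integral_cong)
      fix s
      have "(\<integral>\<^sup>+x. ennreal (f x) * ennreal (y / ((x - s)\<^sup>2 + y\<^sup>2)) \<partial>lborel)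
        = ennreal \<bar>y\<bar> * (\<integral>\<^sup>+u. ennreal (f (s + y * u)) * ennreal (y / (((s + y * u) - s)\<^sup>2 + y\<^sup>2)) \<partial>lborel)"
        using y by (intro nn_integral_real_affine) auto
      also have "\<dots> = (\<integral>\<^sup>+u. ennreal \<bar>y\<bar> * (ennreal (f (s + y * u)) * ennreal (y / (((s + y * u) - s)\<^sup>2 + y\<^sup>2))) \<partial>lborel)"
        by (intro nn_integral_cmult[symmetric]) simp
      also have "\<dots> = (\<integral>\<^sup>+u. ennreal (f (s + y * u)) * ennreal (1 / (1 + u\<^sup>2)) \<partial>lborel)"
      proof (intro nn_integral_cong)
        fix u
        have "y * (y / (((s + y * u) - s)\<^sup>2 + y\<^sup>2)) = 1 / (1 + u\<^sup>2)"
        proof -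
          have "((s + y * u) - s)\<^sup>2 + y\<^sup>2 = (y * y) * (1 + u\<^sup>2)" by (simp add: power2_eq_square algebra_simps)
          then show ?thesis using y by simp
        qed
        moreover have "ennreal y * ennreal (y / (((s + y * u) - s)\<^sup>2 + y\<^sup>2))
            = ennreal (y * (y / (((s + y * u) - s)\<^sup>2 + y\<^sup>2)))"
          using y by (intro ennreal_mult[symmetric]) auto
        ultimately have *: "ennreal y * ennreal (y / (((s + y * u) - s)\<^sup>2 + y\<^sup>2)) = ennreal (1 / (1 + u\<^sup>2))"
          by simp
        show "ennreal \<bar>y\<bar> * (ennreal (f (s + y * u)) * ennreal (y / (((s + y * u) - s)\<^sup>2 + y\<^sup>2)))
          = ennreal (f (s + y * u)) * ennreal (1 / (1 + u\<^sup>2))"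
          unfolding *[symmetric] using y by (simp add: mult.left_commute)
      qed
      finally show "(\<integral>\<^sup>+x. ennreal (f x) * ennreal (y / ((x - s)\<^sup>2 + y\<^sup>2)) \<partial>lborel)
        = (\<integral>\<^sup>+u. ennreal (f (s + y * u)) * ennreal (1 / (1 + u\<^sup>2)) \<partial>lborel)" .
    qed
    finally show ?thesis .
  qed
  have bound: "(\<integral>\<^sup>+u. ennreal (f (s + y * u)) * ennreal (1 / (1 + u\<^sup>2)) \<partial>lborel) \<le> ennreal (B * pi)" for s y
  proof -
    have "(\<integral>\<^sup>+u. ennreal (f (s + y * u)) * ennreal (1 / (1 + u\<^sup>2)) \<partial>lborel)
        \<le> (\<integral>\<^sup>+u. ennreal B * ennreal (1 / (1 + u\<^sup>2)) \<partial>lborel)"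
      using f by (intro nn_integral_mono mult_right_mono ennreal_leI) auto
    also have "\<dots> = ennreal B * ennreal pi"
      by (subst nn_integral_cmult) (auto simp: nn_integral_cauchy_kernel)
    finally show ?thesis using B by (simp add: ennreal_mult)
  qed
  have y0: "(\<lambda>n. 1 / real (Suc n)) \<longlonglongrightarrow> 0" by (rule LIMSEQ_Suc, rule lim_1_over_n)
  have lim: "(\<lambda>n. \<integral>\<^sup>+u. ennreal (f (s + 1 / Suc n * u)) * ennreal (1 / (1 + u\<^sup>2)) \<partial>lborel)
      \<longlonglongrightarrow> ennreal (f s) * ennreal pi" for s
  proof -
    have "(\<lambda>n. \<integral>\<^sup>+u. ennreal (f (s + 1 / Suc n * u)) * ennreal (1 / (1 + u\<^sup>2)) \<partial>lborel)
      \<longlonglongrightarrow> (\<integral>\<^sup>+u. ennreal (f s) * ennreal (1 / (1 + u\<^sup>2)) \<partial>lborel)"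
    proof (rule nn_integral_dominated_convergence[where w="\<lambda>u. ennreal B * ennreal (1 / (1 + u\<^sup>2))"])
      show "AE u in lborel. ennreal (f (s + 1 / Suc n * u)) * ennreal (1 / (1 + u\<^sup>2)) \<le> ennreal B * ennreal (1 / (1 + u\<^sup>2))" for n
        using f by (intro AE_I2 mult_right_mono ennreal_leI) auto
      show "(\<integral>\<^sup>+u. ennreal B * ennreal (1 / (1 + u\<^sup>2)) \<partial>lborel) < \<infinity>"
        by (subst nn_integral_cmult) (auto simp: nn_integral_cauchy_kernel ennreal_mult_less_top)
      show "AE u in lborel. (\<lambda>n. ennreal (f (s + 1 / Suc n * u)) * ennreal (1 / (1 + u\<^sup>2)))
        \<longlonglongrightarrow> ennreal (f s) * ennreal (1 / (1 + u\<^sup>2))"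
      proof (rule AE_I2)
        fix u
        have "(\<lambda>n. s + 1 / Suc n * u) \<longlonglongrightarrow> s + 0 * u"
          by (intro tendsto_add tendsto_mult tendsto_const y0)
        then have lim1: "(\<lambda>n. f (s + 1 / Suc n * u)) \<longlonglongrightarrow> f s"
          using isCont_tendsto_compose[OF f(1)] by (metis mult_zero_left add.right_neutral)
        have e: "ennreal (f t * (1 / (1 + u\<^sup>2))) = ennreal (f t) * ennreal (1 / (1 + u\<^sup>2))" for t
          by (rule ennreal_mult) (use f in auto)
        show "(\<lambda>n. ennreal (f (s + 1 / Suc n * u)) * ennreal (1 / (1 + u\<^sup>2)))
        \<longlonglongrightarrow> ennreal (f s) * ennreal (1 / (1 + u\<^sup>2))"
          unfolding e[symmetric] by (intro tendsto_ennrealI tendsto_mult tendsto_const lim1)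
      qed
    qed simp_all
    also have "(\<integral>\<^sup>+u. ennreal (f s) * ennreal (1 / (1 + u\<^sup>2)) \<partial>lborel) = ennreal (f s) * ennreal pi"
      unfolding nn_integral_cauchy_kernel[symmetric] by (rule nn_integral_cmult) simp
    finally show ?thesis .
  qed
  have "(\<lambda>n. \<integral>\<^sup>+s. \<integral>\<^sup>+u. ennreal (f (s + 1 / Suc n * u)) * ennreal (1 / (1 + u\<^sup>2)) \<partial>lborel \<partial>M)
    \<longlonglongrightarrow> (\<integral>\<^sup>+s. ennreal (f s) * ennreal pi \<partial>M)"
  proof (rule nn_integral_dominated_convergence[where w="\<lambda>_. ennreal (B * pi)"])
    show "AE s in M. (\<integral>\<^sup>+u. ennreal (f (s + 1 / Suc n * u)) * ennreal (1 / (1 + u\<^sup>2)) \<partial>lborel) \<le> ennreal (B * pi)" for n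
      using bound by (intro AE_I2)
    show "AE s in M. (\<lambda>n. \<integral>\<^sup>+u. ennreal (f (s + 1 / Suc n * u)) * ennreal (1 / (1 + u\<^sup>2)) \<partial>lborel)
      \<longlonglongrightarrow> ennreal (f s) * ennreal pi"
      using lim by (intro AE_I2)
    show "(\<integral>\<^sup>+s. ennreal (B * pi) \<partial>M) < \<infinity>"
      using emeasure_space_1 by simp
  qed simp_all
  then show ?thesis unfolding eq[OF divide_pos_pos[OF zero_less_one of_nat_0_less_iff[THEN iffD2, OF zero_less_Suc]]] .
qed

text \<open>Imaginary parts determine the energy, hence by inversion the integrals of bounded
  continuous functions; sine and cosine then give equal characteristic functions.\<close>

theorem cauchy_transform_unique:
  assumes M: "real_distribution M" and N: "real_distribution N"
    and eq: "\<And>z. Im z > 0 \<Longrightarrow> cauchy_transform M z = cauchy_transform N z"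
  shows "M = N"
proof (rule Levy_uniqueness[OF M N])
  interpret M: real_distribution M by fact
  interpret N: real_distribution N by fact
  have energy: "cauchy_energy M z = cauchy_energy N z" if "Im z > 0" for z
    using that M.cauchy.Im_T[of z] N.cauchy.Im_T[of z] eq[OF that] off_support_Im[of z] by simp
  have int: "integral\<^sup>L M f = integral\<^sup>L N f"
    if f: "\<And>x. isCont f x" "\<And>x. \<bar>f x\<bar> \<le> 1" for f :: "real \<Rightarrow> real"
  proof -
    have [measurable]: "f \<in> borel_measurable borel"
      using f by (intro borel_measurable_continuous_onI continuous_at_imp_continuous_on) auto
    \<comment> \<open>The shift by 1 makes \<open>f\<close> nonnegative, as inversion requires;
      total mass 1 undoes it afterwards.\<close>
    have c: "isCont (\<lambda>x. f x + 1) x" "0 \<le> f x + 1" "f x + 1 \<le> 2" for x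
      using f(1)[of x] f(2)[of x] by (auto intro!: continuous_intros)
    have "(\<integral>\<^sup>+s. ennreal (f s + 1) * ennreal pi \<partial>M) = (\<integral>\<^sup>+s. ennreal (f s + 1) * ennreal pi \<partial>N)"
      using M.stieltjes_inversion[OF c] N.stieltjes_inversion[OF c]
      by (simp add: energy LIMSEQ_unique)
    moreover have "(\<integral>\<^sup>+s. ennreal (f s + 1) * ennreal pi \<partial>K) = ennreal ((integral\<^sup>L K f + 1) * pi)"
      "integrable K f" if "real_distribution K" for K
    proof -
      interpret K: real_distribution K by fact
      show i: "integrable K f" using f(2) by (intro K.integrable_const_bound[of _ 1]) auto
      have "(\<integral>\<^sup>+s. ennreal (f s + 1) * ennreal pi \<partial>K) = (\<integral>\<^sup>+s. ennreal ((f s + 1) * pi) \<partial>K)"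
        using c by (intro nn_integral_cong) (simp add: ennreal_mult)
      also have "\<dots> = ennreal (\<integral>s. (f s + 1) * pi \<partial>K)"
        using i c by (intro nn_integral_eq_integral) auto
      also have "(\<integral>s. (f s + 1) * pi \<partial>K) = (integral\<^sup>L K f + 1) * pi"
        using i K.prob_space by (simp add: algebra_simps)
      finally show "(\<integral>\<^sup>+s. ennreal (f s + 1) * ennreal pi \<partial>K) = ennreal ((integral\<^sup>L K f + 1) * pi)" .
    qed
    moreover have "integral\<^sup>L K f + 1 \<ge> 0" if "real_distribution K" for K
    proof -
      interpret K: real_distribution K by fact
      have "integrable K f" using f(2) by (intro K.integrable_const_bound[of _ 1]) auto
      then have "integral\<^sup>L K f + 1 = (\<integral>s. f s + 1 \<partial>K)" using K.prob_space by simp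
      also have "\<dots> \<ge> 0" using c by (intro integral_nonneg_AE AE_I2)
      finally show ?thesis .
    qed
    ultimately show ?thesis using M N by simp
  qed
  show "char M = char N"
  proof
    fix t
    have i: "integrable K (\<lambda>x. cos (t * x))" "integrable K (\<lambda>x. sin (t * x))" if "real_distribution K" for K
    proof -
      interpret K: real_distribution K by fact
      show "integrable K (\<lambda>x. cos (t * x))" "integrable K (\<lambda>x. sin (t * x))"
        by (intro K.integrable_const_bound[of _ 1]; simp)+
    qed
    have "char K t = complex_of_real (\<integral>x. cos (t * x) \<partial>K) + \<i> * complex_of_real (\<integral>x. sin (t * x) \<partial>K)"
      if K: "real_distribution K" for K
    proof -
      have i': "integrable K (\<lambda>x. complex_of_real (cos (t * x)))" "integrable K (\<lambda>x. \<i> * complex_of_real (sin (t * x)))"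
        using i[OF K] by (simp_all only: integrable_of_real integrable_mult_right)
      have "char K t = (\<integral>x. complex_of_real (cos (t * x)) + \<i> * complex_of_real (sin (t * x)) \<partial>K)"
        unfolding char_def exp_Euler cos_of_real sin_of_real by (rule refl)
      also have "\<dots> = (\<integral>x. complex_of_real (cos (t * x)) \<partial>K) + (\<integral>x. \<i> * complex_of_real (sin (t * x)) \<partial>K)"
        using i' by (rule Bochner_Integration.integral_add)
      finally show ?thesis by (simp only: integral_complex_of_real integral_mult_right_zero)
    qed
    moreover have "(\<integral>x. cos (t * x) \<partial>M) = (\<integral>x. cos (t * x) \<partial>N)" "(\<integral>x. sin (t * x) \<partial>M) = (\<integral>x. sin (t * x) \<partial>N)"
      by (intro int; simp)+
    ultimately show "char M t = char N t" using M N by simp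
  qed
qed

section \<open>Representation as a Cauchy transform\<close>

lemma
  assumes "Im z > 0"
  shows integrable_poisson_kernel: "integrable lborel (\<lambda>x. 1 / (cmod (of_real x - z))\<^sup>2)"
    and integral_poisson_kernel: "(\<integral>x. 1 / (cmod (of_real x - z))\<^sup>2 \<partial>lborel) = pi / Im z"
proof -
  let ?f = "\<lambda>x. 1 / (cmod (of_real x - z))\<^sup>2"
  have eq: "?f (Re z + Im z * x) = 1 / (Im z)\<^sup>2 * (1 / (1 + x\<^sup>2))" for x
    unfolding cmod_power2 by (simp add: power2_eq_square algebra_simps)
  have "integrable lborel (\<lambda>x. ?f (Re z + Im z * x))"
    unfolding eq by (rule integrable_mult_right[OF integrable_cauchy_kernel])
  then show "integrable lborel ?f"
    using assms by (subst (asm) lborel_integrable_real_affine_iff) auto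
  have "(\<integral>x. ?f x \<partial>lborel) = \<bar>Im z\<bar> *\<^sub>R (\<integral>x. ?f (Re z + Im z * x) \<partial>lborel)"
    using assms by (intro lborel_integral_real_affine) auto
  also have "(\<integral>x. ?f (Re z + Im z * x) \<partial>lborel) = 1 / (Im z)\<^sup>2 * pi"
    unfolding eq integral_mult_right_zero integral_cauchy_kernel ..
  finally show "(\<integral>x. ?f x \<partial>lborel) = pi / Im z"
    using assms by (simp add: power2_eq_square)
qed

text \<open>The integrand \<open>(g w - g z) / ((w - z) * (w - cnj z))\<close> has no singularity in the closed upper
  half-plane and decays quadratically, so its integral along large half-circles tends to zero.\<close>

lemma poisson_half_plane:
  fixes g :: "complex \<Rightarrow> complex"
  assumes g: "g holomorphic_on {w. - \<delta> < Im w}" and \<delta>: "\<delta> > 0"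
    and B: "\<And>w. 0 \<le> Im w \<Longrightarrow> cmod (g w) \<le> B" and z: "Im z > 0"
  shows "integrable lborel (\<lambda>x. g (of_real x) * of_real (1 / (cmod (of_real x - z))\<^sup>2))"
    and "(\<integral>x. g (of_real x) * of_real (1 / (cmod (of_real x - z))\<^sup>2) \<partial>lborel) = g z * of_real (pi / Im z)"
proof -
  have B0: "0 \<le> B" using B[of 0] norm_ge_zero by (metis order_refl order_trans zero_complex.sel(2))
  have cont: "continuous_on UNIV (\<lambda>x. g (complex_of_real x))"
    by (rule continuous_on_compose2[OF holomorphic_on_imp_continuous_on[OF g]])
       (use \<delta> in \<open>auto intro!: continuous_intros\<close>)
  have [measurable]: "(\<lambda>x. g (complex_of_real x)) \<in> borel_measurable borel"
    using cont by (rule borel_measurable_continuous_onI)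
  have ik: "integrable lborel (\<lambda>x. complex_of_real (1 / (cmod (of_real x - z))\<^sup>2))"
    using integrable_poisson_kernel[OF z] by (simp only: integrable_of_real)
  show ig: "integrable lborel (\<lambda>x. g (of_real x) * of_real (1 / (cmod (of_real x - z))\<^sup>2))"
  proof (rule Bochner_Integration.integrable_bound)
    show "integrable lborel (\<lambda>x. B * (1 / (cmod (of_real x - z))\<^sup>2))"
      using integrable_poisson_kernel[OF z] by (rule integrable_mult_right)
    show "AE x in lborel. norm (g (of_real x) * of_real (1 / (cmod (of_real x - z))\<^sup>2))
      \<le> norm (B * (1 / (cmod (of_real x - z))\<^sup>2))"
    proof (rule AE_I2)
      fix x
      have "norm (g (of_real x) * of_real (1 / (cmod (of_real x - z))\<^sup>2))
          = norm (g (of_real x)) * (1 / (cmod (of_real x - z))\<^sup>2)"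
        unfolding norm_mult norm_of_real by simp
      also have "\<dots> \<le> B * (1 / (cmod (of_real x - z))\<^sup>2)" using B by (intro mult_right_mono) auto
      also have "\<dots> \<le> norm (B * (1 / (cmod (of_real x - z))\<^sup>2))"
        unfolding real_norm_def by (rule abs_ge_self)
      finally show "norm (g (of_real x) * of_real (1 / (cmod (of_real x - z))\<^sup>2))
        \<le> norm (B * (1 / (cmod (of_real x - z))\<^sup>2))" .
    qed
  qed simp
  \<comment> \<open>At most \<open>Im z\<close>, so that the zero \<open>cnj z\<close> of the
    denominator stays outside \<open>S\<close>; at most \<open>\<delta>\<close>, so that
    \<open>g\<close> is holomorphic on \<open>S\<close>.\<close>
  define d where "d = min \<delta> (Im z)"
  define S where "S = {w. - d < Im w}"
  have S: "open S" "convex S" unfolding S_def by (auto simp: open_halfspace_Im_gt convex_halfspace_Im_gt)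
  have d: "d > 0" "d \<le> \<delta>" "d \<le> Im z" using \<delta> z by (auto simp: d_def)
  define k where "k w = (if w = z then deriv g z else (g w - g z) / (w - z))" for w
  define h where "h w = k w / (w - cnj z)" for w
  have "g holomorphic_on S" using g by (rule holomorphic_on_subset) (use d in \<open>auto simp: S_def\<close>)
  then have "k holomorphic_on S" unfolding k_def using S(1) by (rule pole_lemma_open)
  then have h: "h holomorphic_on S" unfolding h_def
    by (intro holomorphic_intros) (use d in \<open>auto simp: S_def\<close>)
  define H where "H x = h (complex_of_real x)" for x
  have Hx: "H x = g (of_real x) * of_real (1 / (cmod (of_real x - z))\<^sup>2) - g z * of_real (1 / (cmod (of_real x - z))\<^sup>2)" for x
  proof -
    have "complex_of_real x \<noteq> z" using z by auto
    moreover have "(of_real x - z) * (of_real x - cnj z) = complex_of_real ((cmod (of_real x - z))\<^sup>2)"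
      by (metis complex_cnj_complex_of_real complex_cnj_diff complex_norm_square of_real_power)
    ultimately show ?thesis
      unfolding H_def h_def k_def by (simp add: diff_divide_distrib flip: of_real_power)
  qed
  note igz = integrable_mult_right[OF ik, of "g z"]
  have iH: "integrable lborel H" unfolding Hx using ig igz by (rule Bochner_Integration.integrable_diff)
  have est: "cmod (\<integral>x. indicator {- R..R} x *\<^sub>R H x \<partial>lborel) \<le> 8 * B * pi / R" if R: "R > 2 * cmod z" for R
  proof -
    have R0: "R > 0" using R norm_ge_zero[of z] by linarith
    let ?c = "part_circlepath 0 R 0 pi" and ?l = "linepath (- complex_of_real R) (of_real R)"
    have arc: "cmod w = R \<and> 0 \<le> Im w" if w: "w \<in> path_image ?c" for w
    proof -
      obtain x where "0 \<le> x" "x \<le> pi" "w = 0 + of_real R * exp (\<i> * of_real x)"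
        using w by (auto simp: path_image_part_circlepath)
      then show ?thesis using R0 by (auto simp: norm_mult Im_exp intro!: mult_nonneg_nonneg sin_ge_zero)
    qed
    have sub: "path_image ?c \<subseteq> S" "path_image ?l \<subseteq> S"
    proof -
      show "path_image ?c \<subseteq> S" using arc d by (force simp: S_def)
      have "closed_segment (- complex_of_real R) (of_real R) \<subseteq> S"
        using S(2) d by (intro closed_segment_subset) (auto simp: S_def)
      then show "path_image ?l \<subseteq> S" by simp
    qed
    have ci: "h contour_integrable_on ?c" "h contour_integrable_on ?l"
      using sub by (auto intro!: contour_integrable_holomorphic_simple[OF h S(1)])
    have "(h has_contour_integral 0) (?c +++ ?l)"
      using sub by (intro Cauchy_theorem_convex_simple[OF h S(2)]) (auto simp: path_image_join)
    then have "contour_integral ?c h + contour_integral ?l h = 0"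
      using ci contour_integral_join[of h ?c ?l] by (simp add: contour_integral_unique)
    then have "cmod (contour_integral ?l h) = cmod (contour_integral ?c h)"
      by (metis add_eq_0_iff norm_minus_cancel)
    also have "\<dots> \<le> 8 * B / R\<^sup>2 * R * \<bar>pi - 0\<bar>"
    proof (rule contour_integral_bound_part_circlepath[OF ci(1)])
      show "0 \<le> 8 * B / R\<^sup>2" using B0 by simp
      fix w assume "w \<in> path_image ?c"
      then have w: "cmod w = R" "0 \<le> Im w" using arc by auto
      have wz: "cmod (w - z) \<ge> R / 2" "cmod (w - cnj z) \<ge> R / 2"
        using norm_triangle_ineq2[of w z] norm_triangle_ineq2[of w "cnj z"] w R by auto
      then have "w \<noteq> z" using R0 by auto
      then have "cmod (h w) = cmod (g w - g z) / (cmod (w - z) * cmod (w - cnj z))"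
        by (simp add: h_def k_def norm_divide norm_mult)
      also have "\<dots> \<le> (B + B) / ((R / 2) * (R / 2))"
      proof (rule frac_le)
        show "cmod (g w - g z) \<le> B + B"
          using B[of w] B[of z] w z norm_triangle_ineq4[of "g w" "g z"] by linarith
        show "R / 2 * (R / 2) \<le> cmod (w - z) * cmod (w - cnj z)"
          using wz R0 by (intro mult_mono) auto
      qed (use R0 B0 in auto)
      also have "\<dots> = 8 * B / R\<^sup>2" by (simp add: power2_eq_square)
      finally show "cmod (h w) \<le> 8 * B / R\<^sup>2" .
    qed (use R0 in auto)
    also have "\<dots> = 8 * B * pi / R" using R0 by (simp add: power2_eq_square)
    also have "contour_integral ?l h = integral {- R..R} H"
      using contour_integral_linepath_Reals_eq[of "- complex_of_real R" "of_real R" h] R0 by (simp add: H_def[abs_def])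
    also have "integral {- R..R} H = (\<integral>x. indicator {- R..R} x *\<^sub>R H x \<partial>lborel)"
    proof -
      have "set_integrable lborel {- R..R} H"
        unfolding set_integrable_def using iH by (intro integrable_mult_indicator) auto
      from set_borel_integral_eq_integral(2)[OF this] show ?thesis by (simp add: set_lebesgue_integral_def)
    qed
    finally show ?thesis .
  qed
  have "(\<lambda>n. \<integral>x. indicator {- real n..real n} x *\<^sub>R H x \<partial>lborel) \<longlonglongrightarrow> (\<integral>x. H x \<partial>lborel)"
  proof (rule integral_dominated_convergence[where w="\<lambda>x. norm (H x)"])
    show "AE x in lborel. (\<lambda>n. indicator {- real n..real n} x *\<^sub>R H x) \<longlonglongrightarrow> H x"
    proof (rule AE_I2)
      fix x
      have "\<forall>\<^sub>F n in sequentially. indicator {- real n..real n} x *\<^sub>R H x = H x"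
        using eventually_ge_at_top[of "nat \<lceil>\<bar>x\<bar>\<rceil>"]
        by eventually_elim (auto simp: indicator_def nat_le_iff ceiling_le_iff abs_le_iff)
      then show "(\<lambda>n. indicator {- real n..real n} x *\<^sub>R H x) \<longlonglongrightarrow> H x"
        by (rule tendsto_eventually)
    qed
    show "AE x in lborel. norm (indicator {- real n..real n} x *\<^sub>R H x) \<le> norm (H x)" for n
      by (intro AE_I2) (auto simp: indicator_def)
  qed (use iH in \<open>auto intro!: borel_measurable_integrable\<close>)
  moreover have "(\<lambda>n. \<integral>x. indicator {- real n..real n} x *\<^sub>R H x \<partial>lborel) \<longlonglongrightarrow> 0"
  proof (rule Lim_null_comparison)
    show "\<forall>\<^sub>F n in sequentially. cmod (\<integral>x. indicator {- real n..real n} x *\<^sub>R H x \<partial>lborel) \<le> 8 * B * pi / real n"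
      using eventually_gt_at_top[of "nat \<lceil>2 * cmod z\<rceil>"]
    proof eventually_elim
      case (elim n)
      then show ?case by (intro est) linarith
    qed
    show "(\<lambda>n. 8 * B * pi / real n) \<longlonglongrightarrow> 0" by (rule lim_const_over_n)
  qed
  ultimately have "(\<integral>x. H x \<partial>lborel) = 0" by (rule LIMSEQ_unique)
  moreover have "(\<integral>x. H x \<partial>lborel) = (\<integral>x. g (of_real x) * of_real (1 / (cmod (of_real x - z))\<^sup>2) \<partial>lborel)
     - (\<integral>x. g z * of_real (1 / (cmod (of_real x - z))\<^sup>2) \<partial>lborel)"
    unfolding Hx using ig igz by (rule Bochner_Integration.integral_diff)
  moreover have "(\<integral>x. g z * of_real (1 / (cmod (of_real x - z))\<^sup>2) \<partial>lborel) = g z * of_real (pi / Im z)"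
    unfolding integral_mult_right_zero integral_complex_of_real integral_poisson_kernel[OF z] ..
  ultimately show "(\<integral>x. g (of_real x) * of_real (1 / (cmod (of_real x - z))\<^sup>2) \<partial>lborel) = g z * of_real (pi / Im z)"
    by simp
qed

text \<open>A nonconstant \<open>D\<close> would be open by the open mapping theorem and would take
  non-real values; the decay along the imaginary axis then makes the constant 0.\<close>

lemma holomorphic_real_valued_eq_0:
  assumes D: "D holomorphic_on {z. Im z > 0}" and Im: "\<And>z. Im z > 0 \<Longrightarrow> Im (D z) = 0"
    and bd: "\<And>y. y > 0 \<Longrightarrow> cmod (D (\<i> * complex_of_real y)) \<le> C / y" and z: "Im z > 0"
  shows "D z = 0"
proof -
  let ?U = "{z. Im z > 0}"
  have "D constant_on ?U"
  proof (rule ccontr)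
    assume "\<not> D constant_on ?U"
    then have "open (D ` ?U)"
      using open_mapping_thm[OF D open_halfspace_Im_gt _ open_halfspace_Im_gt order_refl]
      by (simp add: convex_connected convex_halfspace_Im_gt)
    moreover have "D \<i> \<in> D ` ?U" by simp
    ultimately obtain e where e: "e > 0" "ball (D \<i>) e \<subseteq> D ` ?U" by (meson open_contains_ball)
    have "D \<i> + \<i> * of_real (e / 2) \<in> ball (D \<i>) e" using e(1) by (simp add: dist_norm norm_mult)
    then obtain w where "Im w > 0" "D w = D \<i> + \<i> * of_real (e / 2)" using e(2) by fastforce
    then show False using Im[of w] Im[of \<i>] e(1) by simp
  qed
  then obtain c where c: "\<And>z. Im z > 0 \<Longrightarrow> D z = c" by (auto simp: constant_on_def)
  have "\<forall>\<^sub>F y in at_top. cmod c \<le> C / y"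
    using eventually_gt_at_top[of 0]
  proof eventually_elim
    case (elim y)
    then show ?case using bd[of y] c[of "\<i> * complex_of_real y"] by simp
  qed
  moreover have "((\<lambda>y. C / y) \<longlongrightarrow> 0) at_top"
    by (intro tendsto_divide_0[OF tendsto_const] filterlim_at_top_imp_at_infinity filterlim_ident)
  ultimately have "cmod c \<le> 0"
    by (intro tendsto_lowerbound[of "\<lambda>y. C / y"]) auto
  then show ?thesis using c z by simp
qed

text \<open>The analytic characterisation of Cauchy transforms of probability measures;
  \<open>lim\<close> encodes total mass 1.\<close>

locale cauchy_like =
  fixes G :: "complex \<Rightarrow> complex"
  assumes hol: "G holomorphic_on {z. Im z > 0}"
    and Im_le: "\<And>z. Im z > 0 \<Longrightarrow> Im (G z) \<le> 0"
    and bound: "\<And>z. Im z > 0 \<Longrightarrow> cmod (G z) \<le> 1 / Im z"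
    and lim: "((\<lambda>y. \<i> * complex_of_real y * G (\<i> * complex_of_real y)) \<longlongrightarrow> 1) at_top"
begin

text \<open>Uniformity in the vertical shift \<open>\<epsilon>\<close> is the point: the same height
  \<open>y\<close> serves all shifted functions. This yields the total mass of each shifted measure
  and the tightness of the family. Replacing \<open>y + \<epsilon>\<close> by \<open>y\<close> costs
  at most \<open>1 / y\<close>.\<close>

lemma Re_lower:
  assumes "e > 0"
  shows "\<forall>\<^sub>F y in at_top. \<forall>\<epsilon>\<ge>0. \<epsilon> \<le> 1 \<longrightarrow> y * - Im (G (\<i> * of_real (y + \<epsilon>))) > 1 - e"
proof -
  have "((\<lambda>y. Re (\<i> * complex_of_real y * G (\<i> * complex_of_real y))) \<longlongrightarrow> Re 1) at_top"
    by (intro tendsto_Re lim)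
  then have "\<forall>\<^sub>F y in at_top. Re (\<i> * complex_of_real y * G (\<i> * complex_of_real y)) > 1 - e / 2"
    by (rule order_tendstoD(1)) (use assms in auto)
  then have "\<forall>\<^sub>F y in at_top. y * - Im (G (\<i> * complex_of_real y)) > 1 - e / 2" by simp
  then obtain y0 where y0: "\<And>y. y \<ge> y0 \<Longrightarrow> y * - Im (G (\<i> * complex_of_real y)) > 1 - e / 2"
    unfolding eventually_at_top_linorder by blast
  show ?thesis
    using eventually_ge_at_top[of y0] eventually_gt_at_top[of 0] eventually_gt_at_top[of "2 / e"]
  proof eventually_elim
    case (elim y)
    show ?case
    proof safe
      fix \<epsilon> :: real assume \<epsilon>: "0 \<le> \<epsilon>" "\<epsilon> \<le> 1"
      let ?I = "- Im (G (\<i> * complex_of_real (y + \<epsilon>)))"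
      have "?I \<le> cmod (G (\<i> * complex_of_real (y + \<epsilon>)))" using abs_Im_le_cmod[of "G (\<i> * complex_of_real (y + \<epsilon>))"] by linarith
      also have "\<dots> \<le> 1 / (y + \<epsilon>)" using bound[of "\<i> * complex_of_real (y + \<epsilon>)"] elim \<epsilon> by simp
      also have "\<dots> \<le> 1 / y" using elim \<epsilon> by (intro divide_left_mono) auto
      finally have I: "?I \<le> 1 / y" .
      have "\<epsilon> * ?I \<le> 1 * ?I"
        using Im_le[of "\<i> * complex_of_real (y + \<epsilon>)"] elim \<epsilon> by (intro mult_right_mono) auto
      also have "1 * ?I \<le> 1 / y" using I by simp
      also have "1 / y < e / 2" using elim assms by (simp add: field_simps)
      finally have "\<epsilon> * ?I < e / 2" .
      moreover have "(y + \<epsilon>) * ?I > 1 - e / 2" using y0[of "y + \<epsilon>"] elim \<epsilon> by simp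
      ultimately show "1 - e < y * ?I" by (simp add: algebra_simps)
    qed
  qed
qed

text \<open>After the shift the function is bounded and holomorphic across the real axis, so the
  Poisson formula applies and \<open>- Im g / pi\<close> on the axis is the density of the
  measure.\<close>

lemma shifted_representation:
  assumes \<epsilon>: "0 < \<epsilon>" "\<epsilon> \<le> 1"
  shows "\<exists>M. real_distribution M \<and> (\<forall>z. Im z > 0 \<longrightarrow> cauchy_transform M z = G (z + \<i> * of_real \<epsilon>))"
proof -
  define g where "g w = G (w + \<i> * of_real \<epsilon>)" for w
  have holg: "g holomorphic_on {w. - \<epsilon> < Im w}"
    unfolding g_def by (rule holomorphic_on_compose_gen[OF _ hol, unfolded o_def]) (auto intro!: holomorphic_intros)
  have bdg: "cmod (g w) \<le> 1 / \<epsilon>" if "0 \<le> Im w" for w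
  proof -
    have "cmod (g w) \<le> 1 / (Im w + \<epsilon>)" using bound[of "w + \<i> * of_real \<epsilon>"] that \<epsilon> by (simp add: g_def)
    also have "\<dots> \<le> 1 / \<epsilon>" using that \<epsilon> by (intro divide_left_mono) auto
    finally show ?thesis .
  qed
  have bdg': "cmod (g w) \<le> 1 / Im w" if "0 < Im w" for w
  proof -
    have "cmod (g w) \<le> 1 / (Im w + \<epsilon>)" using bound[of "w + \<i> * of_real \<epsilon>"] that \<epsilon> by (simp add: g_def)
    also have "\<dots> \<le> 1 / Im w" using that \<epsilon> by (intro divide_left_mono) auto
    finally show ?thesis .
  qed
  note poisson = poisson_half_plane[OF holg \<epsilon>(1) bdg]
  define p where "p x = - Im (g (complex_of_real x)) / pi" for x
  have p0: "0 \<le> p x" for x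
    using Im_le[of "complex_of_real x + \<i> * of_real \<epsilon>"] \<epsilon> by (simp add: p_def g_def divide_nonpos_pos)
  have "continuous_on UNIV (\<lambda>x. g (complex_of_real x))"
    by (rule continuous_on_compose2[OF holomorphic_on_imp_continuous_on[OF holg]])
       (use \<epsilon> in \<open>auto intro!: continuous_intros\<close>)
  then have "continuous_on UNIV p" unfolding p_def by (intro continuous_intros) auto
  then have p_meas [measurable]: "p \<in> borel_measurable borel" by (rule borel_measurable_continuous_onI)
  have P: "integrable lborel (\<lambda>x. p x * (1 / (cmod (of_real x - z))\<^sup>2))"
     "(\<integral>x. p x * (1 / (cmod (of_real x - z))\<^sup>2) \<partial>lborel) = - Im (g z) / Im z" if z: "Im z > 0" for z
  proof -
    let ?f = "\<lambda>x. g (of_real x) * of_real (1 / (cmod (of_real x - z))\<^sup>2)"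
    have eq: "p x * (1 / (cmod (of_real x - z))\<^sup>2) = (- 1 / pi) * Im (?f x)" for x
      by (simp add: p_def)
    show "integrable lborel (\<lambda>x. p x * (1 / (cmod (of_real x - z))\<^sup>2))"
      unfolding eq using integrable_Im[OF poisson(1)[OF _ z]] by (intro integrable_mult_right) auto
    show "(\<integral>x. p x * (1 / (cmod (of_real x - z))\<^sup>2) \<partial>lborel) = - Im (g z) / Im z"
      unfolding eq integral_mult_right_zero
      using integral_Im[OF poisson(1)[OF _ z]] poisson(2)[OF _ z] by simp
  qed
  \<comment> \<open>With \<open>y = n + 1\<close>, \<open>f n\<close> is \<open>y\<^sup>2\<close>
    times the Poisson integrand at \<open>i y\<close>. It increases to \<open>p\<close>, while its
    integral \<open>y * - Im (g (i y))\<close> tends to 1.\<close>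
  have mass: "integrable lborel p \<and> integral\<^sup>L lborel p = 1"
  proof -
    define f where "f n x = (real (Suc n))\<^sup>2 * (p x * (1 / (cmod (of_real x - \<i> * of_real (real (Suc n))))\<^sup>2))" for n x
    have fx: "f n x = p x * ((real (Suc n))\<^sup>2 / (x\<^sup>2 + (real (Suc n))\<^sup>2))" for n x
    proof -
      have "(cmod (of_real x - \<i> * of_real y))\<^sup>2 = x\<^sup>2 + y\<^sup>2" for y
        by (simp add: cmod_power2)
      then show ?thesis unfolding f_def by (simp only:) simp
    qed
    have int: "integrable lborel (f n)" "integral\<^sup>L lborel (f n) = real (Suc n) * - Im (g (\<i> * of_real (real (Suc n))))" for n
    proof -
      have z: "Im (\<i> * complex_of_real (real (Suc n))) > 0" by simp
      show "integrable lborel (f n)" unfolding f_def using P(1)[OF z] by (rule integrable_mult_right)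
      have "integral\<^sup>L lborel (f n) = (real (Suc n))\<^sup>2 * (- Im (g (\<i> * of_real (real (Suc n)))) / Im (\<i> * complex_of_real (real (Suc n))))"
        unfolding f_def integral_mult_right_zero P(2)[OF z] ..
      then show "integral\<^sup>L lborel (f n) = real (Suc n) * - Im (g (\<i> * of_real (real (Suc n))))"
        by (simp add: power2_eq_square del: of_nat_Suc)
    qed
    have lim1: "(\<lambda>n. integral\<^sup>L lborel (f n)) \<longlonglongrightarrow> 1"
    proof (rule LIMSEQ_I)
      fix r :: real assume r: "r > 0"
      have "\<forall>\<^sub>F n in sequentially. \<forall>\<epsilon>\<ge>0. \<epsilon> \<le> 1 \<longrightarrow> real (Suc n) * - Im (G (\<i> * of_real (real (Suc n) + \<epsilon>))) > 1 - r"
        by (rule eventually_compose_filterlim[OF Re_lower[OF r]])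
           (intro filterlim_compose[OF filterlim_real_sequentially filterlim_Suc])
      then have "\<forall>\<^sub>F n in sequentially. norm (integral\<^sup>L lborel (f n) - 1) < r"
      proof eventually_elim
        case (elim n)
        have "real (Suc n) * - Im (G (\<i> * of_real (real (Suc n) + \<epsilon>))) > 1 - r" using elim \<epsilon> by simp
        moreover have "G (\<i> * of_real (real (Suc n) + \<epsilon>)) = g (\<i> * of_real (real (Suc n)))"
          by (simp add: g_def algebra_simps)
        ultimately have "integral\<^sup>L lborel (f n) > 1 - r" unfolding int by simp
        moreover have "integral\<^sup>L lborel (f n) \<le> 1"
        proof -
          have "- Im (g (\<i> * of_real (real (Suc n)))) \<le> cmod (g (\<i> * of_real (real (Suc n))))"
            using abs_Im_le_cmod[of "g (\<i> * of_real (real (Suc n)))"] by linarith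
          also have "\<dots> \<le> 1 / real (Suc n)" using bdg'[of "\<i> * of_real (real (Suc n))"] by simp
          finally have "real (Suc n) * - Im (g (\<i> * of_real (real (Suc n)))) \<le> real (Suc n) * (1 / real (Suc n))"
            by (rule mult_left_mono) simp
          then show ?thesis unfolding int by simp
        qed
        ultimately show ?case by simp
      qed
      then show "\<exists>no. \<forall>n\<ge>no. norm (integral\<^sup>L lborel (f n) - 1) < r"
        by (simp add: eventually_sequentially)
    qed
    have m: "AE x in lborel. mono (\<lambda>n. f n x)"
    proof (intro AE_I2 monoI)
      fix x and m n :: nat assume mn: "m \<le> n"
      have "a / (x\<^sup>2 + a) \<le> b / (x\<^sup>2 + b)" if "a \<le> b" "0 < a" for a b :: real
      proof -
        have "a * (x\<^sup>2 + b) \<le> b * (x\<^sup>2 + a)" using that by (simp add: algebra_simps mult_right_mono)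
        moreover have "x\<^sup>2 + a > 0" "x\<^sup>2 + b > 0" using that by (auto intro: add_nonneg_pos)
        ultimately show ?thesis by (simp add: frac_le_eq divide_le_0_iff mult_pos_pos)
      qed
      then show "f m x \<le> f n x" unfolding fx using mn p0
        by (intro mult_left_mono) (auto intro!: power_mono)
    qed
    have l: "AE x in lborel. (\<lambda>n. f n x) \<longlonglongrightarrow> p x"
    proof (intro AE_I2)
      fix x
      have "(\<lambda>n. p x * ((real n)\<^sup>2 / (x\<^sup>2 + (real n)\<^sup>2))) \<longlonglongrightarrow> p x * 1"
        by (intro tendsto_mult tendsto_const) real_asymp
      from LIMSEQ_Suc[OF this] show "(\<lambda>n. f n x) \<longlonglongrightarrow> p x" unfolding fx mult_1_right .
    qed
    have pm: "p \<in> borel_measurable lborel" by simp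
    show ?thesis
      using integrable_monotone_convergence[OF int(1) m l lim1 pm] integral_monotone_convergence[OF int(1) m l lim1 pm] by simp
  qed
  define M where "M = density lborel (\<lambda>x. ennreal (p x))"
  have mass_1: "emeasure M (space M) = 1"
    unfolding M_def using mass p0
    by (simp add: emeasure_density nn_integral_eq_integral)
  have "sets M = sets borel" by (simp add: M_def)
  with prob_spaceI[OF mass_1] have rd: "real_distribution M"
    by (intro real_distribution.intro real_distribution_axioms.intro)
  interpret M: real_distribution M by fact
  have energy: "cauchy_energy M z = - Im (g z) / Im z" if "Im z > 0" for z
  proof -
    have "cauchy_energy M z = (\<integral>s. p s *\<^sub>R (1 / (cmod (z - complex_of_real s))\<^sup>2) \<partial>lborel)"
      unfolding energy_def M_def using p0 by (intro integral_density) auto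
    also have "\<dots> = (\<integral>s. p s * (1 / (cmod (of_real s - z))\<^sup>2) \<partial>lborel)"
      by (simp add: norm_minus_commute)
    finally show ?thesis using P(2)[OF that] by simp
  qed
  \<comment> \<open>The Poisson formula matches imaginary parts only. The real-valued holomorphic
    difference vanishes because both terms are at most \<open>1 / y\<close> at
    \<open>i y\<close>.\<close>
  have "cauchy_transform M z - g z = 0" if z: "Im z > 0" for z
  proof (rule holomorphic_real_valued_eq_0[where D = "\<lambda>z. cauchy_transform M z - g z" and C = 2, OF _ _ _ z])
    show "(\<lambda>z. cauchy_transform M z - g z) holomorphic_on {z. Im z > 0}"
      using \<epsilon> by (intro holomorphic_intros M.cauchy_transform_holomorphic holomorphic_on_subset[OF holg]) auto
    show "Im (cauchy_transform M z - g z) = 0" if "Im z > 0" for z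
      using M.cauchy.Im_T[OF off_support_Im, of z] that by (simp add: energy)
    show "cmod (cauchy_transform M (\<i> * complex_of_real y) - g (\<i> * complex_of_real y)) \<le> 2 / y" if "y > 0" for y
      using norm_triangle_ineq4[of "cauchy_transform M (\<i> * complex_of_real y)" "g (\<i> * complex_of_real y)"]
        M.cmod_cauchy_transform_le[of "\<i> * complex_of_real y"] bdg'[of "\<i> * complex_of_real y"] that by simp
  qed
  then show ?thesis using rd unfolding g_def by (intro exI[of _ M]) simp
qed

text \<open>The shifts are removed by weak compactness: the measures for \<open>\<epsilon> n\<close>
  are tight, and along a convergent subsequence the Cauchy transforms converge at each
  \<open>z\<close>, the kernel being bounded and continuous in \<open>s\<close>.\<close>

theorem representation:
  "\<exists>R. real_distribution R \<and> (\<forall>z. Im z > 0 \<longrightarrow> cauchy_transform R z = G z)"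
proof -
  define \<epsilon> where "\<epsilon> n = 1 / real (Suc n)" for n
  have \<epsilon>: "0 < \<epsilon> n" "\<epsilon> n \<le> 1" for n by (auto simp: \<epsilon>_def)
  have "\<exists>M. \<forall>n. real_distribution (M n) \<and> (\<forall>z. Im z > 0 \<longrightarrow> cauchy_transform (M n) z = G (z + \<i> * of_real (\<epsilon> n)))"
    using shifted_representation[OF \<epsilon>] by (intro choice) blast
  then obtain M where M: "\<And>n. real_distribution (M n)"
    "\<And>n z. Im z > 0 \<Longrightarrow> cauchy_transform (M n) z = G (z + \<i> * of_real (\<epsilon> n))" by blast
  have "tight M"
    unfolding tight_def
  proof (intro conjI allI impI)
    show "real_distribution (M n)" for n by (rule M)
    fix e :: real assume e: "e > 0"
    have "\<forall>\<^sub>F y in at_top. 0 < y \<and> (\<forall>\<epsilon>\<ge>0. \<epsilon> \<le> 1 \<longrightarrow> y * - Im (G (\<i> * of_real (y + \<epsilon>))) > 1 - e / 2)"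
      using e by (intro eventually_conj eventually_gt_at_top Re_lower) simp
    then obtain y where y: "0 < y" "\<And>\<epsilon>. 0 \<le> \<epsilon> \<Longrightarrow> \<epsilon> \<le> 1 \<Longrightarrow> y * - Im (G (\<i> * of_real (y + \<epsilon>))) > 1 - e / 2"
      using eventually_happens'[OF trivial_limit_at_top_linorder] by blast
    have "measure (M n) {- y<..y} > 1 - e" for n
    proof -
      interpret real_distribution "M n" by (rule M)
      have off: "off_support (M n) (\<i> * complex_of_real y)" using y by (intro off_support_Im) simp
      have "Im (cauchy_transform (M n) (\<i> * complex_of_real y)) = - y * cauchy_energy (M n) (\<i> * complex_of_real y)"
        using cauchy.Im_T[OF off] by simp
      moreover have "cauchy_transform (M n) (\<i> * complex_of_real y) = G (\<i> * of_real (y + \<epsilon> n))"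
        using M(2)[of "\<i> * complex_of_real y" n] y by (simp add: algebra_simps)
      ultimately have "1 - e / 2 < y * (y * cauchy_energy (M n) (\<i> * complex_of_real y))"
        using y(2)[of "\<epsilon> n"] \<epsilon>[of n] by simp
      also have "\<dots> = (\<integral>s. (y * y) * (1 / (cmod (\<i> * complex_of_real y - complex_of_real s))\<^sup>2) \<partial>M n)"
        unfolding energy_def integral_mult_right_zero by simp
      \<comment> \<open>The integrand \<open>y\<^sup>2 / (s\<^sup>2 + y\<^sup>2)\<close> is at most
        1 everywhere and at most \<open>1 / 2\<close> off the interval. A value above
        \<open>1 - e / 2\<close> thus forces mass above \<open>1 - e\<close> on the
        interval.\<close>
      also have "\<dots> \<le> (\<integral>s. (1 + indicator {- y<..y} s) / 2 \<partial>M n)"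
      proof (rule integral_mono)
        show "integrable (M n) (\<lambda>s. (y * y) * (1 / (cmod (\<i> * complex_of_real y - complex_of_real s))\<^sup>2))"
          using cauchy.integrable_energy[OF off] by (rule integrable_mult_right)
        show "integrable (M n) (\<lambda>s. (1 + indicator {- y<..y} s) / 2 :: real)"
          by (intro integrable_const_bound[of _ 1]) (auto simp: indicator_def)
        fix s :: real
        have eq: "(y * y) * (1 / (cmod (\<i> * complex_of_real y - complex_of_real s))\<^sup>2) = y\<^sup>2 / (s\<^sup>2 + y\<^sup>2)"
          unfolding cmod_power2 by (simp add: power2_eq_square)
        have pos: "s\<^sup>2 + y\<^sup>2 > 0" using y by (simp add: add_nonneg_pos)
        show "(y * y) * (1 / (cmod (\<i> * complex_of_real y - complex_of_real s))\<^sup>2) \<le> (1 + indicator {- y<..y} s) / 2"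
        proof (cases "s \<in> {- y<..y}")
          case True
          then show ?thesis unfolding eq using pos by (simp add: divide_le_eq)
        next
          case False
          then have "\<bar>y\<bar> \<le> \<bar>s\<bar>" using y by auto
          then have "y\<^sup>2 \<le> s\<^sup>2" by (simp add: abs_le_square_iff)
          then show ?thesis unfolding eq using pos False by (simp add: divide_le_eq)
        qed
      qed
      also have "\<dots> = (1 + measure (M n) {- y<..y}) / 2"
      proof -
        have "integrable (M n) (indicator {- y<..y} :: real \<Rightarrow> real)"
          by (intro integrable_const_bound[of _ 1]) (auto simp: indicator_def)
        then show ?thesis using prob_space by simp
      qed
      finally show ?thesis by simp
    qed
    then have "- y < y \<and> (\<forall>n. 1 - e < measure (M n) {- y<..y})" using y(1) by simp
    then show "\<exists>a b. a < b \<and> (\<forall>n. 1 - e < measure (M n) {a<..b})" by blast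
  qed
  from tight_imp_convergent_subsubsequence[OF this strict_mono_id]
  obtain r R where r: "strict_mono (r :: nat \<Rightarrow> nat)" and R: "real_distribution R" and w: "weak_conv_m (M \<circ> r) R"
    by auto
  have "cauchy_transform R z = G z" if z: "Im z > 0" for z
  proof -
    have "(\<lambda>n. cauchy_transform ((M \<circ> r) n) z) \<longlonglongrightarrow> cauchy_transform R z"
      unfolding cauchy_transform_def
    proof (rule weak_conv_imp_integral_bdd_continuous_conv[OF _ R w])
      show "real_distribution ((M \<circ> r) n)" for n using M by simp
      show "isCont (\<lambda>s. 1 / (z - complex_of_real s)) x" for x
        using z by (intro continuous_intros) auto
      show "norm (1 / (z - complex_of_real s)) \<le> 1 / Im z" for s
        using cmod_ge_Im[of z s] z by (auto simp: norm_divide intro!: divide_left_mono mult_pos_pos)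
    qed
    moreover have "(\<lambda>n. cauchy_transform ((M \<circ> r) n) z) \<longlonglongrightarrow> G z"
    proof -
      have "\<epsilon> \<longlonglongrightarrow> 0" unfolding \<epsilon>_def by (rule LIMSEQ_Suc, rule lim_1_over_n)
      then have "(\<lambda>n. \<epsilon> (r n)) \<longlonglongrightarrow> 0" using LIMSEQ_subseq_LIMSEQ[OF _ r] by (auto simp: o_def)
      then have "(\<lambda>n. z + \<i> * of_real (\<epsilon> (r n))) \<longlonglongrightarrow> z + \<i> * of_real 0" by (intro tendsto_intros)
      moreover have "isCont G z"
        using holomorphic_on_imp_continuous_on[OF hol] z by (simp add: continuous_on_eq_continuous_at open_halfspace_Im_gt)
      ultimately have "(\<lambda>n. G (z + \<i> * of_real (\<epsilon> (r n)))) \<longlonglongrightarrow> G z"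
        using isCont_tendsto_compose by fastforce
      then show ?thesis using M(2)[OF z] by simp
    qed
    ultimately show ?thesis by (rule LIMSEQ_unique)
  qed
  then show ?thesis using R by blast
qed

end

section \<open>Subordination\<close>

lemma (in finite_borel_measure) levy_energy_small:
  assumes "0 < a" "0 < e"
  shows "\<exists>b>0. \<forall>z\<in>truncated_cone a b. levy_energy M z \<le> e"
proof -
  have [measurable_cong]: "sets M = sets borel" by (rule M_is_borel)
  \<comment> \<open>On the cone \<open>\<bar>s\<bar> \<le> (a + 2) * r\<close> for the distance
    \<open>r\<close> from \<open>z\<close> to \<open>s\<close>, and \<open>1 \<le> r\<close> once
    \<open>b > 1\<close>; together these bound \<open>(1 + s\<^sup>2) / r\<^sup>2\<close> by
    \<open>C\<close>.\<close>
  define C where "C = 1 + (a + 2)\<^sup>2"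
  define f where "f b s = min C ((1 + s\<^sup>2) / b\<^sup>2)" for b s :: real
  have C: "C > 0" by (simp add: C_def add_pos_nonneg)
  have [measurable]: "f b \<in> borel_measurable borel" for b unfolding f_def by measurable
  have f0: "norm (f b s) \<le> C" for b s using C by (auto simp: f_def min_def)
  have int: "integrable M (f b)" for b
    using f0 by (intro integrable_const_bound[of _ C]) auto
  have "((\<lambda>b. \<integral>s. f b s \<partial>M) \<longlongrightarrow> (\<integral>s. 0 \<partial>M)) at_top"
  proof (rule integral_dominated_convergence_at_top[where w="\<lambda>_. C"])
    show "AE s in M. ((\<lambda>b. f b s) \<longlongrightarrow> 0) at_top"
    proof (rule AE_I2)
      fix s :: real
      have "((\<lambda>b. (1 + s\<^sup>2) / b\<^sup>2) \<longlongrightarrow> 0) at_top" by real_asymp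
      then have "((\<lambda>b. f b s) \<longlongrightarrow> min C 0) at_top"
        unfolding f_def by (intro tendsto_min tendsto_const)
      then show "((\<lambda>b. f b s) \<longlongrightarrow> 0) at_top" using C by simp
    qed
    show "\<forall>\<^sub>F b in at_top. AE s in M. norm (f b s) \<le> C" using f0 by simp
  qed simp_all
  then have "((\<lambda>b. \<integral>s. f b s \<partial>M) \<longlongrightarrow> 0) at_top" by simp
  then have "\<forall>\<^sub>F b in at_top. (\<integral>s. f b s \<partial>M) < e"
    by (rule order_tendstoD(2)) (rule assms)
  then have "\<forall>\<^sub>F b in at_top. (\<integral>s. f b s \<partial>M) < e \<and> 1 < b"
    by (intro eventually_conj eventually_gt_at_top)
  then obtain b where b: "(\<integral>s. f b s \<partial>M) < e" "1 < b"
    using eventually_happens'[OF trivial_limit_at_top_linorder] by blast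
  have "levy_energy M z \<le> e" if z: "z \<in> truncated_cone a b" for z
  proof -
    have b0: "0 < b" using b by simp
    note c = truncated_coneD[OF z assms(1) b0]
    have off: "off_support M z" using c by (intro off_support_Im) simp
    have "levy_energy M z \<le> (\<integral>s. f b s \<partial>M)"
      unfolding energy_def
    proof (rule integral_mono[OF levy.integrable_energy[OF off] int])
      fix s :: real
      define r where "r = cmod (z - complex_of_real s)"
      have r: "Im z \<le> r" using cmod_ge_Im[of z s] by (simp add: r_def)
      have r1: "b \<le> r" "1 \<le> r" using r c b by auto
      have "\<bar>s\<bar> = cmod (z - (z - complex_of_real s))" by simp
      also have "\<dots> \<le> cmod z + r" unfolding r_def by (rule norm_triangle_ineq4)
      also have "\<dots> \<le> (a + 1) * r + r" using c(4) r assms mult_left_mono[of "Im z" r "a+1"] by linarith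
      also have "\<dots> = (a + 2) * r" by (simp add: algebra_simps)
      finally have "\<bar>s\<bar>\<^sup>2 \<le> ((a + 2) * r)\<^sup>2" by (intro power_mono) auto
      then have "s\<^sup>2 \<le> (a + 2)\<^sup>2 * r\<^sup>2" by (simp add: power_mult_distrib)
      moreover have "1 \<le> r\<^sup>2" using r1 by simp
      ultimately have "1 + s\<^sup>2 \<le> C * r\<^sup>2" by (simp add: C_def algebra_simps)
      then have "(1 + s\<^sup>2) / r\<^sup>2 \<le> C" using r1 by (simp add: divide_le_eq)
      moreover have "(1 + s\<^sup>2) / r\<^sup>2 \<le> (1 + s\<^sup>2) / b\<^sup>2"
        using r1 b by (intro divide_left_mono power_mono) auto
      ultimately show "(1 + s\<^sup>2) / (cmod (z - complex_of_real s))\<^sup>2 \<le> f b s"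
        by (simp add: f_def r_def)
    qed
    then show ?thesis using b by simp
  qed
  then show ?thesis using b by (intro exI[of _ b]) auto
qed

text \<open>The Pick inequality against the fixed point \<open>z0\<close>: the distance is at most
  \<open>3 * Im z\<close> and the energy at \<open>z\<close> tends to 0. The choice of
  \<open>e\<close> makes this part \<open>\<epsilon> / 2 * Im z\<close>; the other half absorbs the
  value at \<open>z0\<close>.\<close>

lemma (in finite_borel_measure) levy_transform_small:
  assumes "0 < \<epsilon>"
  shows "\<forall>\<^sub>F z in cone_filter. cmod (levy_transform \<gamma> M z) \<le> \<epsilon> * Im z"
proof -
  define z0 where "z0 = \<i>"
  define A B where "A = levy_energy M z0" and "B = cmod (levy_transform \<gamma> M z0)"
  have A: "A \<ge> 0" unfolding A_def by (rule levy.energy_nonneg)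
  define e where "e = (\<epsilon> / 6)\<^sup>2 / (A + 1)"
  have e: "e > 0" using assms A by (simp add: e_def)
  obtain b where b: "b > 0" "\<And>z. z \<in> truncated_cone 1 b \<Longrightarrow> levy_energy M z \<le> e"
    using levy_energy_small[OF zero_less_one e] by blast
  have "\<forall>\<^sub>F z in cone_filter. z \<in> truncated_cone 1 b \<and> 1 < Im z \<and> 2 * B / \<epsilon> < Im z"
    by (intro eventually_conj eventually_in_truncated_cone eventually_Im_gt) simp
  then show ?thesis
  proof eventually_elim
    case (elim z)
    then have zc: "z \<in> truncated_cone 1 b" by simp
    note c = truncated_coneD[OF zc zero_less_one b(1)]
    have "cmod (levy_transform \<gamma> M z - levy_transform \<gamma> M z0) \<le> cmod (z - z0) * sqrt (levy_energy M z * A)"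
      unfolding A_def using c by (intro levy.cmod_T_diff_le off_support_Im) (auto simp: z0_def)
    also have "\<dots> \<le> (3 * Im z) * (\<epsilon> / 6)"
    proof (intro mult_mono)
      show "cmod (z - z0) \<le> 3 * Im z"
        using norm_triangle_ineq4[of z z0] c elim by (simp add: z0_def)
      have "levy_energy M z * A \<le> e * (A + 1)"
        using b(2)[OF zc] A e by (intro mult_mono) auto
      also have "\<dots> = (\<epsilon> / 6)\<^sup>2" using A by (simp add: e_def)
      finally have "sqrt (levy_energy M z * A) \<le> sqrt ((\<epsilon> / 6)\<^sup>2)" by (rule real_sqrt_le_mono)
      then show "sqrt (levy_energy M z * A) \<le> \<epsilon> / 6" using assms by simp
    qed (use c A levy.energy_nonneg in auto)
    also have "\<dots> = \<epsilon> * Im z / 2" by simp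
    finally have 1: "cmod (levy_transform \<gamma> M z - levy_transform \<gamma> M z0) \<le> \<epsilon> * Im z / 2" .
    have "B \<le> \<epsilon> * Im z / 2" using elim assms by (simp add: field_simps)
    then show ?case
      using 1 norm_triangle_sub[of "levy_transform \<gamma> M z" "levy_transform \<gamma> M z0"] by (simp add: B_def)
  qed
qed

locale subordination = nu: real_distribution \<nu> + sg: finite_borel_measure \<sigma>
  for \<nu> \<sigma> :: "real measure" +
  fixes \<gamma> t :: real
  assumes t_nonneg: "0 \<le> t"
begin

definition N :: "complex \<Rightarrow> complex" where
  "N w = - of_real t * levy_transform \<gamma> \<sigma> (F_transform \<nu> w)"

definition H :: "complex \<Rightarrow> complex" where
  "H w = w - N w"

text \<open>The product of \<open>t\<close>, the ratio \<open>- Im \<phi> / Im\<close> at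
  \<open>F w\<close> and the ratio \<open>Im F / Im\<close> at \<open>w\<close>. Writing the ratios
  as energies makes \<open>K\<close> meaningful and continuous at regular real points too.\<close>

definition K :: "complex \<Rightarrow> real" where
  "K w = t * levy_energy \<sigma> (F_transform \<nu> w) * (cauchy_energy \<nu> w / (cmod (cauchy_transform \<nu> w))\<^sup>2)"

text \<open>On the real line these are the points to which \<open>N\<close> extends analytically by its defining formula.\<close>

definition regular :: "complex \<Rightarrow> bool" where
  "regular w \<longleftrightarrow> off_support \<nu> w \<and> cauchy_transform \<nu> w \<noteq> 0 \<and> off_support \<sigma> (F_transform \<nu> w)"

lemma K_nonneg: "0 \<le> K w"
  unfolding K_def using t_nonneg nu.cauchy.energy_nonneg sg.levy.energy_nonneg by simp

lemma regular_upper: "Im w > 0 \<Longrightarrow> regular w"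
proof -
  assume w: "Im w > 0"
  then have "Im (F_transform \<nu> w) > 0" using nu.F_transform_pick(2)[OF w w] by linarith
  then show ?thesis unfolding regular_def
    using w nu.cauchy_transform_neq_0[OF w] off_support_Im by auto
qed

lemma Im_N: "regular w \<Longrightarrow> Im (N w) = Im w * K w"
  unfolding regular_def N_def K_def
  by (simp add: sg.levy.Im_T nu.Im_F_transform)

lemma Im_H: "regular w \<Longrightarrow> Im (H w) = Im w * (1 - K w)"
  unfolding H_def by (simp add: Im_N algebra_simps)

text \<open>The Pick inequalities for \<open>G\<close> and for the Levy integral are chained through
  \<open>F = 1 / G\<close>. Neither divides by an imaginary part, so real regular points are
  covered.\<close>

lemma pick:
  assumes "regular w" "regular w'"
  shows "cmod (N w - N w') \<le> cmod (w - w') * sqrt (K w * K w')"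
proof -
  note r = assms[unfolded regular_def]
  define g g' where "g = cauchy_transform \<nu> w" and "g' = cauchy_transform \<nu> w'"
  have g: "g \<noteq> 0" "g' \<noteq> 0" using r by (auto simp: g_def g'_def)
  define P P' Q Q' where "P = levy_energy \<sigma> (F_transform \<nu> w)" and "P' = levy_energy \<sigma> (F_transform \<nu> w')"
    and "Q = cauchy_energy \<nu> w" and "Q' = cauchy_energy \<nu> w'"
  have nn: "0 \<le> P" "0 \<le> P'" "0 \<le> Q" "0 \<le> Q'"
    by (simp_all add: P_def P'_def Q_def Q'_def nu.cauchy.energy_nonneg sg.levy.energy_nonneg)
  have "cmod (F_transform \<nu> w - F_transform \<nu> w') = cmod (g - g') / (cmod g * cmod g')"
    unfolding F_transform_def g_def[symmetric] g'_def[symmetric] using g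
    by (simp add: diff_divide_eq_iff divide_diff_eq_iff norm_divide norm_mult norm_minus_commute mult.commute)
  also have "\<dots> \<le> (cmod (w - w') * sqrt (Q * Q')) / (cmod g * cmod g')"
    unfolding g_def g'_def Q_def Q'_def using r by (intro divide_right_mono nu.cauchy.cmod_T_diff_le) auto
  finally have F: "cmod (F_transform \<nu> w - F_transform \<nu> w') \<le> (cmod (w - w') * sqrt (Q * Q')) / (cmod g * cmod g')" .
  have "cmod (N w - N w') = t * cmod (levy_transform \<gamma> \<sigma> (F_transform \<nu> w) - levy_transform \<gamma> \<sigma> (F_transform \<nu> w'))"
  proof -
    have "N w - N w' = - of_real t * (levy_transform \<gamma> \<sigma> (F_transform \<nu> w) - levy_transform \<gamma> \<sigma> (F_transform \<nu> w'))"
      by (simp add: N_def algebra_simps)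
    then show ?thesis using t_nonneg by (simp add: norm_mult)
  qed
  also have "\<dots> \<le> t * (cmod (F_transform \<nu> w - F_transform \<nu> w') * sqrt (P * P'))"
    unfolding P_def P'_def using r t_nonneg by (intro mult_left_mono sg.levy.cmod_T_diff_le) auto
  also have "\<dots> \<le> t * ((cmod (w - w') * sqrt (Q * Q')) / (cmod g * cmod g') * sqrt (P * P'))"
    using F t_nonneg nn by (intro mult_left_mono mult_right_mono) auto
  also have "\<dots> = cmod (w - w') * sqrt (K w * K w')"
  proof -
    have "K w * K w' = (t / (cmod g * cmod g'))\<^sup>2 * ((Q * Q') * (P * P'))"
      unfolding K_def P_def[symmetric] P'_def[symmetric] Q_def[symmetric] Q'_def[symmetric] g_def[symmetric] g'_def[symmetric]
      by (simp add: power2_eq_square mult_ac)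
    then have "sqrt (K w * K w') = t / (cmod g * cmod g') * (sqrt (Q * Q') * sqrt (P * P'))"
      using t_nonneg by (simp add: real_sqrt_mult)
    then show ?thesis by simp
  qed
  finally show ?thesis .
qed

lemma isCont_F: "regular w \<Longrightarrow> isCont (F_transform \<nu>) w"
  unfolding F_transform_def regular_def by (intro continuous_intros nu.cauchy.isCont_T) auto

lemma isCont_H: "regular w \<Longrightarrow> isCont H w"
  unfolding H_def N_def
  by (intro continuous_intros isCont_o2[OF isCont_F] sg.levy.isCont_T) (auto simp: regular_def)

lemma isCont_K: "regular w \<Longrightarrow> isCont K w"
  unfolding K_def
  by (intro continuous_intros isCont_o2[OF isCont_F] sg.levy.isCont_energy nu.cauchy.isCont_energy nu.cauchy.isCont_T)
     (auto simp: regular_def)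

lemma eventually_regular:
  assumes "regular w"
  shows "\<forall>\<^sub>F w' in nhds w. regular w'"
proof -
  have off: "\<forall>\<^sub>F z' in nhds z. off_support M z'" if off: "off_support M z" for M z
  proof -
    obtain d where "d > 0" "\<And>z'. dist z' z < d / 2 \<Longrightarrow> off_support M z'"
      by (rule off_support_near[OF off]) blast
    then show ?thesis unfolding eventually_nhds_metric by (intro exI[of _ "d / 2"]) simp
  qed
  have r: "off_support \<nu> w" "cauchy_transform \<nu> w \<noteq> 0" "off_support \<sigma> (F_transform \<nu> w)"
    using assms by (simp_all add: regular_def)
  have G: "(cauchy_transform \<nu> \<longlongrightarrow> cauchy_transform \<nu> w) (nhds w)"
    using nu.cauchy.isCont_T[OF r(1)] by (simp add: isCont_def tendsto_at_iff_tendsto_nhds)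
  have F: "filterlim (F_transform \<nu>) (nhds (F_transform \<nu> w)) (nhds w)"
    using isCont_F[OF assms] by (simp add: isCont_def tendsto_at_iff_tendsto_nhds)
  show ?thesis
    unfolding regular_def
    by (intro eventually_conj off[OF r(1)] tendsto_imp_eventually_ne[OF G r(2)]
        eventually_compose_filterlim[OF off[OF r(3)] F])
qed

lemma H_holomorphic: "H holomorphic_on {w. Im w > 0}"
proof -
  have "(levy_transform \<gamma> \<sigma> \<circ> F_transform \<nu>) holomorphic_on {w. Im w > 0}"
  proof (rule holomorphic_on_compose_gen[OF nu.F_transform_holomorphic sg.levy.T_holomorphic])
    show "F_transform \<nu> ` {w. 0 < Im w} \<subseteq> {z. 0 < Im z}"
      using nu.F_transform_pick(2) by (auto intro: less_le_trans)
  qed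
  then show ?thesis unfolding H_def N_def o_def by (intro holomorphic_intros)
qed

lemma N_has_field_derivative:
  assumes "regular (complex_of_real x)"
  shows "(N has_field_derivative complex_of_real (K (of_real x))) (at (of_real x))"
proof -
  let ?x = "complex_of_real x"
  have r: "off_support \<nu> ?x" "cauchy_transform \<nu> ?x \<noteq> 0" "off_support \<sigma> (F_transform \<nu> ?x)"
    using assms by (simp_all add: regular_def)
  have "cauchy_transform \<nu> ?x \<in> \<real>" by (rule nu.cauchy.T_real[OF r(1)])
  then obtain g where g: "cauchy_transform \<nu> ?x = complex_of_real g" by (auto elim: Reals_cases)
  have F: "F_transform \<nu> ?x = complex_of_real (1 / g)" by (simp add: F_transform_def g)
  have g0: "g \<noteq> 0" using r(2) g by auto
  let ?Q = "cauchy_energy \<nu> ?x" and ?P = "levy_energy \<sigma> (F_transform \<nu> ?x)"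
  have dG: "(cauchy_transform \<nu> has_field_derivative - complex_of_real ?Q) (at ?x)"
    by (rule nu.cauchy.T_has_derivative_energy[OF r(1)])
  have dF: "(F_transform \<nu> has_field_derivative complex_of_real (?Q / g\<^sup>2)) (at ?x)"
    unfolding F_transform_def
    using dG r(2) by (auto intro!: derivative_eq_intros simp: g power2_eq_square)
  have dL: "(levy_transform \<gamma> \<sigma> has_field_derivative - complex_of_real ?P) (at (F_transform \<nu> ?x))"
    using sg.levy.T_has_derivative_energy[of "1 / g" \<gamma>] r(3) unfolding F by simp
  have "((\<lambda>w. levy_transform \<gamma> \<sigma> (F_transform \<nu> w)) has_field_derivative - complex_of_real ?P * complex_of_real (?Q / g\<^sup>2)) (at ?x)"
    by (rule DERIV_chain2[OF dL dF])
  from DERIV_cmult[OF this, of "- of_real t"] show ?thesis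
    unfolding N_def K_def using g by (simp add: mult.assoc)
qed

lemma N_real:
  assumes "regular (complex_of_real x)"
  shows "N (complex_of_real x) \<in> \<real>"
  using Im_N[OF assms] by (simp add: complex_is_Real_iff)

end

section \<open>The subordination function as a right inverse of \<open>H\<close>\<close>

context subordination
begin

text \<open>High in a cone \<open>F\<close> is close to the identity: \<open>Im F / Im w\<close> is
  at most 2 there, and \<open>F w\<close> lies where the Levy energy is small.\<close>

lemma K_small:
  assumes "0 < e"
  shows "\<forall>\<^sub>F w in cone_filter. Im w > 0 \<and> K w \<le> e"
proof -
  define e' where "e' = e / (2 * (t + 1))"
  have e': "0 < e'" using assms t_nonneg by (simp add: e'_def)
  obtain b where b: "b > 0" "\<And>z. z \<in> truncated_cone 1 b \<Longrightarrow> levy_energy \<sigma> z \<le> e'"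
    using sg.levy_energy_small[OF zero_less_one e'] by blast
  have small: "\<forall>\<^sub>F z in cone_filter. cmod (F_transform \<nu> z - z) \<le> \<epsilon> * Im z" if "0 < \<epsilon>" for \<epsilon>
    using that by (rule nu.eventually_cmod_F_transform_le)
  have "\<forall>\<^sub>F w in cone_filter. w + (F_transform \<nu> w - w) \<in> truncated_cone 1 b"
    by (rule eventually_add_in_truncated_cone[OF small zero_less_one b(1)])
  moreover have "\<forall>\<^sub>F w in cone_filter. cmod (F_transform \<nu> w - w) \<le> 1 * Im w"
    by (rule small) simp
  ultimately show ?thesis
    using eventually_Im_gt[of 0]
  proof eventually_elim
    case (elim w)
    let ?q = "cauchy_energy \<nu> w / (cmod (cauchy_transform \<nu> w))\<^sup>2"
    have "off_support \<nu> w" using elim by (intro off_support_Im) simp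
    then have "Im (F_transform \<nu> w) = Im w * ?q" using nu.Im_F_transform by simp
    moreover have "Im (F_transform \<nu> w) \<le> 2 * Im w"
      using elim abs_Im_le_cmod[of "F_transform \<nu> w - w"] by simp
    ultimately have "Im w * ?q \<le> Im w * 2" by linarith
    then have q: "?q \<le> 2" using elim mult_le_cancel_left_pos by blast
    have "levy_energy \<sigma> (F_transform \<nu> w) \<le> e'" using elim by (intro b) simp
    then have "K w \<le> t * e' * 2" unfolding K_def using q t_nonneg e' nu.cauchy.energy_nonneg
      by (intro mult_mono mult_left_mono) auto
    also have "\<dots> \<le> e" using assms t_nonneg by (simp add: e'_def field_simps)
    finally show ?case using elim by simp
  qed
qed

text \<open>The future image of \<open>\<omega>\<close>. On it
  \<open>Im H = Im w * (1 - K w)\<close> forces \<open>K < 1\<close>, which makes \<open>H\<close>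
  injective.\<close>

definition \<Omega> :: "complex set" where
  "\<Omega> = {w. Im w > 0 \<and> Im (H w) > 0}"

lemma K_less_1: "w \<in> \<Omega> \<Longrightarrow> K w < 1"
  using Im_H[OF regular_upper] by (auto simp: \<Omega>_def zero_less_mult_iff)

text \<open>With \<open>K w < 1\<close> the Pick inequality against a fixed \<open>w0\<close> gives
  linear growth of slope \<open>sqrt (K w0)\<close>. As \<open>w0\<close> may be taken with small
  \<open>K\<close>, \<open>H\<close> is close to the identity at infinity on all of
  \<open>\<Omega>\<close>, not only inside cones.\<close>

lemma \<Omega>_growth:
  assumes "w \<in> \<Omega>" "Im w0 > 0"
  shows "cmod (w - H w - N w0) \<le> sqrt (K w0) * cmod (w - w0)"
proof -
  have w: "Im w > 0" using assms by (simp add: \<Omega>_def)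
  have "cmod (N w - N w0) \<le> cmod (w - w0) * sqrt (K w * K w0)"
    using w assms by (intro pick regular_upper) auto
  also have "\<dots> \<le> cmod (w - w0) * sqrt (1 * K w0)"
    using K_less_1[OF assms(1)] K_nonneg by (intro mult_left_mono real_sqrt_le_mono mult_right_mono) auto
  finally show ?thesis by (simp add: H_def mult.commute)
qed

lemma \<Omega>_near:
  assumes "e > 0"
  obtains C where "0 \<le> C" "\<And>w. w \<in> \<Omega> \<Longrightarrow> cmod (w - H w) \<le> e * cmod w + C"
proof -
  have "\<forall>\<^sub>F w in cone_filter. Im w > 0 \<and> K w \<le> e\<^sup>2" using assms by (intro K_small) simp
  then obtain w0 where w0: "Im w0 > 0" "K w0 \<le> e\<^sup>2"
    using eventually_happens'[OF cone_filter_neq_bot] by blast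
  have s: "sqrt (K w0) \<le> e" using real_sqrt_le_mono[OF w0(2)] assms by simp
  show thesis
  proof (rule that[of "cmod (N w0) + e * cmod w0"])
    fix w assume w: "w \<in> \<Omega>"
    have "cmod (w - H w) \<le> cmod (w - H w - N w0) + cmod (N w0)" by (metis norm_triangle_sub add.commute)
    also have "cmod (w - H w - N w0) \<le> sqrt (K w0) * cmod (w - w0)" by (rule \<Omega>_growth[OF w w0(1)])
    also have "\<dots> \<le> e * (cmod w + cmod w0)"
      using s assms K_nonneg norm_triangle_ineq4[of w w0] by (intro mult_mono) auto
    finally show "cmod (w - H w) \<le> e * cmod w + (cmod (N w0) + e * cmod w0)" by (simp add: algebra_simps)
  qed (use assms in simp)
qed

lemma \<Omega>_bounded:
  obtains C where "0 \<le> C" "\<And>w. w \<in> \<Omega> \<Longrightarrow> cmod w \<le> 2 * cmod (H w) + C"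
proof -
  obtain C where C: "0 \<le> C" "\<And>w. w \<in> \<Omega> \<Longrightarrow> cmod (w - H w) \<le> 1/2 * cmod w + C"
    by (rule \<Omega>_near[of "1/2"]) auto
  show thesis
  proof (rule that[of "2 * C"])
    fix w assume "w \<in> \<Omega>"
    from C(2)[OF this] show "cmod w \<le> 2 * cmod (H w) + 2 * C"
      using norm_triangle_sub[of w "H w"] by simp
  qed (use C in simp)
qed

text \<open>On \<open>\<Omega>\<close> the Pick factor \<open>sqrt (K w * K w')\<close> is below 1.
  Hence \<open>N\<close> shrinks distances strictly, and equal values of \<open>H\<close> would
  force \<open>N\<close> to preserve one. The first bound says that \<open>\<omega>\<close> shrinks
  distances by at most a factor of 2.\<close>

lemma \<Omega>_expanding:
  assumes "w \<in> \<Omega>" "w' \<in> \<Omega>"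
  shows "cmod (H w - H w') \<le> 2 * cmod (w - w')" and "H w = H w' \<Longrightarrow> w = w'"
proof -
  have i: "Im w > 0" "Im w' > 0" using assms by (auto simp: \<Omega>_def)
  have k: "K w < 1" "K w' < 1" using assms K_less_1 by auto
  have "K w * K w' \<le> K w * 1" using k K_nonneg by (intro mult_left_mono) auto
  then have KK: "K w * K w' < 1" using k by simp
  have p: "cmod (N w - N w') \<le> cmod (w - w') * sqrt (K w * K w')"
    using i by (intro pick regular_upper)
  also have "\<dots> \<le> cmod (w - w') * 1" using KK by (intro mult_left_mono) (auto simp: real_sqrt_le_1_iff)
  finally have "cmod (N w - N w') \<le> cmod (w - w')" by simp
  moreover have "cmod (H w - H w') \<le> cmod (w - w') + cmod (N w - N w')"
  proof -
    have "H w - H w' = (w - w') - (N w - N w')" by (simp add: H_def)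
    then show ?thesis by (metis norm_triangle_ineq4)
  qed
  ultimately show "cmod (H w - H w') \<le> 2 * cmod (w - w')" by simp
  assume "H w = H w'"
  then have "N w - N w' = w - w'" by (simp add: H_def algebra_simps)
  then have "cmod (w - w') \<le> cmod (w - w') * sqrt (K w * K w')" using p by simp
  then have "cmod (w - w') * (1 - sqrt (K w * K w')) \<le> 0" by (simp add: algebra_simps)
  moreover have "1 - sqrt (K w * K w') > 0" using KK by simp
  ultimately show "w = w'" by (simp add: mult_le_0_iff)
qed

lemma open_\<Omega>: "open \<Omega>"
proof -
  have "open ({w. Im w > 0} \<inter> H -` {z. Im z > 0})"
    by (rule continuous_open_preimage[OF holomorphic_on_imp_continuous_on[OF H_holomorphic]])
       (simp_all add: open_halfspace_Im_gt)
  moreover have "\<Omega> = {w. Im w > 0} \<inter> H -` {z. Im z > 0}" by (auto simp: \<Omega>_def)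
  ultimately show ?thesis by simp
qed

lemma Im_H_le: "Im w > 0 \<Longrightarrow> Im (H w) \<le> Im w"
  using Im_H[OF regular_upper, of w] K_nonneg[of w] mult_left_mono[of "1 - K w" 1 "Im w"] by simp

text \<open>Solvability of \<open>H w = z\<close> is an open and closed condition on \<open>z\<close>.\<close>

lemma image_\<Omega>: "H ` \<Omega> = {z. Im z > 0}"
proof -
  let ?U = "{z. Im z > 0}"
  have sub: "H ` \<Omega> \<subseteq> ?U" by (auto simp: \<Omega>_def)
  have hol: "H holomorphic_on \<Omega>"
    using H_holomorphic by (rule holomorphic_on_subset) (auto simp: \<Omega>_def)
  have inj: "inj_on H \<Omega>" using \<Omega>_expanding(2) by (auto intro: inj_onI)
  have "open (H ` \<Omega>)" using open_mapping_thm3[OF hol open_\<Omega> inj] .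
  then have op: "openin (top_of_set ?U) (H ` \<Omega>)" using sub by (intro open_openin_trans) (auto simp: open_halfspace_Im_gt)
  have cl: "closedin (top_of_set ?U) (H ` \<Omega>)"
    unfolding closedin_limpt
  proof (intro conjI sub allI impI; elim conjE)
    fix z assume lim: "z islimpt H ` \<Omega>" and z: "z \<in> ?U"
    then obtain x where x: "\<And>n. x n \<in> H ` \<Omega>" and xz: "x \<longlonglongrightarrow> z"
      unfolding islimpt_sequential by blast
    have "\<forall>n. \<exists>w. w \<in> \<Omega> \<and> x n = H w" using x by blast
    from choice[OF this] obtain w where w: "\<And>n. w n \<in> \<Omega>" "\<And>n. x n = H (w n)" by blast
    obtain C where C: "\<And>w. w \<in> \<Omega> \<Longrightarrow> cmod w \<le> 2 * cmod (H w) + C" by (rule \<Omega>_bounded) blast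
    obtain B where B: "\<And>n. cmod (x n) \<le> B" using convergent_imp_Bseq[OF convergentI[OF xz]] by (auto simp: Bseq_def)
    have "cmod (w n) \<le> 2 * B + C" for n using C[OF w(1)[of n]] B[of n] w(2)[of n] by simp
    then have "bounded (range w)" by (auto simp: bounded_iff)
    then obtain l r where r: "strict_mono (r :: nat \<Rightarrow> nat)" "(w \<circ> r) \<longlonglongrightarrow> l"
      using bounded_imp_convergent_subsequence by blast
    have xr: "(x \<circ> r) \<longlonglongrightarrow> z" using xz r(1) by (rule LIMSEQ_subseq_LIMSEQ)
    \<comment> \<open>\<open>Im (H w) \<le> Im w\<close> keeps the limit of the preimages away from
      the real axis.\<close>
    have "Im z \<le> Im l"
    proof (rule LIMSEQ_le)
      show "(\<lambda>n. Im ((x \<circ> r) n)) \<longlonglongrightarrow> Im z" "(\<lambda>n. Im ((w \<circ> r) n)) \<longlonglongrightarrow> Im l"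
        using tendsto_Im[OF xr] tendsto_Im[OF r(2)] by simp_all
      show "\<exists>N. \<forall>n\<ge>N. Im ((x \<circ> r) n) \<le> Im ((w \<circ> r) n)"
        using w Im_H_le by (auto simp: \<Omega>_def)
    qed
    then have l: "Im l > 0" using z by simp
    have "isCont H l" using isCont_H regular_upper l by blast
    then have "(\<lambda>n. H ((w \<circ> r) n)) \<longlonglongrightarrow> H l" using r(2) by (rule isCont_tendsto_compose)
    moreover have "(\<lambda>n. H ((w \<circ> r) n)) = x \<circ> r" using w by (auto simp: o_def)
    ultimately have "H l = z" using xr LIMSEQ_unique by fastforce
    then show "z \<in> H ` \<Omega>" using l z by (auto simp: \<Omega>_def)
  qed
  have "H ` \<Omega> \<noteq> {}"
  proof -
    have "\<forall>\<^sub>F w in cone_filter. Im w > 0 \<and> K w \<le> 1 / 2" by (intro K_small) simp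
    then obtain w where w: "Im w > 0" "K w \<le> 1 / 2" using eventually_happens'[OF cone_filter_neq_bot] by blast
    then have "w \<in> \<Omega>" using Im_H[OF regular_upper, of w] by (simp add: \<Omega>_def)
    then show ?thesis by blast
  qed
  moreover have "connected ?U" by (simp add: convex_connected convex_halfspace_Im_gt)
  ultimately show ?thesis using op cl unfolding connected_clopen by blast
qed

definition \<omega> :: "complex \<Rightarrow> complex" where
  "\<omega> = the_inv_into \<Omega> H"

lemma inj_on_\<Omega>: "inj_on H \<Omega>"
  using \<Omega>_expanding(2) by (auto intro: inj_onI)

lemma
  assumes "Im z > 0"
  shows \<omega>_in: "\<omega> z \<in> \<Omega>" and H_\<omega>: "H (\<omega> z) = z"
  using assms image_\<Omega> the_inv_into_into[OF inj_on_\<Omega> _ order_refl, of z] f_the_inv_into_f[OF inj_on_\<Omega>, of z]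
  by (auto simp: \<omega>_def)

lemma \<omega>_H: "w \<in> \<Omega> \<Longrightarrow> \<omega> (H w) = w"
  unfolding \<omega>_def by (rule the_inv_into_f_f[OF inj_on_\<Omega>])

lemma Im_\<omega>: "Im z > 0 \<Longrightarrow> Im z \<le> Im (\<omega> z)" "Im z > 0 \<Longrightarrow> Im (\<omega> z) > 0"
  using \<omega>_in[of z] H_\<omega>[of z] Im_H_le[of "\<omega> z"] by (auto simp: \<Omega>_def)

lemma \<omega>_holomorphic: "\<omega> holomorphic_on {z. Im z > 0}"
proof -
  have hol: "H holomorphic_on \<Omega>"
    using H_holomorphic by (rule holomorphic_on_subset) (auto simp: \<Omega>_def)
  obtain g where g: "g holomorphic_on H ` \<Omega>" "\<And>w. w \<in> \<Omega> \<Longrightarrow> g (H w) = w"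
    using holomorphic_has_inverse[OF hol open_\<Omega> inj_on_\<Omega>] by metis
  then have "\<omega> z = g z" if "z \<in> H ` \<Omega>" for z using that \<omega>_H by auto
  then show ?thesis using g(1) unfolding image_\<Omega> by (metis (no_types, lifting) holomorphic_cong)
qed

text \<open>The norm bound uses \<open>Im z \<le> Im (\<omega> z)\<close>. For the limit,
  \<open>i y * G (\<omega> (i y))\<close> is split into \<open>i y / \<omega> (i y)\<close> and
  \<open>\<omega> * G (\<omega>)\<close>; both factors tend to 1.\<close>

lemma cauchy_like_subordinated: "cauchy_like (\<lambda>z. cauchy_transform \<nu> (\<omega> z))"
proof
  have "(cauchy_transform \<nu> \<circ> \<omega>) holomorphic_on {z. Im z > 0}"
    using Im_\<omega>(2) by (intro holomorphic_on_compose_gen[OF \<omega>_holomorphic nu.cauchy_transform_holomorphic]) auto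
  then show "(\<lambda>z. cauchy_transform \<nu> (\<omega> z)) holomorphic_on {z. Im z > 0}" by (simp add: o_def)
  show "Im (cauchy_transform \<nu> (\<omega> z)) \<le> 0" if "Im z > 0" for z
    using nu.cauchy.Im_T[OF off_support_Im, of "\<omega> z"] Im_\<omega>(2)[OF that] nu.cauchy.energy_nonneg[of "\<omega> z"] by simp
  show "cmod (cauchy_transform \<nu> (\<omega> z)) \<le> 1 / Im z" if "Im z > 0" for z
  proof -
    have "cmod (cauchy_transform \<nu> (\<omega> z)) \<le> 1 / Im (\<omega> z)" by (rule nu.cmod_cauchy_transform_le[OF Im_\<omega>(2)[OF that]])
    also have "\<dots> \<le> 1 / Im z" using Im_\<omega>[OF that] that by (intro divide_left_mono) auto
    finally show ?thesis .
  qed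
  define w where "w y = \<omega> (\<i> * complex_of_real y)" for y
  have w: "w y \<in> \<Omega>" "H (w y) = \<i> * complex_of_real y" "y \<le> Im (w y)" "y \<le> cmod (w y)" if "y > 0" for y
    using \<omega>_in[of "\<i> * complex_of_real y"] H_\<omega>[of "\<i> * complex_of_real y"] Im_\<omega>(1)[of "\<i> * complex_of_real y"] that
      abs_Im_le_cmod[of "w y"] by (auto simp: w_def)
  have ratio: "\<forall>\<^sub>F y in at_top. y > 0 \<and> cmod (\<i> * complex_of_real y - w y) \<le> e * cmod (w y)" if e: "e > 0" for e
  proof -
    obtain C where C: "0 \<le> C" "\<And>w. w \<in> \<Omega> \<Longrightarrow> cmod (w - H w) \<le> e / 2 * cmod w + C"
      by (rule \<Omega>_near[of "e / 2"]) (use e in auto)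
    show ?thesis
      using eventually_gt_at_top[of 0] eventually_ge_at_top[of "2 * C / e"]
    proof eventually_elim
      case (elim y)
      have "2 * C / e \<le> cmod (w y)" using w(4)[OF elim(1)] elim by simp
      then have "C \<le> e / 2 * cmod (w y)" using e by (simp add: field_simps)
      then show ?case using C(2)[OF w(1)[OF elim(1)]] w(2)[OF elim(1)] elim by (simp add: norm_minus_commute)
    qed
  qed
  have "((\<lambda>y. \<i> * complex_of_real y / w y) \<longlongrightarrow> 1) at_top"
  proof (rule tendstoI)
    fix e :: real assume "e > 0"
    then have "\<forall>\<^sub>F y in at_top. y > 0 \<and> cmod (\<i> * complex_of_real y - w y) \<le> e / 2 * cmod (w y)" by (intro ratio) simp
    then show "\<forall>\<^sub>F y in at_top. dist (\<i> * complex_of_real y / w y) 1 < e"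
    proof eventually_elim
      case (elim y)
      have wy: "cmod (w y) > 0" using w(4)[of y] elim by linarith
      then have "w y \<noteq> 0" by auto
      then have "\<i> * complex_of_real y / w y - 1 = (\<i> * complex_of_real y - w y) / w y" by (simp add: field_simps)
      then have "dist (\<i> * complex_of_real y / w y) 1 = cmod (\<i> * complex_of_real y - w y) / cmod (w y)"
        by (simp add: dist_norm norm_divide)
      also have "\<dots> \<le> e / 2" using elim wy by (simp add: divide_le_eq)
      finally show ?case using \<open>e > 0\<close> by simp
    qed
  qed
  moreover have "((\<lambda>y. w y * cauchy_transform \<nu> (w y) - 1) \<longlongrightarrow> 0) at_top"
  proof (rule Lim_null_comparison)
    \<comment> \<open>The ratio \<open>1 / 2\<close> bounds the real part of \<open>w y\<close> by
      half of its modulus, which places \<open>w y\<close> in the cone of aperture 1. The height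
      \<open>y / 2\<close> is used since the cone asks for a strict inequality and only
      \<open>y \<le> Im (w y)\<close> is known.\<close>
    have "\<forall>\<^sub>F y in at_top. y > 0 \<and> cmod (\<i> * complex_of_real y - w y) \<le> 1 / 2 * cmod (w y)" by (intro ratio) simp
    then show "\<forall>\<^sub>F y in at_top. norm (w y * cauchy_transform \<nu> (w y) - 1) \<le> (1 + 2) * (\<integral>s. min 1 (\<bar>s\<bar> / (y / 2)) \<partial>\<nu>)"
    proof eventually_elim
      case (elim y)
      have "\<bar>Re (w y)\<bar> \<le> 1 / 2 * cmod (w y)"
        using elim abs_Re_le_cmod[of "\<i> * complex_of_real y - w y"] by simp
      also have "\<dots> \<le> 1 / 2 * (\<bar>Re (w y)\<bar> + Im (w y))" using cmod_le[of "w y"] w(3)[of y] elim by simp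
      finally have "\<bar>Re (w y)\<bar> \<le> Im (w y)" by simp
      have sq: "\<bar>Re (w y)\<bar>\<^sup>2 \<le> (1 / 2 * cmod (w y))\<^sup>2"
        using \<open>\<bar>Re (w y)\<bar> \<le> 1 / 2 * cmod (w y)\<close> by (intro power_mono) auto
      then have "3 * \<bar>Re (w y)\<bar>\<^sup>2 \<le> (Im (w y))\<^sup>2" unfolding power_mult_distrib cmod_power2 by (simp add: power2_eq_square)
      moreover have "0 < (Im (w y))\<^sup>2" using w(3)[of y] elim by simp
      ultimately have "\<bar>Re (w y)\<bar>\<^sup>2 < (Im (w y))\<^sup>2" using zero_le_power2[of "\<bar>Re (w y)\<bar>"] by linarith
      then have "\<bar>Re (w y)\<bar> < Im (w y)" using w(3)[of y] elim by (intro power2_less_imp_less[of "\<bar>Re (w y)\<bar>"]) auto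
      then have "w y \<in> truncated_cone 1 (y / 2)" using w(3)[of y] elim by (simp add: truncated_cone_def)
      from nu.cmod_cauchy_transform_asymp[OF this] show ?case using elim by simp
    qed
    have "((\<lambda>y. \<integral>s. min 1 (\<bar>s\<bar> / (y / 2)) \<partial>\<nu>) \<longlongrightarrow> 0) at_top"
      by (rule filterlim_compose[OF nu.tail_mean_tendsto_0]) real_asymp
    then have "((\<lambda>y. (1 + 2) * (\<integral>s. min 1 (\<bar>s\<bar> / (y / 2)) \<partial>\<nu>)) \<longlongrightarrow> (1 + 2) * 0) at_top"
      by (intro tendsto_mult tendsto_const)
    then show "((\<lambda>y. (1 + 2) * (\<integral>s. min 1 (\<bar>s\<bar> / (y / 2)) \<partial>\<nu>)) \<longlongrightarrow> 0) at_top" by simp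
  qed
  then have "((\<lambda>y. w y * cauchy_transform \<nu> (w y)) \<longlongrightarrow> 1) at_top" by (simp add: LIM_zero_iff)
  ultimately have "((\<lambda>y. (\<i> * complex_of_real y / w y) * (w y * cauchy_transform \<nu> (w y))) \<longlongrightarrow> 1 * 1) at_top"
    by (rule tendsto_mult)
  moreover have "\<forall>\<^sub>F y in at_top. (\<i> * complex_of_real y / w y) * (w y * cauchy_transform \<nu> (w y))
     = \<i> * complex_of_real y * cauchy_transform \<nu> (\<omega> (\<i> * complex_of_real y))"
    using eventually_gt_at_top[of 0]
  proof eventually_elim
    case (elim y)
    then have "w y \<noteq> 0" using w(4)[of y] by auto
    then show ?case by (simp add: w_def)
  qed
  ultimately show "((\<lambda>y. \<i> * complex_of_real y * cauchy_transform \<nu> (\<omega> (\<i> * complex_of_real y))) \<longlongrightarrow> 1) at_top"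
    using Lim_transform_eventually by fastforce
qed

lemma ex_subordinated:
  obtains \<rho> where "real_distribution \<rho>"
    "\<And>z. Im z > 0 \<Longrightarrow> cauchy_transform \<rho> z = cauchy_transform \<nu> (\<omega> z)"
  using cauchy_like.representation[OF cauchy_like_subordinated] by blast

text \<open>For \<open>w = z + \<phi> z\<close> one has \<open>F_transform \<nu> w = z\<close>, so
  \<open>H w\<close> is \<open>z\<close> plus the claimed germ. Once \<open>w\<close> lies in
  \<open>\<Omega>\<close>, \<open>\<omega> (H w) = w\<close> and
  \<open>F_transform \<rho> (H w) = F_transform \<nu> w = z\<close>.\<close>

lemma subordinated_germ:
  assumes \<rho>: "real_distribution \<rho>" "\<And>z. Im z > 0 \<Longrightarrow> cauchy_transform \<rho> z = cauchy_transform \<nu> (\<omega> z)"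
    and \<phi>: "has_voiculescu_germ \<nu> \<phi>"
  shows "has_voiculescu_germ \<rho> (\<lambda>z. \<phi> z + of_real t * levy_transform \<gamma> \<sigma> z)"
proof -
  have L: "\<forall>\<^sub>F z in cone_filter. cmod (of_real t * levy_transform \<gamma> \<sigma> z) \<le> \<epsilon> * Im z" if "0 < \<epsilon>" for \<epsilon>
  proof -
    have "\<forall>\<^sub>F z in cone_filter. cmod (levy_transform \<gamma> \<sigma> z) \<le> \<epsilon> / (t + 1) * Im z"
      using that t_nonneg by (intro sg.levy_transform_small) auto
    then show ?thesis
      using eventually_Im_gt[of 0]
    proof eventually_elim
      case (elim z)
      have "cmod (of_real t * levy_transform \<gamma> \<sigma> z) = t * cmod (levy_transform \<gamma> \<sigma> z)"
        using t_nonneg by (simp add: norm_mult)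
      also have "\<dots> \<le> (t + 1) * (\<epsilon> / (t + 1) * Im z)" using elim t_nonneg that by (intro mult_mono) auto
      also have "\<dots> = \<epsilon> * Im z" using t_nonneg by simp
      finally show ?case .
    qed
  qed
  note small = nu.has_voiculescu_germ_small[OF \<phi>]
  show ?thesis
  proof (rule real_distribution.has_voiculescu_germI[OF \<rho>(1)])
    fix \<epsilon> :: real assume "0 < \<epsilon>"
    then have "0 < \<epsilon> / 2" by simp
    from small[OF this] L[OF this]
    show "\<forall>\<^sub>F z in cone_filter. cmod (\<phi> z + of_real t * levy_transform \<gamma> \<sigma> z) \<le> \<epsilon> * Im z"
    proof eventually_elim
      case (elim z)
      have "cmod (\<phi> z + of_real t * levy_transform \<gamma> \<sigma> z) \<le> \<epsilon> / 2 * Im z + \<epsilon> / 2 * Im z"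
        using elim by (intro norm_triangle_le add_mono)
      then show ?case by simp
    qed
  next
    \<comment> \<open>Two perturbations of at most \<open>Im z / 4\<close> each leave the imaginary
      parts of \<open>w\<close> and \<open>H w\<close> positive.\<close>
    have q: "0 < (1 / 4 :: real)" by simp
    show "\<forall>\<^sub>F z in cone_filter. F_transform \<rho> (z + (\<phi> z + of_real t * levy_transform \<gamma> \<sigma> z)) = z"
      using small[OF q] L[OF q] eventually_Im_gt[of 0] has_voiculescu_germ_F[OF \<phi>]
    proof eventually_elim
      case (elim z)
      define w where "w = z + \<phi> z"
      have Hw: "H w = z + (\<phi> z + of_real t * levy_transform \<gamma> \<sigma> z)"
        using elim by (simp add: H_def N_def w_def)
      have "\<bar>Im (\<phi> z)\<bar> \<le> 1 / 4 * Im z" "\<bar>Im (of_real t * levy_transform \<gamma> \<sigma> z)\<bar> \<le> 1 / 4 * Im z"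
        using elim(1,2) abs_Im_le_cmod[of "\<phi> z"] abs_Im_le_cmod[of "of_real t * levy_transform \<gamma> \<sigma> z"] by linarith+
      then have "Im z + Im (\<phi> z) > 0"
          "Im z + (Im (\<phi> z) + Im (of_real t * levy_transform \<gamma> \<sigma> z)) > 0" using elim(3) by linarith+
      then have "Im w > 0" "Im (H w) > 0" unfolding Hw by (simp_all only: w_def plus_complex.sel)
      then have w: "w \<in> \<Omega>" "Im (H w) > 0" by (auto simp: \<Omega>_def)
      have "F_transform \<rho> (H w) = F_transform \<nu> w"
        unfolding F_transform_def using \<rho>(2)[OF w(2)] \<omega>_H[OF w(1)] by simp
      also have "\<dots> = z" using elim(4) by (simp only: w_def)
      finally show ?case by (simp only: Hw)
    qed
  qed
qed

end

section \<open>Semigroups\<close>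

text \<open>Inverting the germ: injectivity gives \<open>F_M w + \<phi> (F_M w) = w\<close> far out,
  and the germ of \<open>N\<close> taken at the point \<open>F_M w\<close> gives
  \<open>F_N w = F_M w\<close>. Analytic continuation carries this from a cone to the
  half-plane.\<close>

theorem voiculescu_germ_unique_measure:
  assumes M: "real_distribution M" and N: "real_distribution N"
    and \<phi>: "has_voiculescu_germ M \<phi>" "has_voiculescu_germ N \<phi>"
  shows "M = N"
proof (rule cauchy_transform_unique[OF M N])
  interpret M: real_distribution M by fact
  interpret N: real_distribution N by fact
  obtain b where b: "0 < b" "near_identity M (1 / 2) 1 b" using M.ex_near_identity[of 1 "1/2"] by auto
  have inj: "inj_on (F_transform M) (truncated_cone 1 b)"
    using M.near_identity_inj_on[OF b(2) _ b(1)] by simp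
  have ev: "\<forall>\<^sub>F z in cone_filter. z + \<phi> z \<in> truncated_cone 1 b"
    using eventually_add_in_truncated_cone[OF M.has_voiculescu_germ_small[OF \<phi>(1)] zero_less_one b(1)] by simp
  have lim: "filterlim (F_transform M) cone_filter cone_filter"
    unfolding filterlim_iff
  proof (intro allI impI)
    fix P assume "\<forall>\<^sub>F z in cone_filter. P z"
    then obtain c d where cd: "0 < c" "0 < d" "\<forall>z\<in>truncated_cone c d. P z" by (auto simp: eventually_cone_filter)
    have "\<forall>\<^sub>F z in cone_filter. z + (F_transform M z - z) \<in> truncated_cone c d"
      by (rule eventually_add_in_truncated_cone[OF M.eventually_cmod_F_transform_le cd(1,2)])
    then show "\<forall>\<^sub>F z in cone_filter. P (F_transform M z)"
      by eventually_elim (use cd in simp)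
  qed
  have "\<forall>\<^sub>F w in cone_filter. F_transform M w = F_transform N w"
    using eventually_compose_filterlim[OF ev lim] eventually_compose_filterlim[OF has_voiculescu_germ_F[OF \<phi>(1)] lim]
      eventually_compose_filterlim[OF has_voiculescu_germ_F[OF \<phi>(2)] lim] eventually_in_truncated_cone[OF zero_less_one, of b]
  proof eventually_elim
    case (elim w)
    have "F_transform M w + \<phi> (F_transform M w) = w"
      using inj_onD[OF inj elim(2) elim(1,4)] .
    then show ?case using elim(3) by simp
  qed
  then obtain c d where cd: "0 < c" "0 < d" "\<forall>w\<in>truncated_cone c d. F_transform M w = F_transform N w"
    by (auto simp: eventually_cone_filter)
  fix z :: complex assume z: "Im z > 0"
  show "cauchy_transform M z = cauchy_transform N z"
  proof (rule analytic_continuation_open[where s = "truncated_cone c d" and s' = "{z. Im z > 0}"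
        and f = "cauchy_transform M" and g = "cauchy_transform N"])
    show "truncated_cone c d \<noteq> {}"
    proof -
      have "Complex 0 (d + 1) \<in> truncated_cone c d" using cd by (simp add: truncated_cone_def)
      then show ?thesis by blast
    qed
    show "truncated_cone c d \<subseteq> {z. Im z > 0}" using cd by (auto simp: truncated_cone_def)
    show "cauchy_transform M w = cauchy_transform N w" if "w \<in> truncated_cone c d" for w
      using cd(3) that by (auto simp: F_transform_def)
    show "connected {z. Im z > 0}" by (simp add: convex_connected convex_halfspace_Im_gt)
  qed (use z M.cauchy_transform_holomorphic N.cauchy_transform_holomorphic in
      \<open>simp_all add: open_truncated_cone open_halfspace_Im_gt\<close>)
qed

lemma is_free_convolution_unique:
  assumes M: "real_distribution M" and N: "real_distribution N"
    and R: "is_free_convolution M N R" "is_free_convolution M N R'"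
  shows "R = R'"
proof -
  obtain \<phi> \<psi> where 1: "real_distribution R" "has_voiculescu_germ M \<phi>" "has_voiculescu_germ N \<psi>"
    "has_voiculescu_germ R (\<lambda>z. \<phi> z + \<psi> z)" using R(1) unfolding is_free_convolution_iff by blast
  obtain \<phi>' \<psi>' where 2: "real_distribution R'" "has_voiculescu_germ M \<phi>'" "has_voiculescu_germ N \<psi>'"
    "has_voiculescu_germ R' (\<lambda>z. \<phi>' z + \<psi>' z)" using R(2) unfolding is_free_convolution_iff by blast
  have "\<forall>\<^sub>F z in cone_filter. \<phi>' z + \<psi>' z = \<phi> z + \<psi> z"
    using real_distribution.has_voiculescu_germ_unique[OF M 1(2) 2(2)]
      real_distribution.has_voiculescu_germ_unique[OF N 1(3) 2(3)]
    by eventually_elim simp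
  from has_voiculescu_germ_cong[OF 2(4) this] show ?thesis
    using voiculescu_germ_unique_measure[OF 1(1) 2(1) 1(4)] by simp
qed

lemma free_convolution_eq:
  assumes "real_distribution M" "real_distribution N" "is_free_convolution M N R"
  shows "M \<boxplus> N = R"
  unfolding free_convolution_def
  using assms(3) is_free_convolution_unique[OF assms(1,2) _ assms(3)] by (rule the_equality)

locale semigroup_with_levy_measure =
  fixes \<mu> :: "real \<Rightarrow> real measure" and \<sigma> :: "real measure" and \<gamma> :: real
  assumes semigroup: "free_convolution_semigroup \<mu>"
    and levy_measure: "finite_borel_measure \<sigma>"
    and germ_1: "has_voiculescu_germ (\<mu> 1) (levy_transform \<gamma> \<sigma>)"
begin

lemma distribution: "0 \<le> t \<Longrightarrow> real_distribution (\<mu> t)"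
  using semigroup by (simp add: free_convolution_semigroup_def)

lemma germ_add:
  assumes "0 \<le> s" "0 \<le> t" "has_voiculescu_germ (\<mu> s) f" "has_voiculescu_germ (\<mu> t) g"
  shows "has_voiculescu_germ (\<mu> (s + t)) (\<lambda>z. f z + g z)"
proof -
  have "is_free_convolution (\<mu> s) (\<mu> t) (\<mu> (s + t))"
    using semigroup assms by (simp add: free_convolution_semigroup_def)
  then obtain \<phi> \<psi> where *: "has_voiculescu_germ (\<mu> s) \<phi>" "has_voiculescu_germ (\<mu> t) \<psi>"
    "has_voiculescu_germ (\<mu> (s + t)) (\<lambda>z. \<phi> z + \<psi> z)" unfolding is_free_convolution_iff by blast
  have "\<forall>\<^sub>F z in cone_filter. \<phi> z + \<psi> z = f z + g z"
    using real_distribution.has_voiculescu_germ_unique[OF distribution[OF assms(1)] *(1) assms(3)]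
      real_distribution.has_voiculescu_germ_unique[OF distribution[OF assms(2)] *(2) assms(4)]
    by eventually_elim simp
  from has_voiculescu_germ_cong[OF *(3) this] show ?thesis .
qed

text \<open>\<open>\<mu> 0\<close> is its own square under the convolution, so its germ equals its
  own double.\<close>

lemma germ_0: "has_voiculescu_germ (\<mu> 0) (\<lambda>_. 0)"
proof -
  interpret real_distribution "\<mu> 0" using distribution by simp
  obtain f where f: "has_voiculescu_germ (\<mu> 0) f" by (rule ex_voiculescu_germ)
  then have "has_voiculescu_germ (\<mu> 0) (\<lambda>z. f z + f z)" using germ_add[of 0 0 f f] by simp
  from has_voiculescu_germ_unique[OF f this] have "\<forall>\<^sub>F z in cone_filter. f z = 0"
    by eventually_elim simp
  from has_voiculescu_germ_cong[OF f this] show ?thesis .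
qed

lemma germ_multiple:
  assumes "0 \<le> s" "has_voiculescu_germ (\<mu> s) f"
  shows "has_voiculescu_germ (\<mu> (real n * s)) (\<lambda>z. of_nat n * f z)"
proof (induction n)
  case 0
  then show ?case using germ_0 by simp
next
  case (Suc n)
  from germ_add[OF _ assms(1) Suc assms(2)] assms(1) show ?case
    by (simp add: algebra_simps)
qed

text \<open>The germ \<open>f\<close> of \<open>\<mu> (1 / n)\<close> satisfies
  \<open>n * f = \<phi>\<close> by uniqueness at time 1; taking \<open>m\<close> copies gives time
  \<open>m / n\<close>.\<close>

lemma germ_rational:
  assumes "0 < n"
  shows "has_voiculescu_germ (\<mu> (real m / real n)) (\<lambda>z. of_real (real m / real n) * levy_transform \<gamma> \<sigma> z)"
proof -
  interpret real_distribution "\<mu> (1 / real n)" using distribution by simp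
  obtain f where f: "has_voiculescu_germ (\<mu> (1 / real n)) f" by (rule ex_voiculescu_germ)
  then have "has_voiculescu_germ (\<mu> 1) (\<lambda>z. of_nat n * f z)" using germ_multiple[of "1 / real n" f n] assms by simp
  from real_distribution.has_voiculescu_germ_unique[OF distribution[OF zero_le_one] this germ_1]
  have "\<forall>\<^sub>F z in cone_filter. of_nat m * f z = of_real (real m / real n) * levy_transform \<gamma> \<sigma> z"
  proof eventually_elim
    case (elim z)
    show ?case unfolding elim[symmetric] using assms by simp
  qed
  from has_voiculescu_germ_cong[OF _ this] show ?thesis
    using germ_multiple[OF _ f, of m] by simp
qed

text \<open>On rational times the germ is known. At a real time \<open>t\<close>, compare with rational \<open>r n > t\<close>,
  \<open>r n \<longlonglongrightarrow> t\<close>: since \<open>\<mu> (r n - t)\<close> tends to the point mass at \<open>0\<close>, the transforms of these measures live on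
  a common cone and tend to \<open>0\<close> there.\<close>

lemma germ:
  assumes t: "0 \<le> t"
  shows "has_voiculescu_germ (\<mu> t) (\<lambda>z. of_real t * levy_transform \<gamma> \<sigma> z)"
proof -
  interpret sg: finite_borel_measure \<sigma> by (rule levy_measure)
  interpret T: real_distribution "\<mu> t" using distribution t by simp
  let ?L = "levy_transform \<gamma> \<sigma>"
  \<comment> \<open>The least fraction with denominator \<open>n + 1\<close> strictly above
    \<open>t\<close>. Strictness makes \<open>\<epsilon> n\<close> positive, as the continuity
    condition at time 0 demands.\<close>
  define r where "r n = real (Suc (nat \<lfloor>t * real (Suc n)\<rfloor>)) / real (Suc n)" for n
  have r: "t < r n" "r n \<le> t + 1 / real (Suc n)" for n
  proof -
    have "real (nat \<lfloor>t * real (Suc n)\<rfloor>) = of_int \<lfloor>t * real (Suc n)\<rfloor>" using t by simp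
    then have "t * real (Suc n) < real (Suc (nat \<lfloor>t * real (Suc n)\<rfloor>))"
      "real (Suc (nat \<lfloor>t * real (Suc n)\<rfloor>)) \<le> t * real (Suc n) + 1"
      using floor_correct[of "t * real (Suc n)"] by linarith+
    then show "t < r n" "r n \<le> t + 1 / real (Suc n)" unfolding r_def by (simp_all add: field_simps del: of_nat_Suc)
  qed
  define \<epsilon> where "\<epsilon> n = r n - t" for n
  have \<epsilon>: "0 < \<epsilon> n" for n using r by (simp add: \<epsilon>_def)
  have \<epsilon>0: "\<epsilon> \<longlonglongrightarrow> 0"
  proof (rule tendsto_sandwich[where f = "\<lambda>_. 0" and h = "\<lambda>n. 1 / real (Suc n)"])
    show "(\<lambda>n. 1 / real (Suc n)) \<longlonglongrightarrow> 0" by (rule LIMSEQ_Suc, rule lim_1_over_n)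
    show "\<forall>\<^sub>F n in sequentially. \<epsilon> n \<le> 1 / real (Suc n)"
    proof (rule always_eventually, rule allI)
      fix n show "\<epsilon> n \<le> 1 / real (Suc n)" using r(2)[of n] unfolding \<epsilon>_def by linarith
    qed
    show "\<forall>\<^sub>F n in sequentially. 0 \<le> \<epsilon> n" using \<epsilon> by (simp add: less_imp_le)
  qed simp
  have r0: "r \<longlonglongrightarrow> t"
    using tendsto_add[OF \<epsilon>0 tendsto_const[of t]] by (simp add: \<epsilon>_def)
  have rd: "real_distribution (\<mu> (\<epsilon> n))" for n using distribution \<epsilon> by (simp add: less_imp_le)
  have d0: "real_distribution (return borel (0::real))"
    using distribution[of 0] semigroup by (simp add: free_convolution_semigroup_def)
  define d where "d n = (\<integral>s. min 1 (\<bar>s\<bar> / 1) \<partial>\<mu> (\<epsilon> n))" for n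
  have "weak_conv_m (\<lambda>n. \<mu> (\<epsilon> n)) (return borel 0)"
    using semigroup \<epsilon> \<epsilon>0 by (simp add: free_convolution_semigroup_def)
  then have "d \<longlonglongrightarrow> (\<integral>s. min 1 (\<bar>s\<bar> / 1) \<partial>return borel (0::real))"
    unfolding d_def
  proof (rule weak_conv_imp_integral_bdd_continuous_conv[OF rd d0])
    show "isCont (\<lambda>s. min 1 (\<bar>s\<bar> / 1)) x" for x :: real by (intro continuous_min continuous_intros) simp
    show "norm (min 1 (\<bar>s\<bar> / 1)) \<le> 1" for s :: real by simp
  qed
  also have "(\<integral>s. min 1 (\<bar>s\<bar> / 1) \<partial>return borel (0::real)) = 0"
    by (subst integral_return) auto
  finally have d: "d \<longlonglongrightarrow> 0" .
  obtain a b f where f: "0 < a" "0 < b" "f holomorphic_on truncated_cone a b" "has_voiculescu_germ (\<mu> t) f"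
    by (rule T.ex_voiculescu_germ) blast
  \<comment> \<open>A cone inside the domain of \<open>f\<close> and inside the cone of aperture
    \<open>1 / 2\<close> and height 2, on which the small-time transforms are all defined.\<close>
  define p q where "p = min a (1 / 2)" and "q = max b 2"
  have pq: "0 < p" "0 < q" "p \<le> a" "p \<le> 1 / 2" "b \<le> q" "2 * 1 \<le> q" using f by (auto simp: p_def q_def)
  have sub: "truncated_cone p q \<subseteq> truncated_cone a b" "truncated_cone p q \<subseteq> truncated_cone (1 / 2) (2 * 1)"
    using pq by (intro truncated_cone_mono; simp)+
  have "f z = of_real t * ?L z" if z: "z \<in> truncated_cone p q" for z
  proof -
    have "(\<lambda>n. 3 * d n) \<longlonglongrightarrow> 3 * 0" by (intro tendsto_mult tendsto_const d)
    then have "(\<lambda>n. 3 * d n) \<longlonglongrightarrow> 0" by simp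
    \<comment> \<open>The threshold of \<open>near_identityI\<close> for \<open>a = b = 1\<close>
      and \<open>\<eta> = 1 / 8\<close>: it is \<open>\<eta> / (2 * (a + 1)) = 1 / 32\<close>, and 3
      is \<open>a + 2\<close>.\<close>
    then have small: "\<forall>\<^sub>F n in sequentially. 3 * d n < 1 / 32" by (rule order_tendstoD(2)) simp
    note zc = truncated_coneD[OF z pq(1,2)]
    have z1: "z \<in> truncated_cone 1 1"
      using truncated_cone_mono[of p 1 1 q] pq z by auto
    have "\<forall>\<^sub>F n in sequentially. norm (of_real (r n) * ?L z - f z) \<le> 8 * Im z * (3 * d n)"
      using small
    proof eventually_elim
      case (elim n)
      interpret E: real_distribution "\<mu> (\<epsilon> n)" by (rule rd)
      have "near_identity (\<mu> (\<epsilon> n)) (1 / (4 + 4 * 1)) 1 1"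
        by (rule near_identityI[OF rd]) (use elim in \<open>simp_all add: d_def\<close>)
      then obtain \<psi> where \<psi>: "voiculescu_transform_on (\<mu> (\<epsilon> n)) (truncated_cone (1 / 2) (2 * 1)) \<psi>"
          "\<psi> holomorphic_on truncated_cone (1 / 2) (2 * 1)"
          "\<And>z. z \<in> truncated_cone (1 / 2) (2 * 1) \<Longrightarrow> cmod (\<psi> z) \<le> 2 * cmod (F_transform (\<mu> (\<epsilon> n)) z - z)"
        by (rule E.near_identity_voiculescu[OF zero_less_one zero_less_one]) blast
      have "0 < (1 / 2 :: real)" "0 < (2 * 1 :: real)" by simp_all
      then have g\<psi>: "has_voiculescu_germ (\<mu> (\<epsilon> n)) \<psi>" unfolding has_voiculescu_germ_def using \<psi>(1) by blast
      have "has_voiculescu_germ (\<mu> (t + \<epsilon> n)) (\<lambda>z. f z + \<psi> z)"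
        using \<epsilon>[of n] by (intro germ_add[OF t _ f(4) g\<psi>]) simp
      then have 1: "has_voiculescu_germ (\<mu> (r n)) (\<lambda>z. f z + \<psi> z)" by (simp add: \<epsilon>_def)
      have 2: "has_voiculescu_germ (\<mu> (r n)) (\<lambda>z. of_real (r n) * ?L z)"
        unfolding r_def by (rule germ_rational) simp
      have "real_distribution (\<mu> (r n))" using distribution r(1)[of n] t by simp
      note ev = real_distribution.has_voiculescu_germ_unique[OF this 1 2]
      obtain c e where
        ce: "0 < c" "c \<le> p" "q \<le> e" "0 < e" "\<forall>z\<in>truncated_cone c e. f z + \<psi> z = of_real (r n) * ?L z"
        using ex_large_truncated_cone[OF ev pq(1), of q] by (elim exE conjE)
      \<comment> \<open>The germs agree only on a cone that depends on \<open>n\<close>. Analytic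
        continuation moves the identity to the fixed cone, so that \<open>n\<close> can tend to
        infinity at one point \<open>z\<close>.\<close>
      have "f z + \<psi> z = of_real (r n) * ?L z"
      proof (rule analytic_continuation_open[where s = "truncated_cone c e" and s' = "truncated_cone p q"
          and f = "\<lambda>z. f z + \<psi> z" and g = "\<lambda>z. of_real (r n) * ?L z"])
        show "truncated_cone c e \<noteq> {}"
        proof -
          have "Complex 0 (e + 1) \<in> truncated_cone c e" using ce by (simp add: truncated_cone_def)
          then show ?thesis by blast
        qed
        show "truncated_cone c e \<subseteq> truncated_cone p q" using ce by (intro truncated_cone_mono) auto
        show "(\<lambda>z. f z + \<psi> z) holomorphic_on truncated_cone p q"
          by (intro holomorphic_intros holomorphic_on_subset[OF f(3) sub(1)] holomorphic_on_subset[OF \<psi>(2) sub(2)])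
        have "truncated_cone p q \<subseteq> {z. 0 < Im z}" using pq by (auto simp: truncated_cone_def)
        then show "(\<lambda>z. of_real (r n) * ?L z) holomorphic_on truncated_cone p q"
          by (intro holomorphic_intros holomorphic_on_subset[OF sg.levy.T_holomorphic])
      qed (use z ce in \<open>simp_all add: open_truncated_cone convex_connected convex_truncated_cone\<close>)
      then have "norm (of_real (r n) * ?L z - f z) = cmod (\<psi> z)" by (metis add_diff_cancel_left')
      also have "\<dots> \<le> 2 * cmod (F_transform (\<mu> (\<epsilon> n)) z - z)" using \<psi>(3) sub(2) z by blast
      also have "cmod (F_transform (\<mu> (\<epsilon> n)) z - z) \<le> 2 * (3 * d n) * (1 + 1) * Im z"
      proof (rule cmod_F_transform_asymp[OF z1])
        show "cmod (z * cauchy_transform (\<mu> (\<epsilon> n)) z - 1) \<le> 3 * d n"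
          using E.cmod_cauchy_transform_asymp[OF z1] by (simp add: d_def)
      qed (use elim in simp_all)
      finally show ?case by (simp add: algebra_simps)
    qed
    moreover have "(\<lambda>n. 8 * Im z * (3 * d n)) \<longlonglongrightarrow> 8 * Im z * (3 * 0)"
      by (intro tendsto_mult tendsto_const d)
    then have "(\<lambda>n. 8 * Im z * (3 * d n)) \<longlonglongrightarrow> 0" by simp
    ultimately have "(\<lambda>n. of_real (r n) * ?L z - f z) \<longlonglongrightarrow> 0" by (rule Lim_null_comparison)
    moreover have "(\<lambda>n. of_real (r n) * ?L z - f z) \<longlonglongrightarrow> of_real t * ?L z - f z"
      by (intro tendsto_intros r0)
    ultimately have "of_real t * ?L z - f z = 0" using LIMSEQ_unique by blast
    then show ?thesis by simp
  qed
  then have "\<forall>\<^sub>F z in cone_filter. f z = of_real t * ?L z"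
    unfolding eventually_cone_filter using pq by blast
  from has_voiculescu_germ_cong[OF f(4) this] show ?thesis .
qed

lemma free_convolution_0:
  assumes "real_distribution \<nu>"
  shows "\<mu> 0 \<boxplus> \<nu> = \<nu>"
proof (rule free_convolution_eq[OF distribution[OF order_refl] assms])
  obtain f where "has_voiculescu_germ \<nu> f" by (rule real_distribution.ex_voiculescu_germ[OF assms])
  moreover from this have "has_voiculescu_germ \<nu> (\<lambda>z. 0 + f z)" by simp
  ultimately show "is_free_convolution (\<mu> 0) \<nu> \<nu>"
    unfolding is_free_convolution_iff using germ_0 assms by blast
qed

text \<open>The constructed measure has the sum of the two germs, so it is the value of the definite
  description behind \<open>\<boxplus>\<close>.\<close>

lemma free_convolution_subordination:
  assumes \<nu>: "real_distribution \<nu>" and t: "0 \<le> t"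
  shows "real_distribution (\<mu> t \<boxplus> \<nu>)"
    "\<And>z. Im z > 0 \<Longrightarrow> cauchy_transform (\<mu> t \<boxplus> \<nu>) z = cauchy_transform \<nu> (subordination.\<omega> \<nu> \<sigma> \<gamma> t z)"
proof -
  have "subordination \<nu> \<sigma> t"
    by (intro subordination.intro \<nu> levy_measure subordination_axioms.intro t)
  then interpret subordination \<nu> \<sigma> \<gamma> t .
  obtain \<rho> where \<rho>: "real_distribution \<rho>"
    "\<And>z. Im z > 0 \<Longrightarrow> cauchy_transform \<rho> z = cauchy_transform \<nu> (\<omega> z)" by (rule ex_subordinated) blast
  obtain f where f: "has_voiculescu_germ \<nu> f" by (rule real_distribution.ex_voiculescu_germ[OF \<nu>])
  have "has_voiculescu_germ \<rho> (\<lambda>z. of_real t * levy_transform \<gamma> \<sigma> z + f z)"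
    using subordinated_germ[OF \<rho> f] by (simp add: add.commute)
  then have "is_free_convolution (\<mu> t) \<nu> \<rho>"
    unfolding is_free_convolution_iff using \<rho>(1) germ[OF t] f by blast
  then have "\<mu> t \<boxplus> \<nu> = \<rho>" by (rule free_convolution_eq[OF distribution[OF t] \<nu>])
  then show "real_distribution (\<mu> t \<boxplus> \<nu>)"
    "\<And>z. Im z > 0 \<Longrightarrow> cauchy_transform (\<mu> t \<boxplus> \<nu>) z = cauchy_transform \<nu> (\<omega> z)" using \<rho> by simp_all
qed

end

lemma ex_semigroup_with_levy_measure:
  assumes "free_convolution_semigroup \<mu>" "is_free_levy_measure (\<mu> 1) \<sigma>"
  obtains \<gamma> where "semigroup_with_levy_measure \<mu> \<sigma> \<gamma>"
proof -
  obtain \<gamma> where "finite_borel_measure \<sigma>" "has_voiculescu_germ (\<mu> 1) (levy_transform \<gamma> \<sigma>)"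
    using assms(2) unfolding is_free_levy_measure_def has_voiculescu_germ_def levy_transform_def[abs_def] by blast
  then show ?thesis using assms(1) by (intro that[of \<gamma>] semigroup_with_levy_measure.intro)
qed

section \<open>Gaps of the support\<close>

text \<open>On the ball the distance from \<open>z\<close> to \<open>s\<close> is below
  \<open>2 * \<delta>\<close>, so the integrand of the energy is at least
  \<open>1 / (4 * \<delta>\<^sup>2)\<close> there.\<close>

lemma (in finite_borel_measure) measure_ball_le_energy:
  assumes "Im z > 0" "cmod (z - of_real x) < \<delta>" "cauchy_energy M z \<le> C"
  shows "measure M (ball x \<delta>) \<le> 4 * C * \<delta>\<^sup>2"
proof -
  have [measurable_cong]: "sets M = sets borel" by (rule M_is_borel)
  have \<delta>: "\<delta> > 0" using assms(2) norm_ge_zero by (rule le_less_trans[rotated])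
  have off: "off_support M z" using assms(1) by (intro off_support_Im) simp
  have i: "integrable M (\<lambda>s. indicator (ball x \<delta>) s :: real)"
    by (intro integrable_const_bound[of _ 1]) (auto simp: indicator_def)
  have "(\<integral>s. indicator (ball x \<delta>) s / (4 * \<delta>\<^sup>2) \<partial>M) \<le> cauchy_energy M z"
    unfolding energy_def
  proof (rule integral_mono[OF _ cauchy.integrable_energy[OF off]])
    show "integrable M (\<lambda>s. indicator (ball x \<delta>) s / (4 * \<delta>\<^sup>2))" using i by (rule integrable_divide)
    fix s
    show "indicator (ball x \<delta>) s / (4 * \<delta>\<^sup>2) \<le> 1 / (cmod (z - complex_of_real s))\<^sup>2"
    proof (cases "s \<in> ball x \<delta>")
      case True
      have "cmod (z - of_real s) \<le> cmod (z - of_real x) + cmod (of_real x - complex_of_real s)"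
        by (metis diff_add_cancel add_diff_eq norm_triangle_ineq)
      also have "cmod (of_real x - complex_of_real s) = dist x s" by (simp add: dist_real_def flip: of_real_diff)
      finally have "cmod (z - of_real s) \<le> 2 * \<delta>" using True assms(2) by simp
      moreover have "cmod (z - of_real s) > 0" using cmod_ge_Im[of z s] assms(1) by linarith
      ultimately have "1 / (2 * \<delta>)\<^sup>2 \<le> 1 / (cmod (z - complex_of_real s))\<^sup>2"
        using \<delta> by (intro divide_left_mono power_mono) auto
      then show ?thesis using True by (simp add: power_mult_distrib)
    qed simp
  qed
  also have "(\<integral>s. indicator (ball x \<delta>) s / (4 * \<delta>\<^sup>2) \<partial>M) = measure M (ball x \<delta>) / (4 * \<delta>\<^sup>2)"
    unfolding integral_divide_zero by simp
  finally have "measure M (ball x \<delta>) / (4 * \<delta>\<^sup>2) \<le> C" using assms(3) by linarith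
  then have "measure M (ball x \<delta>) \<le> C * (4 * \<delta>\<^sup>2)" using \<delta> by (simp add: divide_le_eq)
  then show ?thesis by (simp add: mult_ac)
qed

text \<open>Balls of radius \<open>\<delta>\<close> have mass \<open>O(\<delta>\<^sup>2)\<close>, so covering the interval by \<open>O(1/\<delta>)\<close> of them shows that it is a null set.\<close>

lemma (in finite_borel_measure) not_in_support_if_energy_bounded:
  assumes e: "e > 0"
    and en: "\<And>x \<delta>. x \<in> ball x0 e \<Longrightarrow> \<delta> > 0 \<Longrightarrow>
      \<exists>z. Im z > 0 \<and> cmod (z - of_real x) < \<delta> \<and> cauchy_energy M z \<le> C"
  shows "x0 \<notin> measure_support M"
proof -
  have [measurable_cong]: "sets M = sets borel" by (rule M_is_borel)
  let ?I = "ball x0 (e / 2)"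
  have "x0 \<in> ball x0 e" using e by simp
  from en[OF this zero_less_one] obtain z where "cauchy_energy M z \<le> C" by (elim exE conjE)
  then have C: "0 \<le> C" using cauchy.energy_nonneg[of z] by linarith
  have "measure M ?I \<le> 4 * C * e\<^sup>2 * ((1 + 1 / real (Suc n)) / real (Suc n))" for n
  proof -
    let ?n = "real (Suc n)"
    define y where "y = e / ?n"
    have y: "y > 0" "?n * y = e" using e by (auto simp: y_def)
    define x where "x k = x0 - e / 2 + real k * y" for k
    \<comment> \<open>The second set in each intersection is everything or empty. It discards grid
      points outside \<open>ball x0 e\<close>, for which the energy hypothesis says nothing.\<close>
    have cover: "?I \<subseteq> (\<Union>k\<in>{..Suc n}. ball (x k) y \<inter> {y. x k \<in> ball x0 e})"
    proof
      fix s assume s: "s \<in> ?I"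
      define u where "u = (s - x0 + e / 2) / y"
      have su: "s = x0 - e / 2 + u * y" using y by (simp add: u_def)
      have "0 \<le> s - x0 + e / 2" "s - x0 + e / 2 < e" using s unfolding mem_ball dist_real_def by linarith+
      then have u: "0 \<le> u" "u < ?n"
        using y by (auto simp: u_def divide_less_eq simp del: of_nat_Suc)
      define k where "k = nat \<lfloor>u\<rfloor>"
      have k: "real k \<le> u" "u < real k + 1" using u by (auto simp: k_def of_nat_nat)
      have "real k < ?n" using k u by linarith
      then have kn: "k \<le> Suc n" by simp
      have "\<bar>u - real k\<bar> < 1" using k by linarith
      then have "\<bar>u - real k\<bar> * y < 1 * y" using y by (intro mult_strict_right_mono) auto
      moreover have "s - x k = (u - real k) * y" by (simp add: su x_def left_diff_distrib)
      then have "\<bar>s - x k\<bar> = \<bar>u - real k\<bar> * y" using y by (simp add: abs_mult)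
      ultimately have "s \<in> ball (x k) y" by (simp add: dist_real_def abs_minus_commute)
      moreover have "0 \<le> real k * y" using y by simp
      moreover have "real k * y < e"
        using mult_strict_right_mono[OF \<open>real k < ?n\<close> y(1)] y(2) by simp
      then have "x k \<in> ball x0 e" using e \<open>0 \<le> real k * y\<close> unfolding x_def mem_ball dist_real_def by linarith
      ultimately show "s \<in> (\<Union>k\<in>{..Suc n}. ball (x k) y \<inter> {y. x k \<in> ball x0 e})" using kn by auto
    qed
    have "measure M ?I \<le> measure M (\<Union>k\<in>{..Suc n}. ball (x k) (y) \<inter> {y. x k \<in> ball x0 e})"
      using cover by (intro finite_measure_mono) measurable
    also have "\<dots> \<le> (\<Sum>k\<in>{..Suc n}. measure M (ball (x k) (y) \<inter> {y. x k \<in> ball x0 e}))"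
      by (intro measure_subadditive_finite) (auto simp: M_is_borel fmeasurable_eq_sets)
    also have "\<dots> \<le> (\<Sum>k\<in>{..Suc n}. 4 * C * y\<^sup>2)"
    proof (rule sum_mono)
      fix k
      show "measure M (ball (x k) (y) \<inter> {y. x k \<in> ball x0 e}) \<le> 4 * C * y\<^sup>2"
      proof (cases "x k \<in> ball x0 e")
        case True
        from en[OF True y(1)] obtain z where "Im z > 0" "cmod (z - of_real (x k)) < y" "cauchy_energy M z \<le> C" by blast
        then show ?thesis using measure_ball_le_energy True by simp
      qed (use C in simp)
    qed
    also have "\<dots> = 4 * C * e\<^sup>2 * ((1 + 1 / ?n) / ?n)"
    proof -
      have "(m + 1) * (4 * C * (e / m)\<^sup>2) = 4 * C * e\<^sup>2 * ((1 + 1 / m) / m)" if "m > 0" for m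
        using that by (simp add: power2_eq_square field_simps)
      from this[of ?n] show ?thesis by (simp add: y_def)
    qed
    finally show ?thesis .
  qed
  moreover have "(\<lambda>n. 4 * C * e\<^sup>2 * ((1 + 1 / real (Suc n)) / real (Suc n))) \<longlonglongrightarrow> 4 * C * e\<^sup>2 * 0"
    by (intro tendsto_mult tendsto_const) real_asymp
  ultimately have "measure M ?I \<le> 0"
    by (intro LIMSEQ_le_const[of _ 0]) auto
  then have "emeasure M ?I = 0" using measure_nonneg[of M ?I] by (simp add: emeasure_eq_measure)
  then show ?thesis unfolding measure_support_def using e by (auto intro!: exI[of _ ?I])
qed

lemma (in finite_borel_measure) cauchy_energy_le_levy_energy:
  assumes "off_support M z"
  shows "cauchy_energy M z \<le> levy_energy M z"
  unfolding energy_def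
  by (rule integral_mono[OF cauchy.integrable_energy[OF assms] levy.integrable_energy[OF assms]])
     (simp add: divide_right_mono)

lemma (in kernel_transform) Re_T_has_real_derivative:
  assumes "off_support M (complex_of_real x)"
  shows "((\<lambda>x. Re (T (complex_of_real x))) has_real_derivative - energy M \<kappa> (of_real x)) (at x)"
  using has_field_derivative_Re[OF has_vector_derivative_real_field[OF T_has_derivative_energy[OF assms]]]
  by simp

lemma closed_measure_support: "closed (measure_support M)"
proof -
  have "- measure_support M = \<Union>{U. open U \<and> emeasure M U = 0}"
    by (auto simp: measure_support_def zero_less_iff_neq_zero)
  then have "open (- measure_support M)" by (simp add: open_Union)
  then show ?thesis by (simp add: closed_def)
qed

text \<open>The Cauchy transform is antitone on each of the finitely many gaps, its derivative being
  minus the energy.\<close>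

lemma (in finite_borel_measure) finite_components_regular_real:
  assumes "finite (components (measure_support M))" "finite (components A)"
  shows "finite (components {x. x \<notin> measure_support M \<and> Re (cauchy_transform M (of_real x)) \<in> A})"
proof -
  have "finite (components {x\<in>L. Re (cauchy_transform M (of_real x)) \<in> A})"
    if L: "L \<in> components (- measure_support M)" for L
  proof (rule finite_components_antimono_vimage[OF in_components_connected[OF L] assms(2)])
    fix x y assume xy: "x \<in> L" "y \<in> L" "x \<le> y"
    have "off_support M (complex_of_real u)" if "x \<le> u" "u \<le> y" for u
    proof -
      have "u \<in> L" using in_components_connected[OF L] xy that unfolding connected_iff_interval by blast
      then show ?thesis using in_components_subset[OF L] off_support_of_real_iff by blast
    qed
    then show "Re (cauchy_transform M (of_real y)) \<le> Re (cauchy_transform M (of_real x))"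
      using cauchy.Re_T_has_real_derivative cauchy.energy_nonneg
      by (intro DERIV_nonpos_imp_nonincreasing[OF xy(3)]) (metis neg_le_0_iff_le)
  qed
  moreover have "{x. x \<notin> measure_support M \<and> Re (cauchy_transform M (of_real x)) \<in> A}
      = (\<Union>L\<in>components (- measure_support M). {x\<in>L. Re (cauchy_transform M (of_real x)) \<in> A})"
    using Union_components[of "- measure_support M"] by blast
  ultimately show ?thesis
    using finite_components_Compl[OF assms(1)] by (simp add: finite_components_UN)
qed

lemma finite_components_inverse_vimage:
  fixes S :: "real set"
  assumes "finite (components S)"
  shows "finite (components {g. g \<noteq> 0 \<and> 1 / g \<in> S})"
proof -
  have "{g. g \<noteq> 0 \<and> 1 / g \<in> S} = {g\<in>{0<..}. 1 / g \<in> S} \<union> {g\<in>{..<0}. 1 / g \<in> S}" by auto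
  moreover have "finite (components {g\<in>{0<..}. 1 / g \<in> S})"
    by (rule finite_components_antimono_vimage[OF _ assms]) (auto intro: divide_left_mono)
  moreover have "finite (components {g\<in>{..<0}. 1 / g \<in> S})"
    by (rule finite_components_antimono_vimage[OF _ assms]) (auto simp: divide_simps)
  ultimately show ?thesis by (simp add: finite_components_Un)
qed

section \<open>Regular real points and the set where \<open>K\<close> is below 1\<close>

context subordination
begin

lemma F_real:
  assumes "off_support \<nu> (complex_of_real x)"
  shows "F_transform \<nu> (of_real x) = of_real (1 / Re (cauchy_transform \<nu> (of_real x)))"
  using nu.cauchy.T_real[OF assms] by (auto simp: F_transform_def elim: Reals_cases)

text \<open>Phrased through \<open>G\<close>, which is antitone on a whole gap, whereas
  \<open>F = 1 / G\<close> may have a pole inside.\<close>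

lemma regular_real_iff:
  "regular (complex_of_real x) \<longleftrightarrow> x \<notin> measure_support \<nu> \<and>
     Re (cauchy_transform \<nu> (of_real x)) \<in> {g. g \<noteq> 0 \<and> 1 / g \<in> - measure_support \<sigma>}"
proof (cases "off_support \<nu> (complex_of_real x)")
  case True
  have "cauchy_transform \<nu> (of_real x) = 0 \<longleftrightarrow> Re (cauchy_transform \<nu> (of_real x)) = 0"
    using nu.cauchy.T_real[OF True] by (auto elim: Reals_cases)
  then show ?thesis unfolding regular_def F_real[OF True]
    using True by (simp add: sg.off_support_of_real_iff nu.off_support_of_real_iff del: of_real_divide)
next
  case False
  then show ?thesis unfolding regular_def by (simp add: nu.off_support_of_real_iff)
qed

lemma finite_components_regular:
  assumes "finite (components (measure_support \<nu>))" "finite (components (measure_support \<sigma>))"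
  shows "finite (components {x. regular (complex_of_real x)})"
  unfolding regular_real_iff
  by (intro nu.finite_components_regular_real assms finite_components_inverse_vimage finite_components_Compl)

text \<open>If \<open>K\<close> exceeded \<open>c\<close> precisely between \<open>a\<close> and \<open>b\<close>, the mean value theorem would give
  \<open>N b - N a > c * (b - a)\<close> although the Pick inequality gives \<open>\<le>\<close>.\<close>

lemma K_less_1_between:
  assumes reg: "\<And>x. p \<le> x \<Longrightarrow> x \<le> q \<Longrightarrow> regular (complex_of_real x)"
    and K: "K (of_real p) < 1" "K (of_real q) < 1" and x: "p \<le> x" "x \<le> q"
  shows "K (complex_of_real x) < 1"
proof (rule ccontr)
  assume Kx: "\<not> K (complex_of_real x) < 1"
  define c where "c = max (K (of_real p)) (K (of_real q))"
  define k where "k y = K (complex_of_real y)" for y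
  have c: "c < 1" "k p \<le> c" "k q \<le> c" "c < k x" "0 \<le> c"
    using K Kx K_nonneg[of "of_real p"] by (auto simp: c_def k_def)
  have contk: "continuous_on {p..q} k"
    unfolding k_def
    by (intro continuous_at_imp_continuous_on ballI isCont_o2[of _ complex_of_real K] isCont_K reg continuous_intros) auto
  have cl: "compact {y\<in>{p..x}. k y \<le> c}" "compact {y\<in>{x..q}. k y \<le> c}"
  proof -
    have "compact {y\<in>S. k y \<le> c}" if "S \<subseteq> {p..q}" "closed S" for S
    proof -
      have "closed (S \<inter> k -` {..c})"
        using that by (intro continuous_closed_preimage continuous_on_subset[OF contk]) auto
      moreover have "S \<inter> k -` {..c} = {y\<in>S. k y \<le> c}" by auto
      moreover have "bounded {y\<in>S. k y \<le> c}" 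
        by (rule bounded_subset[OF bounded_closed_interval[of p q]]) (use that in blast)
      ultimately show ?thesis by (simp add: compact_eq_bounded_closed)
    qed
    from this[of "{p..x}"] this[of "{x..q}"]
    show "compact {y\<in>{p..x}. k y \<le> c}" "compact {y\<in>{x..q}. k y \<le> c}"
      using x by (simp_all del: mem_Collect_eq atLeastAtMost_iff)
  qed
  have "p \<in> {y\<in>{p..x}. k y \<le> c}" "q \<in> {y\<in>{x..q}. k y \<le> c}" using c x by auto
  then have ne: "{y\<in>{p..x}. k y \<le> c} \<noteq> {}" "{y\<in>{x..q}. k y \<le> c} \<noteq> {}" by blast+
  \<comment> \<open>\<open>a\<close> is the last point before \<open>x\<close> and \<open>b\<close>
    the first after it at which \<open>k\<close> is at most \<open>c\<close>; compactness makes both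
    attained.\<close>
  obtain a where a: "a \<in> {y\<in>{p..x}. k y \<le> c}" "\<And>y. y \<in> {y\<in>{p..x}. k y \<le> c} \<Longrightarrow> y \<le> a"
    using compact_attains_sup[OF cl(1) ne(1)] by blast
  obtain b where b: "b \<in> {y\<in>{x..q}. k y \<le> c}" "\<And>y. y \<in> {y\<in>{x..q}. k y \<le> c} \<Longrightarrow> b \<le> y"
    using compact_attains_inf[OF cl(2) ne(2)] by blast
  have ab: "p \<le> a" "a < x" "x < b" "b \<le> q" using a(1) b(1) c by (auto simp: less_le)
  have big: "c < k y" if "a < y" "y < b" for y
  proof (rule ccontr)
    assume "\<not> c < k y"
    then show False using a(2)[of y] b(2)[of y] that ab by (cases "y \<le> x") auto
  qed
  have der: "((\<lambda>y. Re (N (complex_of_real y))) has_real_derivative k y) (at y)" if "a \<le> y" "y \<le> b" for y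
    using has_field_derivative_Re[OF has_vector_derivative_real_field[OF N_has_field_derivative[OF reg, of y]]] that ab
    by (simp add: k_def)
  obtain \<xi> where \<xi>: "a < \<xi>" "\<xi> < b" "Re (N (of_real b)) - Re (N (of_real a)) = (b - a) * k \<xi>"
    using MVT2[of a b "\<lambda>y. Re (N (complex_of_real y))" k] der ab by auto
  have "(b - a) * c < (b - a) * k \<xi>" using big[OF \<xi>(1,2)] ab by (intro mult_strict_left_mono) auto
  also have "\<dots> \<le> cmod (N (of_real b) - N (of_real a))"
    using \<xi>(3) abs_Re_le_cmod[of "N (of_real b) - N (of_real a)"] by simp
  also have "\<dots> \<le> cmod (of_real b - of_real a) * sqrt (K (of_real b) * K (of_real a))"
    using ab by (intro pick reg) auto
  also have "\<dots> \<le> (b - a) * sqrt (c * c)"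
  proof (intro mult_mono real_sqrt_le_mono)
    show "cmod (complex_of_real b - of_real a) \<le> b - a" using ab by (simp flip: of_real_diff)
    show "K (of_real b) \<le> c" "K (of_real a) \<le> c" using a(1) b(1) by (auto simp: k_def)
  qed (use ab c K_nonneg in auto)
  also have "\<dots> = (b - a) * c" using c by simp
  finally show False by simp
qed

end

text \<open>Supplies the neighbourhood demanded by \<open>not_in_support_if_energy_bounded\<close>:
  every point near \<open>f x0\<close> is a value of \<open>f\<close> near
  \<open>x0\<close>.\<close>

lemma injective_image_ball:
  fixes f :: "real \<Rightarrow> real"
  assumes "r > 0" "continuous_on (ball x0 r) f" "inj_on f (ball x0 r)"
  obtains e where "e > 0" "ball (f x0) e \<subseteq> f ` ball x0 r"
proof -
  have "open (f ` ball x0 r)" using assms by (intro invariance_of_domain) auto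
  moreover have "f x0 \<in> f ` ball x0 r" using assms(1) by auto
  ultimately show ?thesis using that by (meson open_contains_ball)
qed

lemma vertical_limit: "(\<lambda>n. Complex x (1 / real (Suc n))) \<longlonglongrightarrow> complex_of_real x"
proof -
  have "(\<lambda>n. 1 / real (Suc n)) \<longlonglongrightarrow> 0" by (rule LIMSEQ_Suc, rule lim_1_over_n)
  then have "(\<lambda>n. Complex x (1 / real (Suc n))) \<longlonglongrightarrow> Complex x 0"
    by (intro tendsto_Complex tendsto_const)
  then show ?thesis by (simp add: complex_of_real_def)
qed

lemma real_in_ball: "x \<in> ball x0 r \<Longrightarrow> dist (complex_of_real x) (of_real x0) < r"
  by (simp add: dist_norm dist_real_def abs_minus_commute flip: of_real_diff)

lemma eventually_near:
  assumes "x \<in> ball x0 r"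
  shows "\<forall>\<^sub>F n in sequentially. dist (Complex x (1 / real (Suc n))) (of_real x0) < r"
proof -
  have "(\<lambda>n. dist (Complex x (1 / real (Suc n))) (of_real x0)) \<longlonglongrightarrow> dist (complex_of_real x) (of_real x0)"
    by (intro tendsto_dist vertical_limit tendsto_const)
  then show ?thesis using real_in_ball[OF assms] by (rule order_tendstoD(2))
qed

text \<open>Positive \<open>t\<close> is required to recover a bound on the Levy energy from
  \<open>Im \<omega> - Im z\<close>, in which it occurs with the factor \<open>t\<close>.\<close>

locale subordinated = subordination \<nu> \<sigma> \<gamma> t + rho: real_distribution \<rho>
  for \<nu> \<sigma> \<gamma> t \<rho> +
  assumes t_pos: "0 < t"
    and G_\<rho>: "\<And>z. Im z > 0 \<Longrightarrow> cauchy_transform \<rho> z = cauchy_transform \<nu> (\<omega> z)"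
begin

section \<open>Correspondence between gaps of the convolution and regular points with
  \<open>K\<close> below 1\<close>

lemma F_\<rho>: "Im z > 0 \<Longrightarrow> F_transform \<rho> z = F_transform \<nu> (\<omega> z)"
  by (simp add: F_transform_def G_\<rho>)

lemma \<omega>_eq: "Im z > 0 \<Longrightarrow> \<omega> z = z - of_real t * levy_transform \<gamma> \<sigma> (F_transform \<rho> z)"
  using H_\<omega>[of z] by (simp add: H_def N_def F_\<rho> algebra_simps)

lemma energy_\<rho>: "Im z > 0 \<Longrightarrow> Im (\<omega> z) * cauchy_energy \<nu> (\<omega> z) = Im z * cauchy_energy \<rho> z"
  using rho.cauchy.Im_T[OF off_support_Im, of z] nu.cauchy.Im_T[OF off_support_Im, of "\<omega> z"]
    G_\<rho>[of z] Im_\<omega>(2)[of z] by simp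

text \<open>Zeros of \<open>G\<close> are excluded because \<open>F\<close> has a pole there and its
  boundary value would be infinite.\<close>

definition gap :: "real set" where
  "gap = {x. x \<notin> measure_support \<rho> \<and> cauchy_transform \<rho> (of_real x) \<noteq> 0}"

text \<open>The energy of \<open>\<rho>\<close> is bounded near \<open>x0\<close>, and
  \<open>energy_\<rho>\<close> transfers this. The lower bound on the energy of \<open>\<nu>\<close>
  controls \<open>Im (\<omega> z) / Im z\<close>; \<open>Im z \<le> Im (\<omega> z)\<close> controls
  the energy of \<open>\<nu>\<close> itself. Finally
  \<open>Im (\<omega> z) = Im z + t * Im F * P\<close>, with \<open>P\<close> the Levy energy,
  controls \<open>P\<close> because \<open>Im z \<le> Im F\<close>.\<close>

lemma near_gap:
  assumes "x0 \<in> gap"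
  obtains r C where "0 < r" "0 < C"
    "\<And>z. dist z (of_real x0) < r \<Longrightarrow> off_support \<rho> z"
    "\<And>z. dist z (of_real x0) < r \<Longrightarrow> cauchy_transform \<rho> z \<noteq> 0"
    "\<And>z. dist z (of_real x0) < r \<Longrightarrow> Im z > 0 \<Longrightarrow> Im (\<omega> z) \<le> C * Im z"
    "\<And>z. dist z (of_real x0) < r \<Longrightarrow> Im z > 0 \<Longrightarrow> cauchy_energy \<nu> (\<omega> z) \<le> C"
    "\<And>z. dist z (of_real x0) < r \<Longrightarrow> Im z > 0 \<Longrightarrow> levy_energy \<sigma> (F_transform \<rho> z) \<le> C"
proof -
  have x0: "off_support \<rho> (of_real x0)" "cauchy_transform \<rho> (of_real x0) \<noteq> 0"
    using assms by (auto simp: gap_def rho.off_support_of_real_iff)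
  obtain d where d: "d > 0" "\<And>z'. dist z' (of_real x0) < d / 2 \<Longrightarrow> off_support \<rho> z'"
    "\<And>z'. dist z' (of_real x0) < d / 2 \<Longrightarrow> cauchy_energy \<rho> z' \<le> 4 * cauchy_energy \<rho> (of_real x0)"
    by (rule rho.cauchy.energy_lipschitz[OF x0(1)]) blast
  have "(cauchy_transform \<rho> \<longlongrightarrow> cauchy_transform \<rho> (of_real x0)) (nhds (of_real x0))"
    using rho.cauchy.isCont_T[OF x0(1)] by (simp add: isCont_def tendsto_at_iff_tendsto_nhds)
  then have "\<forall>\<^sub>F z in nhds (of_real x0). cauchy_transform \<rho> z \<noteq> 0"
    using x0(2) by (rule tendsto_imp_eventually_ne)
  then obtain d' where d': "d' > 0" "\<And>z. dist z (of_real x0) < d' \<Longrightarrow> cauchy_transform \<rho> z \<noteq> 0"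
    unfolding eventually_nhds_metric by blast
  define r where "r = min (d / 2) (min d' 1)"
  have r: "0 < r" "r \<le> d / 2" "r \<le> d'" "r \<le> 1" using d d' by (auto simp: r_def)
  obtain C0 where C0: "\<And>w. w \<in> \<Omega> \<Longrightarrow> cmod w \<le> 2 * cmod (H w) + C0" by (rule \<Omega>_bounded) blast
  \<comment> \<open>Bounds \<open>cmod (\<omega> z)\<close> for \<open>z\<close> within distance 1
    of \<open>x0\<close>, so that one \<open>c\<close> serves all points
    \<open>\<omega> z\<close>.\<close>
  define B where "B = 2 * (\<bar>x0\<bar> + 1) + C0"
  obtain c where c: "0 < c" "\<And>z. off_support \<nu> z \<Longrightarrow> cmod z \<le> B \<Longrightarrow> c \<le> cauchy_energy \<nu> z"
    by (rule nu.cauchy_energy_lower[of B]) blast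
  define A where "A = 4 * cauchy_energy \<rho> (of_real x0)"
  have A0: "0 \<le> A" using rho.cauchy.energy_nonneg by (simp add: A_def)
  define C where "C = A / c + A + A / c / t + 1"
  have C: "A / c \<le> C" "A \<le> C" "A / c / t \<le> C" "0 < C" using A0 c(1) t_pos by (simp_all add: C_def add_nonneg_pos)
  have main: "Im (\<omega> z) \<le> A / c * Im z" "cauchy_energy \<nu> (\<omega> z) \<le> A"
    "levy_energy \<sigma> (F_transform \<rho> z) \<le> A / c / t"
    if z: "dist z (of_real x0) < r" "Im z > 0" for z
  proof -
    have "cmod z \<le> \<bar>x0\<bar> + 1"
      using z r norm_triangle_sub[of z "of_real x0"] by (simp add: dist_norm)
    then have "cmod (\<omega> z) \<le> B" using C0[OF \<omega>_in[OF z(2)]] H_\<omega>[OF z(2)] by (simp add: B_def)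
    then have cE: "c \<le> cauchy_energy \<nu> (\<omega> z)"
      using Im_\<omega>(2)[OF z(2)] by (intro c(2) off_support_Im) auto
    have \<rho>A: "cauchy_energy \<rho> z \<le> A" unfolding A_def using z r by (intro d(3)) auto
    have "Im (\<omega> z) * c \<le> Im (\<omega> z) * cauchy_energy \<nu> (\<omega> z)"
      using cE Im_\<omega>(2)[OF z(2)] by (intro mult_left_mono) auto
    also have "\<dots> = Im z * cauchy_energy \<rho> z" by (rule energy_\<rho>[OF z(2)])
    also have "\<dots> \<le> Im z * A" using \<rho>A z by (intro mult_left_mono) auto
    finally show \<omega>A: "Im (\<omega> z) \<le> A / c * Im z" using c(1) by (simp add: field_simps)
    have "Im z * cauchy_energy \<nu> (\<omega> z) \<le> Im (\<omega> z) * cauchy_energy \<nu> (\<omega> z)"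
      using Im_\<omega>(1)[OF z(2)] nu.cauchy.energy_nonneg by (intro mult_right_mono) auto
    also have "\<dots> \<le> Im z * A" unfolding energy_\<rho>[OF z(2)] using \<rho>A z by (intro mult_left_mono) auto
    finally show "cauchy_energy \<nu> (\<omega> z) \<le> A" using z(2) by simp
    let ?F = "F_transform \<rho> z" and ?P = "levy_energy \<sigma> (F_transform \<rho> z)"
    have F: "Im z \<le> Im ?F" using rho.F_transform_pick(2)[OF z(2) z(2)] .
    have "Im (levy_transform \<gamma> \<sigma> ?F) = - Im ?F * ?P"
      using F z by (intro sg.levy.Im_T off_support_Im) simp
    then have "Im (\<omega> z) = Im z + t * (Im ?F * ?P)"
      using \<omega>_eq[OF z(2)] by simp
    then have "t * (Im ?F * ?P) \<le> A / c * Im z" using \<omega>A z by simp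
    moreover have "t * (Im z * ?P) \<le> t * (Im ?F * ?P)"
      using F t_pos sg.levy.energy_nonneg by (intro mult_left_mono mult_right_mono) auto
    ultimately have "Im z * (t * ?P) \<le> Im z * (A / c)" by (simp add: algebra_simps)
    then have "t * ?P \<le> A / c" using z(2) mult_le_cancel_left_pos by blast
    then show "?P \<le> A / c / t" using t_pos by (subst pos_le_divide_eq) (simp_all add: mult.commute)
  qed
  show thesis
  proof (rule that[OF r(1) C(4)])
    fix z assume z: "dist z (complex_of_real x0) < r"
    show "off_support \<rho> z" "cauchy_transform \<rho> z \<noteq> 0" using d(2) d'(2) z r by auto
    assume Im: "Im z > 0"
    have "A / c * Im z \<le> C * Im z" using C Im by (intro mult_right_mono) auto
    then show "Im (\<omega> z) \<le> C * Im z" using main(1)[OF z Im] by linarith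
    show "cauchy_energy \<nu> (\<omega> z) \<le> C" "levy_energy \<sigma> (F_transform \<rho> z) \<le> C"
      using main(2,3)[OF z Im] C by linarith+
  qed
qed

text \<open>The Levy energy stays bounded along \<open>F_transform \<rho> z\<close> for
  \<open>z\<close> near \<open>x0\<close>. Since \<open>G\<close> is strictly decreasing on the gap,
  real boundary values of \<open>F\<close> fill a neighbourhood of
  \<open>F_transform \<rho> x0\<close>, so the bounded-energy criterion applies to
  \<open>\<sigma>\<close>.\<close>

lemma F_\<rho>_off_support:
  assumes "x0 \<in> gap"
  shows "off_support \<sigma> (F_transform \<rho> (of_real x0))"
proof -
  obtain r C where r: "0 < r"
    "\<And>z. dist z (of_real x0) < r \<Longrightarrow> off_support \<rho> z"
    "\<And>z. dist z (of_real x0) < r \<Longrightarrow> cauchy_transform \<rho> z \<noteq> 0"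
    "\<And>z. dist z (of_real x0) < r \<Longrightarrow> Im z > 0 \<Longrightarrow> levy_energy \<sigma> (F_transform \<rho> z) \<le> C"
    by (rule near_gap[OF assms]) blast
  define g where "g x = Re (cauchy_transform \<rho> (complex_of_real x))" for x
  have G: "cauchy_transform \<rho> (of_real x) = of_real (g x)" "g x \<noteq> 0"
      "F_transform \<rho> (of_real x) = of_real (1 / g x)" if "x \<in> ball x0 r" for x
  proof -
    show *: "cauchy_transform \<rho> (of_real x) = of_real (g x)"
      using rho.cauchy.T_real[OF r(2)[OF real_in_ball[OF that]]] by (auto simp: g_def elim: Reals_cases)
    then show "g x \<noteq> 0" "F_transform \<rho> (of_real x) = of_real (1 / g x)"
      using r(3)[OF real_in_ball[OF that]] by (auto simp: F_transform_def)
  qed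
  have der: "(g has_real_derivative - cauchy_energy \<rho> (of_real x)) (at x)" if "x \<in> ball x0 r" for x
    unfolding g_def by (rule rho.cauchy.Re_T_has_real_derivative[OF r(2)[OF real_in_ball[OF that]]])
  have less: "g y < g x" if "x \<in> ball x0 r" "y \<in> ball x0 r" "x < y" for x y
  proof (rule DERIV_neg_imp_decreasing[OF that(3)])
    fix u assume "x \<le> u" "u \<le> y"
    then have u: "u \<in> ball x0 r" using that by (auto simp: dist_real_def)
    then show "\<exists>d. (g has_real_derivative d) (at u) \<and> d < 0"
      using der[OF u] rho.cauchy_energy_pos[OF r(2)[OF real_in_ball[OF u]]] by (intro exI conjI) auto
  qed
  define f where "f x = 1 / g x" for x
  have "continuous_on (ball x0 r) g"
    using der by (intro continuous_at_imp_continuous_on ballI DERIV_isCont)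
  then have "continuous_on (ball x0 r) f"
    unfolding f_def using G(2) by (intro continuous_intros) auto
  moreover have "inj_on f (ball x0 r)"
  proof (rule inj_onI)
    fix x y assume xy: "x \<in> ball x0 r" "y \<in> ball x0 r" "f x = f y"
    then have "g x = g y" by (simp add: f_def)
    then show "x = y" using less[of x y] less[of y x] xy by (metis less_irrefl linorder_neqE)
  qed
  ultimately obtain e where e: "e > 0" "ball (f x0) e \<subseteq> f ` ball x0 r"
    by (rule injective_image_ball[OF r(1)]) blast
  have "f x0 \<notin> measure_support \<sigma>"
  proof (rule sg.not_in_support_if_energy_bounded[OF e(1)])
    fix y \<delta> :: real assume "y \<in> ball (f x0) e" and \<delta>: "\<delta> > 0"
    then obtain x where x: "x \<in> ball x0 r" "y = f x" using e(2) by blast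
    have "isCont (F_transform \<rho>) (of_real x)"
      unfolding F_transform_def using r(2,3)[OF real_in_ball[OF x(1)]]
      by (intro continuous_intros rho.cauchy.isCont_T) auto
    then have "(\<lambda>n. F_transform \<rho> (Complex x (1 / real (Suc n)))) \<longlonglongrightarrow> F_transform \<rho> (of_real x)"
      by (rule isCont_tendsto_compose[OF _ vertical_limit])
    then have "(\<lambda>n. F_transform \<rho> (Complex x (1 / real (Suc n)))) \<longlonglongrightarrow> of_real y"
      using G(3)[OF x(1)] by (simp add: x f_def)
    then have "\<forall>\<^sub>F n in sequentially. dist (F_transform \<rho> (Complex x (1 / real (Suc n)))) (of_real y) < \<delta>"
      using \<delta> by (rule tendstoD)
    from eventually_conj[OF this eventually_near[OF x(1)]]
    obtain n where n: "dist (F_transform \<rho> (Complex x (1 / real (Suc n)))) (of_real y) < \<delta>"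
        "dist (Complex x (1 / real (Suc n))) (of_real x0) < r"
      using eventually_happens'[OF sequentially_bot] by blast
    let ?z = "Complex x (1 / real (Suc n))"
    have Im: "Im ?z > 0" by simp
    have ImF: "Im (F_transform \<rho> ?z) > 0" using rho.F_transform_pick(2)[OF Im Im] Im by linarith
    have "cauchy_energy \<sigma> (F_transform \<rho> ?z) \<le> levy_energy \<sigma> (F_transform \<rho> ?z)"
      using ImF by (intro sg.cauchy_energy_le_levy_energy off_support_Im) simp
    also have "\<dots> \<le> C" by (rule r(4)[OF n(2) Im])
    finally show "\<exists>z. Im z > 0 \<and> cmod (z - of_real y) < \<delta> \<and> cauchy_energy \<sigma> z \<le> C"
      using ImF n(1) by (intro exI[of _ "F_transform \<rho> ?z"]) (simp add: dist_norm)
  qed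
  then show ?thesis
    using G(3)[of x0] r(1) by (simp add: sg.off_support_of_real_iff f_def del: of_real_divide)
qed

text \<open>The boundary value of \<open>\<omega>\<close>, read off from \<open>\<omega>_eq\<close>;
  its right side extends continuously to gap points by \<open>F_\<rho>_off_support\<close>, so no
  limit enters the definition.\<close>

definition boundary :: "real \<Rightarrow> real" where
  "boundary x = Re (of_real x - of_real t * levy_transform \<gamma> \<sigma> (F_transform \<rho> (of_real x)))"

text \<open>The bounded-energy criterion is now applied to \<open>\<nu>\<close> along
  \<open>\<omega> z\<close>. The points \<open>boundary x\<close> fill a real neighbourhood because
  \<open>\<omega>\<close> shrinks distances by at most a factor of 2, which survives in the limit
  and makes \<open>boundary\<close> injective. The remaining claims follow by vertical
  limits.\<close>

lemma gap_regular:
  assumes "x0 \<in> gap"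
  shows "regular (of_real (boundary x0))" "K (of_real (boundary x0)) < 1"
    "H (of_real (boundary x0)) = of_real x0"
proof -
  obtain r C where r: "0 < r" "0 < C"
    "\<And>z. dist z (of_real x0) < r \<Longrightarrow> off_support \<rho> z"
    "\<And>z. dist z (of_real x0) < r \<Longrightarrow> cauchy_transform \<rho> z \<noteq> 0"
    "\<And>z. dist z (of_real x0) < r \<Longrightarrow> Im z > 0 \<Longrightarrow> Im (\<omega> z) \<le> C * Im z"
    "\<And>z. dist z (of_real x0) < r \<Longrightarrow> Im z > 0 \<Longrightarrow> cauchy_energy \<nu> (\<omega> z) \<le> C"
    by (rule near_gap[OF assms]) blast
  let ?v = "\<lambda>x n. Complex x (1 / real (Suc n))"
  have Im_v: "Im (?v x n) > 0" for x n by simp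
  have gap: "x \<in> gap" if "x \<in> ball x0 r" for x
    using r(3,4)[OF real_in_ball[OF that]] by (simp add: gap_def rho.off_support_of_real_iff)
  define e where "e z = z - of_real t * levy_transform \<gamma> \<sigma> (F_transform \<rho> z)" for z
  have cont: "isCont e (of_real x)" if "x \<in> ball x0 r" for x
  proof -
    have F: "isCont (F_transform \<rho>) (of_real x)"
      unfolding F_transform_def using r(3,4)[OF real_in_ball[OF that]]
      by (intro continuous_intros rho.cauchy.isCont_T) auto
    show ?thesis unfolding e_def
      by (intro continuous_intros isCont_o2[OF F] sg.levy.isCont_T F_\<rho>_off_support gap that)
  qed
  have e_real: "e (of_real x) = of_real (boundary x)" if "x \<in> ball x0 r" for x
  proof -
    have "off_support \<rho> (of_real x)" using r(3)[OF real_in_ball[OF that]] .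
    then have "F_transform \<rho> (of_real x) \<in> \<real>"
      unfolding F_transform_def using rho.cauchy.T_real by (auto elim!: Reals_cases)
    then obtain u where u: "F_transform \<rho> (of_real x) = of_real u" by (auto elim: Reals_cases)
    have "levy_transform \<gamma> \<sigma> (of_real u) \<in> \<real>"
      using F_\<rho>_off_support[OF gap[OF that]] u by (intro sg.levy.T_real) simp
    then show ?thesis unfolding e_def boundary_def u by (auto elim!: Reals_cases)
  qed
  have lim: "(\<lambda>n. \<omega> (?v x n)) \<longlonglongrightarrow> of_real (boundary x)" if "x \<in> ball x0 r" for x
  proof -
    have "(\<lambda>n. e (?v x n)) \<longlonglongrightarrow> e (of_real x)"
      by (rule isCont_tendsto_compose[OF cont[OF that] vertical_limit])
    moreover have "e (?v x n) = \<omega> (?v x n)" for n using \<omega>_eq[OF Im_v] by (simp only: e_def)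
    ultimately show ?thesis using e_real[OF that] by simp
  qed
  have expand: "\<bar>x - y\<bar> \<le> 2 * \<bar>boundary x - boundary y\<bar>" if xy: "x \<in> ball x0 r" "y \<in> ball x0 r" for x y
  proof -
    have "(\<lambda>n. 2 * cmod (\<omega> (?v x n) - \<omega> (?v y n))) \<longlonglongrightarrow> 2 * cmod (of_real (boundary x) - of_real (boundary y))"
      by (intro tendsto_intros lim xy)
    moreover have "\<bar>x - y\<bar> \<le> 2 * cmod (\<omega> (?v x n) - \<omega> (?v y n))" for n
    proof -
      have "\<bar>x - y\<bar> \<le> cmod (?v x n - ?v y n)" using abs_Re_le_cmod[of "?v x n - ?v y n"] by simp
      also have "\<dots> \<le> 2 * cmod (\<omega> (?v x n) - \<omega> (?v y n))"
        using \<Omega>_expanding(1)[OF \<omega>_in[OF Im_v] \<omega>_in[OF Im_v]] unfolding H_\<omega>[OF Im_v] .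
      finally show ?thesis .
    qed
    ultimately have "\<bar>x - y\<bar> \<le> 2 * cmod (complex_of_real (boundary x) - of_real (boundary y))"
      by (intro LIMSEQ_le_const[of "\<lambda>n. 2 * cmod (\<omega> (?v x n) - \<omega> (?v y n))"]) auto
    then show ?thesis by (simp flip: of_real_diff)
  qed
  have "continuous_on (ball x0 r) (\<lambda>x. Re (e (of_real x)))"
    by (intro continuous_at_imp_continuous_on ballI continuous_intros isCont_o2[of _ complex_of_real e] cont) auto
  then have "continuous_on (ball x0 r) boundary"
    by (rule continuous_on_eq) (simp add: e_def boundary_def)
  moreover have "inj_on boundary (ball x0 r)"
  proof (rule inj_onI)
    fix x y assume "x \<in> ball x0 r" "y \<in> ball x0 r" "boundary x = boundary y"
    then show "x = y" using expand[of x y] by simp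
  qed
  ultimately obtain d where d: "d > 0" "ball (boundary x0) d \<subseteq> boundary ` ball x0 r"
    by (rule injective_image_ball[OF r(1)]) blast
  have "boundary x0 \<notin> measure_support \<nu>"
  proof (rule nu.not_in_support_if_energy_bounded[OF d(1)])
    fix y \<delta> :: real assume "y \<in> ball (boundary x0) d" and \<delta>: "\<delta> > 0"
    then obtain x where x: "x \<in> ball x0 r" "y = boundary x" using d(2) by blast
    have "\<forall>\<^sub>F n in sequentially. dist (\<omega> (?v x n)) (of_real y) < \<delta>"
      using lim[OF x(1)] \<delta> unfolding x(2)[symmetric] by (rule tendstoD)
    from eventually_conj[OF this eventually_near[OF x(1)]]
    obtain n where n: "dist (\<omega> (?v x n)) (of_real y) < \<delta>" "dist (?v x n) (of_real x0) < r"
      using eventually_happens'[OF sequentially_bot] by blast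
    show "\<exists>z. Im z > 0 \<and> cmod (z - of_real y) < \<delta> \<and> cauchy_energy \<nu> z \<le> C"
      using n(1) Im_\<omega>(2)[OF Im_v] r(6)[OF n(2) Im_v] by (intro exI[of _ "\<omega> (?v x n)"]) (simp add: dist_norm)
  qed
  then have off: "off_support \<nu> (of_real (boundary x0))" by (simp add: nu.off_support_of_real_iff)
  have x0: "x0 \<in> ball x0 r" using r(1) by simp
  have "(\<lambda>n. cauchy_transform \<nu> (\<omega> (?v x0 n))) \<longlonglongrightarrow> cauchy_transform \<nu> (of_real (boundary x0))"
    by (rule isCont_tendsto_compose[OF nu.cauchy.isCont_T[OF off] lim[OF x0]])
  then have 1: "(\<lambda>n. cauchy_transform \<rho> (?v x0 n)) \<longlonglongrightarrow> cauchy_transform \<nu> (of_real (boundary x0))"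
    using G_\<rho>[OF Im_v] by simp
  have 2: "(\<lambda>n. cauchy_transform \<rho> (?v x0 n)) \<longlonglongrightarrow> cauchy_transform \<rho> (of_real x0)"
    by (rule isCont_tendsto_compose[OF rho.cauchy.isCont_T[OF r(3)[OF real_in_ball[OF x0]]] vertical_limit])
  have G_eq: "cauchy_transform \<nu> (of_real (boundary x0)) = cauchy_transform \<rho> (of_real x0)"
    using LIMSEQ_unique[OF 1 2] .
  then have "F_transform \<nu> (of_real (boundary x0)) = F_transform \<rho> (of_real x0)" by (simp add: F_transform_def)
  then show reg: "regular (of_real (boundary x0))"
    unfolding regular_def using off G_eq F_\<rho>_off_support[OF assms] assms by (simp add: gap_def)
  have "(\<lambda>n. H (\<omega> (?v x0 n))) \<longlonglongrightarrow> H (of_real (boundary x0))"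
    by (rule isCont_tendsto_compose[OF isCont_H[OF reg] lim[OF x0]])
  then have "(\<lambda>n. ?v x0 n) \<longlonglongrightarrow> H (of_real (boundary x0))" using H_\<omega>[OF Im_v] by simp
  then show "H (of_real (boundary x0)) = of_real x0" using vertical_limit LIMSEQ_unique by blast
  have limK: "(\<lambda>n. K (\<omega> (?v x0 n))) \<longlonglongrightarrow> K (of_real (boundary x0))"
    by (rule isCont_tendsto_compose[OF isCont_K[OF reg] lim[OF x0]])
  \<comment> \<open>\<open>Im w \<le> C * Im (H w)\<close> and
    \<open>Im (H w) = Im w * (1 - K w)\<close> keep \<open>K\<close> at a fixed distance below 1, so
    the strict inequality survives the limit.\<close>
  have "\<forall>\<^sub>F n in sequentially. K (\<omega> (?v x0 n)) \<le> 1 - 1 / C"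
    using eventually_near[OF x0]
  proof eventually_elim
    case (elim n)
    let ?w = "\<omega> (?v x0 n)"
    have w: "Im ?w > 0" using Im_\<omega>(2)[OF Im_v] .
    have "Im ?w \<le> C * Im (?v x0 n)" by (rule r(5)[OF elim Im_v])
    also have "Im (?v x0 n) = Im ?w * (1 - K ?w)"
      using Im_H[OF regular_upper[OF w]] unfolding H_\<omega>[OF Im_v] .
    finally have "Im ?w * 1 \<le> Im ?w * (C * (1 - K ?w))" by (simp add: algebra_simps)
    then have "1 \<le> C * (1 - K ?w)" using w mult_le_cancel_left_pos by blast
    then show ?case using r(2) by (simp add: field_simps)
  qed
  then have "K (of_real (boundary x0)) \<le> 1 - 1 / C"
    by (intro tendsto_upperbound[OF limK]) auto
  then show "K (of_real (boundary x0)) < 1" using r(2) by (smt (verit) divide_pos_pos)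
qed

text \<open>The reverse transfer. Near \<open>x0\<close> one has
  \<open>Im (H w) \<ge> c * Im w\<close>, so points just above the axis lie in
  \<open>\<Omega>\<close> and \<open>energy_\<rho>\<close> bounds the energy of
  \<open>\<rho>\<close> at \<open>H w\<close>. Injectivity of \<open>H\<close> on the real
  neighbourhood, from the Pick inequality with \<open>K < 1\<close>, makes the values fill an
  interval.\<close>

lemma H_not_in_support:
  assumes reg: "regular (complex_of_real x0)" and K: "K (of_real x0) < 1"
  shows "Re (H (of_real x0)) \<notin> measure_support \<rho>"
proof -
  \<comment> \<open>Half of the available margin, so that \<open>K w < 1 - c\<close> persists near
    \<open>x0\<close> by continuity.\<close>
  define c where "c = (1 - K (of_real x0)) / 2"
  have c: "0 < c" using K by (simp add: c_def)
  define C where "C = cauchy_energy \<nu> (of_real x0) + 1"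
  have off: "off_support \<nu> (of_real x0)" using reg by (simp add: regular_def)
  have lim: "(K \<longlongrightarrow> K (of_real x0)) (nhds (of_real x0))"
    "(cauchy_energy \<nu> \<longlongrightarrow> cauchy_energy \<nu> (of_real x0)) (nhds (of_real x0))"
    using isCont_K[OF reg] nu.cauchy.isCont_energy[OF off] by (simp_all add: isCont_def tendsto_at_iff_tendsto_nhds)
  have "K (of_real x0) < 1 - c" "cauchy_energy \<nu> (of_real x0) < C"
    using K by (simp_all add: c_def C_def field_simps)
  then have "\<forall>\<^sub>F w in nhds (of_real x0). K w < 1 - c" "\<forall>\<^sub>F w in nhds (of_real x0). cauchy_energy \<nu> w < C"
    using order_tendstoD(2)[OF lim(1)] order_tendstoD(2)[OF lim(2)] by blast+
  then have "\<forall>\<^sub>F w in nhds (of_real x0). regular w \<and> K w < 1 - c \<and> cauchy_energy \<nu> w < C"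
    by (intro eventually_conj eventually_regular[OF reg])
  then obtain r where r: "0 < r" "\<And>w. dist w (of_real x0) < r \<Longrightarrow> regular w \<and> K w < 1 - c \<and> cauchy_energy \<nu> w < C"
    unfolding eventually_nhds_metric by blast
  define h where "h x = Re (H (complex_of_real x))" for x
  have h: "H (of_real x) = of_real (h x)" if "x \<in> ball x0 r" for x
    using N_real r(2)[OF real_in_ball[OF that]] by (auto simp: h_def H_def elim!: Reals_cases)
  have "continuous_on (ball x0 r) h"
    unfolding h_def using r(2)[OF real_in_ball]
    by (intro continuous_at_imp_continuous_on ballI continuous_intros isCont_o2[of _ complex_of_real H] isCont_H) auto
  moreover have "inj_on h (ball x0 r)"
  proof (rule inj_onI, rule ccontr)
    fix x y assume xy: "x \<in> ball x0 r" "y \<in> ball x0 r" "h x = h y" "x \<noteq> y"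
    let ?x = "complex_of_real x" and ?y = "complex_of_real y"
    have "H ?x = H ?y" using h[OF xy(1)] h[OF xy(2)] xy(3) by simp
    then have "N ?x - N ?y = ?x - ?y" by (simp add: H_def algebra_simps)
    then have "cmod (?x - ?y) \<le> cmod (?x - ?y) * sqrt (K ?x * K ?y)"
      using pick[of ?x ?y] r(2)[OF real_in_ball[OF xy(1)]] r(2)[OF real_in_ball[OF xy(2)]] by simp
    moreover have "cmod (?x - ?y) > 0" using xy(4) by simp
    ultimately have "1 \<le> sqrt (K ?x * K ?y)" by simp
    then have "1 \<le> K ?x * K ?y" by simp
    moreover have "K ?x < 1" "K ?y < 1"
      using r(2)[OF real_in_ball[OF xy(1)]] r(2)[OF real_in_ball[OF xy(2)]] c by auto
    then have "K ?x * K ?y < 1 * 1" using K_nonneg by (intro mult_strict_mono') auto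
    ultimately show False by simp
  qed
  ultimately obtain d where d: "d > 0" "ball (h x0) d \<subseteq> h ` ball x0 r"
    by (rule injective_image_ball[OF r(1)]) blast
  have "h x0 \<notin> measure_support \<rho>"
  proof (rule rho.not_in_support_if_energy_bounded[OF d(1)])
    fix y \<delta> :: real assume "y \<in> ball (h x0) d" and \<delta>: "\<delta> > 0"
    then obtain x where x: "x \<in> ball x0 r" "y = h x" using d(2) by blast
    let ?v = "\<lambda>n. Complex x (1 / real (Suc n))"
    have "isCont H (of_real x)" using r(2)[OF real_in_ball[OF x(1)]] by (intro isCont_H) simp
    then have "(\<lambda>n. H (?v n)) \<longlonglongrightarrow> H (of_real x)" by (rule isCont_tendsto_compose[OF _ vertical_limit])
    then have "\<forall>\<^sub>F n in sequentially. dist (H (?v n)) (H (of_real x)) < \<delta>" using \<delta> by (rule tendstoD)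
    from eventually_conj[OF this eventually_near[OF x(1)]]
    obtain n where n: "dist (H (?v n)) (H (of_real x)) < \<delta>" "dist (?v n) (of_real x0) < r"
      using eventually_happens'[OF sequentially_bot] by blast
    define w where "w = ?v n"
    have w: "Im w > 0" "regular w" "K w < 1 - c" "cauchy_energy \<nu> w < C" using r(2)[OF n(2)] by (auto simp: w_def)
    have "Im w * c \<le> Im w * (1 - K w)" using w by (intro mult_left_mono) auto
    then have ImH: "Im w * c \<le> Im (H w)" using Im_H[OF w(2)] by simp
    moreover have "Im w * c > 0" using w c by simp
    ultimately have Hpos: "Im (H w) > 0" by linarith
    then have "\<omega> (H w) = w" using w by (intro \<omega>_H) (simp add: \<Omega>_def)
    then have eq: "Im (H w) * cauchy_energy \<rho> (H w) = Im w * cauchy_energy \<nu> w"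
      using energy_\<rho>[OF Hpos] by simp
    have "(Im w * c) * cauchy_energy \<rho> (H w) \<le> Im (H w) * cauchy_energy \<rho> (H w)"
      using ImH rho.cauchy.energy_nonneg by (intro mult_right_mono) auto
    also have "\<dots> \<le> Im w * C" unfolding eq using w by (intro mult_left_mono) auto
    finally have "Im w * (c * cauchy_energy \<rho> (H w)) \<le> Im w * C" by (simp add: mult.assoc)
    then have "c * cauchy_energy \<rho> (H w) \<le> C" using w(1) mult_le_cancel_left_pos by blast
    then have "cauchy_energy \<rho> (H w) \<le> C / c" using c by (simp add: pos_le_divide_eq mult.commute)
    then show "\<exists>z. Im z > 0 \<and> cmod (z - of_real y) < \<delta> \<and> cauchy_energy \<rho> z \<le> C / c"
      using Hpos n(1) h[OF x(1)] by (intro exI[of _ "H w"]) (simp add: dist_norm w_def x(2))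
  qed
  then show ?thesis by (simp add: h_def)
qed

text \<open>\<open>G\<close> has negative derivative off the support, so if it vanishes at a point
  of \<open>J\<close> it is nonzero slightly to the right, still in the open set
  \<open>J\<close>.\<close>

lemma gap_in_component:
  assumes J: "J \<in> components (- measure_support \<rho>)"
  obtains x where "x \<in> J" "x \<in> gap"
proof -
  have oJ: "open J" by (rule open_components[OF open_Compl[OF closed_measure_support] J])
  obtain x where x: "x \<in> J" using in_components_nonempty[OF J] by blast
  have sub: "J \<subseteq> - measure_support \<rho>" by (rule in_components_subset[OF J])
  then have off: "off_support \<rho> (of_real x)" using x by (auto simp: rho.off_support_of_real_iff)
  have "- cauchy_energy \<rho> (of_real x) < 0" using rho.cauchy_energy_pos[OF off] by simp
  from DERIV_neg_dec_right[OF rho.cauchy.Re_T_has_real_derivative[OF off] this]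
  obtain d where d: "d > 0" "\<And>h. 0 < h \<Longrightarrow> h < d \<Longrightarrow>
      Re (cauchy_transform \<rho> (of_real (x + h))) < Re (cauchy_transform \<rho> (of_real x))" by blast
  obtain e where e: "e > 0" "ball x e \<subseteq> J" using oJ x by (meson open_contains_ball)
  define h where "h = min d e / 2"
  have h: "0 < h" "h < d" "h < e" using d e by (auto simp: h_def)
  then have xh: "x + h \<in> J" using e by (auto simp: dist_real_def subset_iff)
  show thesis
  proof (cases "cauchy_transform \<rho> (of_real x) = 0")
    case True
    then have "cauchy_transform \<rho> (of_real (x + h)) \<noteq> 0" using d(2)[OF h(1,2)] by auto
    then show thesis using that[of "x + h"] xh sub by (auto simp: gap_def)
  next
    case False
    then show thesis using that[of x] x sub by (auto simp: gap_def)
  qed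
qed

theorem finite_components_support:
  assumes "finite (components (measure_support \<nu>))" "finite (components (measure_support \<sigma>))"
  shows "finite (components (measure_support \<rho>))"
proof -
  define W where "W = {p. regular (complex_of_real p)}"
  have W: "finite (components W)" unfolding W_def by (rule finite_components_regular[OF assms])
  let ?J = "components (- measure_support \<rho>)"
  have "\<forall>J\<in>?J. \<exists>x. x \<in> J \<and> x \<in> gap" by (meson gap_in_component)
  then obtain x where x: "\<And>J. J \<in> ?J \<Longrightarrow> x J \<in> J" "\<And>J. J \<in> ?J \<Longrightarrow> x J \<in> gap" by metis
  define L where "L J = connected_component_set W (boundary (x J))" for J
  have in_W: "boundary (x J) \<in> W" if "J \<in> ?J" for J
    using gap_regular(1)[OF x(2)[OF that]] by (simp add: W_def)
  \<comment> \<open>If two boundary points share a component of \<open>W\<close>, then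
    \<open>K < 1\<close> on the whole interval between them. Its image under \<open>H\<close> is
    connected, avoids the support and contains a point of each gap.\<close>
  have same: "J = J'" if J: "J \<in> ?J" "J' \<in> ?J" and eq: "L J = L J'"
    and le: "boundary (x J) \<le> boundary (x J')" for J J'
  proof -
    let ?p = "boundary (x J)" and ?q = "boundary (x J')"
    have "?p \<in> L J" "?q \<in> L J" using in_W J eq by (auto simp: L_def)
    then have sub: "{?p..?q} \<subseteq> W"
      using connected_connected_component[of W ?p] connected_component_subset[of W ?p]
      unfolding L_def connected_iff_interval by (meson atLeastAtMost_iff subset_eq)
    then have reg: "regular (complex_of_real y)" if "?p \<le> y" "y \<le> ?q" for y
      using that by (auto simp: W_def)
    have K: "K (complex_of_real y) < 1" if "?p \<le> y" "y \<le> ?q" for y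
      using K_less_1_between[OF reg gap_regular(2)[OF x(2)[OF J(1)]] gap_regular(2)[OF x(2)[OF J(2)]] that] .
    let ?h = "\<lambda>y. Re (H (complex_of_real y))"
    have "continuous_on {?p..?q} ?h"
      by (intro continuous_at_imp_continuous_on ballI continuous_intros isCont_o2[of _ complex_of_real H] isCont_H reg) auto
    then have conn: "connected (?h ` {?p..?q})" by (intro connected_continuous_image) auto
    have out: "?h ` {?p..?q} \<subseteq> - measure_support \<rho>"
      using H_not_in_support[OF reg K] by auto
    have "x J = ?h ?p" "x J' = ?h ?q" using gap_regular(3)[OF x(2)] J by simp_all
    then have mem: "x J \<in> ?h ` {?p..?q}" "x J' \<in> ?h ` {?p..?q}" using le by auto
    have "?h ` {?p..?q} \<subseteq> J" by (rule components_maximal[OF J(1) conn out]) (use mem x(1)[OF J(1)] in blast)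
    then have "x J' \<in> J" using mem by blast
    then show "J = J'" using components_eq[OF J] x(1)[OF J(2)] by blast
  qed
  have "inj_on L ?J"
  proof (rule inj_onI)
    fix J J' assume "J \<in> ?J" "J' \<in> ?J" "L J = L J'"
    then show "J = J'" using same[of J J'] same[of J' J] by (cases "boundary (x J) \<le> boundary (x J')") auto
  qed
  moreover have "L ` ?J \<subseteq> components W" using in_W by (auto simp: L_def components_def)
  ultimately have "finite ?J" using W by (meson finite_subset inj_on_finite)
  from finite_components_Compl[OF this] show ?thesis by simp
qed

end

theorem corollary3p11:
  fixes \<mu> :: "real \<Rightarrow> real measure" and \<sigma> \<nu> :: "real measure"
  assumes "free_convolution_semigroup \<mu>"
    and "is_free_levy_measure (\<mu> 1) \<sigma>"
    and "finite (components (measure_support \<sigma>))"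
    and "real_distribution \<nu>"
  shows "(\<forall>t\<ge>0. finite (components (measure_support (\<mu> t \<boxplus> \<nu>)))) \<longleftrightarrow>
         finite (components (measure_support \<nu>))"
proof -
  obtain \<gamma> where "semigroup_with_levy_measure \<mu> \<sigma> \<gamma>"
    by (rule ex_semigroup_with_levy_measure[OF assms(1,2)])
  then interpret semigroup_with_levy_measure \<mu> \<sigma> \<gamma> .
  have zero: "\<mu> 0 \<boxplus> \<nu> = \<nu>" by (rule free_convolution_0[OF assms(4)])
  have "finite (components (measure_support (\<mu> t \<boxplus> \<nu>)))"
    if \<nu>: "finite (components (measure_support \<nu>))" and t: "0 < t" for t
  proof -
    have t0: "0 \<le> t" using t by simp
    have "subordination \<nu> \<sigma> t"
      by (intro subordination.intro assms(4) levy_measure subordination_axioms.intro t0)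
    moreover note free_convolution_subordination[OF assms(4) t0]
    ultimately have "subordinated \<nu> \<sigma> \<gamma> t (\<mu> t \<boxplus> \<nu>)"
      by (intro subordinated.intro subordinated_axioms.intro t)
    then show ?thesis using \<nu> assms(3) by (rule subordinated.finite_components_support)
  qed
  then show ?thesis using zero by (metis less_eq_real_def order_refl)
qed

end
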